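(* Fix $L>0$ and let $\mathcal{F}_L=\{g\in C^1(\mathbb{R}^d):\kappa_g(r)\ge-r^{-1}f_L(r)\ \forall r>0\}$. Then for all $0\le t\le T<+\infty$: if $g\in\mathcal{F}_L$ then $U^{T,g}_t\in\mathcal{F}_L$.
   Context: For a differentiable $U:\mathbb{R}^d\to\mathbb{R}$ and $r>0$, $\kappa_U(r)=\inf\{|x-y|^{-2}\langle\nabla U(x)-\nabla U(y),x-y\rangle:|x-y|=r\}$. For $L>0$, $f_L(r)=2L^{1/2}\tanh(rL^{1/2}/2)$, $r\ge0$. For a function $g$ and $0\le t<T$, $U^{T,g}_t(x)=-\log\Big((2\pi(T-t))^{-d/2}\int\exp\big(-\tfrac{|y-x|^2}{2(T-t)}-g(y)\big)\mathrm{d}y\Big)$, and $U^{T,g}_T=g$; this is the solution of the HJB equation $\partial_t\varphi_t+\frac12\Delta\varphi_t-\frac12|\nabla\varphi_t|^2=0$, $\varphi_T=g$. *)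

theory Defs
  imports "HOL-Analysis.Analysis"
begin

definition grad :: "('a::euclidean_space \<Rightarrow> real) \<Rightarrow> 'a \<Rightarrow> 'a" where
  "grad U x = (THE v. (U has_derivative (\<lambda>h. v \<bullet> h)) (at x))"

definition C1 :: "('a::euclidean_space \<Rightarrow> real) \<Rightarrow> bool" where
  "C1 U \<longleftrightarrow> (\<exists>G. (\<forall>x. (U has_derivative (\<lambda>h. G x \<bullet> h)) (at x)) \<and> continuous_on UNIV G)"

text \<open>kappa_U(r), an infimum taken in the extended reals (it may be -infinity).\<close>
definition kappa :: "('a::euclidean_space \<Rightarrow> real) \<Rightarrow> real \<Rightarrow> ereal" where
  "kappa U r = (INF p \<in> {(x, y). norm (x - y) = r}.
      ereal (((grad U (fst p) - grad U (snd p)) \<bullet> (fst p - snd p)) / (norm (fst p - snd p))\<^sup>2))"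

definition fL :: "real \<Rightarrow> real \<Rightarrow> real" where
  "fL L r = 2 * sqrt L * tanh (r * sqrt L / 2)"

definition FL :: "real \<Rightarrow> ('a::euclidean_space \<Rightarrow> real) set" where
  "FL L = {g. C1 g \<and> (\<forall>r>0. kappa g r \<ge> ereal (- fL L r / r))}"

definition UTg :: "real \<Rightarrow> ('a::euclidean_space \<Rightarrow> real) \<Rightarrow> real \<Rightarrow> 'a \<Rightarrow> real" where
  "UTg T g t x = (if t = T then g x else
     - ln ((2 * pi * (T - t)) powr (- real DIM('a) / 2) *
        (\<integral>y. exp (- (norm (y - x))\<^sup>2 / (2 * (T - t)) - g y) \<partial>lborel)))"

end

theory Submission
  imports Defs
begin

text \<open>
  Write \<open>p(\<tau>,x)\<close> for the gradient of the solution at time \<open>T - \<tau>\<close>; it solves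
  \<open>p\<^sub>\<tau> = \<Delta>p / 2 - Dp[p]\<close>.  With \<open>r = |x - y|\<close> and \<open>e = (x - y) / r\<close>, the two-point function
  \<open>W = \<langle>p(x) - p(y), e\<rangle> + f(r)\<close> obeys a differential inequality \<open>W\<^sub>\<tau> \<ge> A W + f'(r) W\<close>,
  where \<open>A\<close> is the generator of two copies of the diffusion with drift \<open>-p\<close> coupled by reflection:
  its second order part only uses the directions \<open>(e,-e)\<close> and \<open>(b,b)\<close> with \<open>b \<bottom> e\<close>, along which
  \<open>e\<close> is constant, and \<open>2f'' + ff' = 0\<close> cancels the remaining terms.  A maximum principle
  for \<open>W + \<epsilon> exp(b\<tau>)(1 + |x|\<^sup>2 + |y|\<^sup>2)\<close> then propagates \<open>W \<ge> 0\<close> from \<open>\<tau> = 0\<close>.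

  The maximum principle needs growth and Lipschitz bounds on \<open>p\<close> that are uniform as \<open>\<tau> \<rightarrow> 0\<close>.
  They hold if \<open>\<nabla>g\<close> is Lipschitz, since \<open>p\<close> is the mean of \<open>\<nabla>g\<close> under a probability measure
  that concentrates at \<open>x\<close>.  A general \<open>g\<close> is approximated by its Moreau envelopes, which have
  Lipschitz gradients and belong to the class for the constant \<open>L / (1 - \<lambda>L)\<^sup>2\<close>.
\<close>

section \<open>The class of potentials\<close>

text \<open>The function f = \<open>fL L\<close> is the solution with f(0) = 0 of the Riccati
  equation f' + f^2/4 = L; differentiating it gives 2 f'' + f f' = 0. The two terms have different
  origins: reflection changes r at speed 2, so half the second derivative of f(r) is 2 f'', while
  the drift changes r at the rate -<p(x) - p(y), e> = f - W, which yields f f' and leaves -f' W. A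
  synchronous coupling would produce no f''. The relation for W is only an inequality because the
  drift rotates e; the loss (|D|^2 - <D, e>^2) / r with D = p(x) - p(y) has a sign by
  Cauchy-Schwarz. Two obstacles shape the rest. The direction e is undefined on the diagonal, and on
  a noncompact space a minimum may not exist. A penalty with a constant and a quadratic part removes
  both, provided p is Lipschitz on balls and of linear growth, uniformly in time. Potentials such as
  |x|^4 violate this at time 0, hence the regularisation. Its limit is taken in a formula for p that
  contains g but not the gradient of g, so pointwise convergence of the potentials suffices.\<close>

definition fL_monotone :: "real \<Rightarrow> ('a::euclidean_space \<Rightarrow> 'a) \<Rightarrow> bool" where
  "fL_monotone L G \<longleftrightarrow>
     (\<forall>x y. - (norm (x - y) * fL L (norm (x - y))) \<le> (G x - G y) \<bullet> (x - y))"

lemma grad_eq: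
  assumes "(U has_derivative (\<lambda>h. v \<bullet> h)) (at x)"
  shows "grad U x = v"
  unfolding grad_def
proof (rule the_equality)
  show "(U has_derivative (\<lambda>h. v \<bullet> h)) (at x)" by (rule assms)
  fix w assume "(U has_derivative (\<lambda>h. w \<bullet> h)) (at x)"
  from has_derivative_unique[OF this assms] have "w \<bullet> h = v \<bullet> h" for h by meson
  then show "w = v" by (metis vector_eq_rdot)
qed

text \<open>Multiplying by |x - y|^2 removes the division and the extended reals: the bound on the
  infimum becomes a family of inequalities that is trivial on the diagonal and closed under
  pointwise limits of \<open>G\<close>. The gradient is carried as a function \<open>G\<close>
  because \<open>grad\<close> is a definite description.\<close>

lemma FL_iff:
  "g \<in> FL L \<longleftrightarrow> (\<exists>G. (\<forall>x. (g has_derivative (\<lambda>h. G x \<bullet> h)) (at x)) \<and>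
     continuous_on UNIV G \<and> fL_monotone L G)"
proof -
  have key: "(\<forall>r>0. kappa g r \<ge> ereal (- fL L r / r)) \<longleftrightarrow> fL_monotone L G"
    if G: "\<And>x. (g has_derivative (\<lambda>h. G x \<bullet> h)) (at x)" for G
  proof -
    have gr: "grad g x = G x" for x by (rule grad_eq[OF G])
    have "(\<forall>r>0. kappa g r \<ge> ereal (- fL L r / r)) \<longleftrightarrow>
      (\<forall>x y. x \<noteq> y \<longrightarrow> - fL L (norm (x - y)) / norm (x - y)
          \<le> ((G x - G y) \<bullet> (x - y)) / (norm (x - y))\<^sup>2)"
      unfolding kappa_def le_INF_iff by (auto simp: gr)
    also have "\<dots> \<longleftrightarrow> fL_monotone L G"
    proof -
      have "- fL L (norm (x - y)) / norm (x - y) \<le> ((G x - G y) \<bullet> (x - y)) / (norm (x - y))\<^sup>2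
         \<longleftrightarrow> - (norm (x - y) * fL L (norm (x - y))) \<le> (G x - G y) \<bullet> (x - y)" if "x \<noteq> y" for x y
      proof -
        have "norm (x - y) > 0" using that by simp
        then show ?thesis by (simp add: field_simps power2_eq_square)
      qed
      moreover have "- (norm (x - x) * fL L (norm (x - x))) \<le> (G x - G x) \<bullet> (x - x)" for x by simp
      ultimately show ?thesis unfolding fL_monotone_def by metis
    qed
    finally show ?thesis .
  qed
  show ?thesis unfolding FL_def C1_def using key by auto
qed

section \<open>Elementary bounds and derivatives of f_L\<close>

lemma tanh_le_self:
  fixes r :: real
  assumes "0 \<le> r" shows "tanh r \<le> r"
proof -
  have "(\<lambda>x. x - tanh x) 0 \<le> (\<lambda>x. x - tanh x) r"
  proof (rule DERIV_nonneg_imp_nondecreasing[OF assms])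
    fix x :: real
    have "((\<lambda>x. x - tanh x) has_real_derivative 1 - (1 - tanh x ^ 2)) (at x)"
      by (auto intro!: derivative_eq_intros)
    moreover have "1 - (1 - tanh x ^ 2) \<ge> 0" by simp
    ultimately show "\<exists>y. ((\<lambda>x. x - tanh x) has_real_derivative y) (at x) \<and> 0 \<le> y" by blast
  qed
  then show ?thesis by simp
qed

lemma fL_zero [simp]: "fL L 0 = 0"
  by (simp add: fL_def)

lemma fL_nonneg: "L > 0 \<Longrightarrow> 0 \<le> r \<Longrightarrow> 0 \<le> fL L r"
  by (simp add: fL_def)

lemma fL_le_linear: assumes "L > 0" "0 \<le> r" shows "fL L r \<le> L * r"
proof -
  have "fL L r \<le> 2 * sqrt L * (r * sqrt L / 2)"
    unfolding fL_def using assms by (intro mult_left_mono tanh_le_self) auto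
  also have "\<dots> = L * r" using assms by simp
  finally show ?thesis .
qed

lemma fL_le_bound: assumes "L > 0" shows "fL L r \<le> 2 * sqrt L"
proof -
  have "fL L r \<le> 2 * sqrt L * 1"
    unfolding fL_def using assms by (intro mult_left_mono less_imp_le[OF tanh_real_lt_1]) auto
  then show ?thesis by simp
qed

lemma has_derivative_fL:
  "(fL L has_real_derivative (sqrt L)\<^sup>2 * (1 - (tanh (r * sqrt L / 2))\<^sup>2)) (at r)"
  unfolding fL_def by (auto intro!: derivative_eq_intros simp: power2_eq_square)

lemma continuous_on_fL [continuous_intros]:
  "continuous_on S f \<Longrightarrow> continuous_on S (\<lambda>x. fL L (f x))"
  unfolding fL_def by (intro continuous_intros) auto

text \<open>This is the equation 2 f'' + f f' = 0 on which the cancellation in the maximum principle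
  rests. Keeping \<open>(sqrt L)\<^sup>2\<close> instead of L makes the formula valid for either
  sign of L.\<close>

lemma has_derivative_fL':
  "((\<lambda>r. (sqrt L)\<^sup>2 * (1 - (tanh (r * sqrt L / 2))\<^sup>2)) has_real_derivative
     - (fL L r / 2) * ((sqrt L)\<^sup>2 * (1 - (tanh (r * sqrt L / 2))\<^sup>2))) (at r)"
  unfolding fL_def by (auto intro!: derivative_eq_intros simp: power2_eq_square algebra_simps)

text \<open>Replacing L by L / c^2 multiplies the slope inside tanh by 1 / c, which compensates
  exactly for s <= r / c; the prefactor grows as well because c <= 1. The Moreau envelopes use it
  with c = 1 - l L.\<close>

lemma fL_scale_le:
  assumes "L > 0" "0 < c" "c \<le> 1" "0 \<le> s" "c * s \<le> r"
  shows "fL L s \<le> fL (L / c\<^sup>2) r"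
proof -
  have sq: "sqrt (L / c\<^sup>2) = sqrt L / c" using assms by (simp add: real_sqrt_divide)
  have "s * sqrt L \<le> r * (sqrt L / c)"
  proof -
    have "s \<le> r / c" using assms by (simp add: field_simps)
    then have "s * sqrt L \<le> r / c * sqrt L" using assms by (intro mult_right_mono) auto
    then show ?thesis by simp
  qed
  then have "tanh (s * sqrt L / 2) \<le> tanh (r * (sqrt L / c) / 2)"
    by simp
  moreover have "sqrt L \<le> sqrt L / c" using assms by (simp add: field_simps)
  ultimately show ?thesis unfolding fL_def sq
    using assms by (intro mult_mono) auto
qed

lemma fL_monotone_lower:
  assumes "L > 0" "fL_monotone L G"
  shows "- (2 * sqrt L * norm (x - y)) \<le> (G x - G y) \<bullet> (x - y)"
proof -
  have "norm (x - y) * fL L (norm (x - y)) \<le> norm (x - y) * (2 * sqrt L)"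
    by (intro mult_left_mono fL_le_bound assms) auto
  then show ?thesis using assms(2) unfolding fL_monotone_def by (smt (verit) mult.commute)
qed

text \<open>The boundedness of f_L is what counts: along a ray the derivative of g is bounded below
  by a constant, so g decreases at most linearly and exp(-g) is integrable against every Gaussian.
  From \<open>fL_le_linear\<close> alone only a quadratic lower bound would follow, too weak for
  Gaussians of variance 1 / L or more.\<close>

lemma potential_lower_bound:
  assumes "L > 0" "fL_monotone L G" and g: "\<And>x. (g has_derivative (\<lambda>h. G x \<bullet> h)) (at x)"
  shows "g y \<ge> g 0 - (norm (G 0) + 2 * sqrt L) * norm y"
proof (cases "y = 0")
  case False
  have d: "((\<lambda>s. g (s *\<^sub>R y)) has_real_derivative G (s *\<^sub>R y) \<bullet> y) (at s)" for s
    unfolding has_field_derivative_def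
    by (rule has_derivative_compose[OF _ g, of "\<lambda>s. s *\<^sub>R y" "\<lambda>s. s *\<^sub>R y", THEN has_derivative_eq_rhs])
       (auto intro!: derivative_eq_intros)
  have "\<exists>z>0. z < 1 \<and> g (1 *\<^sub>R y) - g (0 *\<^sub>R y) = (1 - 0) * (G (z *\<^sub>R y) \<bullet> y)"
    by (rule MVT2) (use d in auto)
  then obtain z :: real where z: "z > 0" "g y - g 0 = G (z *\<^sub>R y) \<bullet> y" by auto
  have "- (2 * sqrt L * norm (z *\<^sub>R y - 0)) \<le> (G (z *\<^sub>R y) - G 0) \<bullet> (z *\<^sub>R y - 0)"
    by (rule fL_monotone_lower[OF assms(1,2)])
  then have "z * (- (2 * sqrt L * norm y)) \<le> z * ((G (z *\<^sub>R y) - G 0) \<bullet> y)"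
    using z by (simp add: algebra_simps)
  then have "- (2 * sqrt L * norm y) \<le> (G (z *\<^sub>R y) - G 0) \<bullet> y"
    using z(1) by (simp only: mult_le_cancel_left_pos)
  moreover have "- (norm (G 0) * norm y) \<le> G 0 \<bullet> y"
    using Cauchy_Schwarz_ineq2[of "G 0" y] by linarith
  ultimately show ?thesis using z(2) by (simp add: algebra_simps)
qed auto

section \<open>Differentiation under the integral sign\<close>

text \<open>The derivative bound on the whole ball gives, by the mean value inequality, a Lipschitz
  bound for the integrand with constant \<open>B y\<close>; the normalised remainder is then
  dominated by \<open>2 * B y\<close> and tends to 0 pointwise. The parameter space is arbitrary so
  that points, times and translation lengths can all play its role.\<close>

lemma has_derivative_integral_dominated:
  fixes F :: "'p::real_normed_vector \<Rightarrow> 'm \<Rightarrow> 'b::{banach, second_countable_topology}"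
  assumes e: "e > 0"
    and int: "\<And>x. x \<in> ball x0 e \<Longrightarrow> integrable M (F x)"
    and der: "\<And>x y. x \<in> ball x0 e \<Longrightarrow> ((\<lambda>x. F x y) has_derivative F' x y) (at x)"
    and bnd: "\<And>x y h. x \<in> ball x0 e \<Longrightarrow> norm (F' x y h) \<le> B y * norm h"
    and B: "integrable M B" and B0: "\<And>y. 0 \<le> B y"
    and meas: "\<And>h. (\<lambda>y. F' x0 y h) \<in> borel_measurable M"
  shows "((\<lambda>x. \<integral>y. F x y \<partial>M) has_derivative (\<lambda>h. \<integral>y. F' x0 y h \<partial>M)) (at x0)"
proof -
  have x0: "x0 \<in> ball x0 e" using e by simp
  have intF': "integrable M (\<lambda>y. F' x0 y h)" for h
  proof (rule Bochner_Integration.integrable_bound)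
    show "integrable M (\<lambda>y. B y * norm h)" using B by simp
    show "AE y in M. norm (F' x0 y h) \<le> norm (B y * norm h)"
      using bnd[OF x0] B0 by (auto simp: abs_mult)
  qed (rule meas)
  have lin: "linear (F' x0 y)" for y using der[OF x0] has_derivative_linear by blast
  have bl: "bounded_linear (\<lambda>h. \<integral>y. F' x0 y h \<partial>M)"
  proof (rule bounded_linear_intro)
    show "(\<integral>y. F' x0 y (a + b) \<partial>M) = (\<integral>y. F' x0 y a \<partial>M) + (\<integral>y. F' x0 y b \<partial>M)" for a b
      by (simp add: linear_add[OF lin] intF')
    show "(\<integral>y. F' x0 y (r *\<^sub>R a) \<partial>M) = r *\<^sub>R (\<integral>y. F' x0 y a \<partial>M)" for r a
      by (simp add: linear_cmul[OF lin])
    show "norm (\<integral>y. F' x0 y h \<partial>M) \<le> norm h * (\<integral>y. B y \<partial>M)" for h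
    proof -
      have "norm (\<integral>y. F' x0 y h \<partial>M) \<le> (\<integral>y. B y * norm h \<partial>M)"
        by (rule order_trans[OF integral_norm_bound integral_mono]) (use B bnd[OF x0] intF' in auto)
      then show ?thesis by (simp add: mult.commute)
    qed
  qed
  \<comment> \<open>The remainder divided by |x - x0|; at x = x0 it is 0 because 1 / 0 = 0.\<close>
  define Q where "Q x y = (1 / norm (x - x0)) *\<^sub>R (F x y - F x0 y - F' x0 y (x - x0))" for x y
  have lip: "norm (F x y - F x0 y) \<le> B y * norm (x - x0)" if "x \<in> ball x0 e" for x y
  proof (rule differentiable_bound[where S = "ball x0 e" and f' = "\<lambda>x. F' x y"])
    show "onorm (F' z y) \<le> B y" if "z \<in> ball x0 e" for z
      by (rule onorm_bound) (use B0 bnd[OF that] in auto)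
  qed (use that x0 der in \<open>auto intro: has_derivative_at_withinI\<close>)
  have Qb: "norm (Q x y) \<le> 2 * B y" if "x \<in> ball x0 e" for x y
  proof (cases "x = x0")
    case False
    have "norm (F x y - F x0 y - F' x0 y (x - x0)) \<le> 2 * B y * norm (x - x0)"
      using lip[OF that, of y] bnd[OF x0, of y "x - x0"]
        norm_triangle_ineq4[of "F x y - F x0 y" "F' x0 y (x - x0)"] by linarith
    then show ?thesis using False by (simp add: Q_def pos_divide_le_eq)
  qed (use B0 in \<open>simp add: Q_def\<close>)
  have Qint: "integrable M (Q x)" if "x \<in> ball x0 e" for x
    unfolding Q_def using int[OF that] int[OF x0] intF' by auto
  have "((\<lambda>x. \<integral>y. Q x y \<partial>M) \<longlongrightarrow> 0) (at x0)"
    unfolding tendsto_at_iff_sequentially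
  proof (intro allI impI)
    fix X :: "nat \<Rightarrow> 'p" assume X: "\<forall>i. X i \<in> UNIV - {x0}" "X \<longlonglongrightarrow> x0"
    \<comment> \<open>Dominated convergence asks for the bound at every index, so the sequence is
      shifted until it stays in the ball.\<close>
    obtain N where N: "\<And>n. n \<ge> N \<Longrightarrow> X n \<in> ball x0 e"
      using X(2) e unfolding lim_sequentially by (metis dist_commute mem_ball)
    have "(\<lambda>n. \<integral>y. Q (X (n + N)) y \<partial>M) \<longlonglongrightarrow> (\<integral>y. 0 \<partial>M)"
    proof (rule integral_dominated_convergence[where w = "\<lambda>y. 2 * B y"])
      show "AE y in M. (\<lambda>n. Q (X (n + N)) y) \<longlonglongrightarrow> 0"
      proof (rule AE_I2)
        fix y
        have "((\<lambda>x. Q x y) \<longlongrightarrow> 0) (at x0)"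
          using der[OF x0, of y] unfolding has_derivative_iff_norm Q_def
          by (subst tendsto_norm_zero_iff[symmetric]) (simp add: divide_inverse mult.commute)
        then have "(\<lambda>n. Q (X n) y) \<longlonglongrightarrow> 0"
          using X unfolding tendsto_at_iff_sequentially comp_def by blast
        then show "(\<lambda>n. Q (X (n + N)) y) \<longlonglongrightarrow> 0" by (rule LIMSEQ_ignore_initial_segment)
      qed
      show "AE y in M. norm (Q (X (n + N)) y) \<le> 2 * B y" for n
        using Qb[OF N] by auto
      show "Q (X (n + N)) \<in> borel_measurable M" for n
        using Qint[OF N, of "n + N"] by auto
    qed (use B in auto)
    then have "(\<lambda>n. \<integral>y. Q (X (n + N)) y \<partial>M) \<longlonglongrightarrow> 0" by simp
    then show "((\<lambda>x. \<integral>y. Q x y \<partial>M) \<circ> X) \<longlonglongrightarrow> 0"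
      unfolding comp_def by (rule LIMSEQ_offset)
  qed
  moreover have "\<forall>\<^sub>F x in at x0. (\<integral>y. Q x y \<partial>M) = (1 / norm (x - x0)) *\<^sub>R
      ((\<integral>y. F x y \<partial>M) - (\<integral>y. F x0 y \<partial>M) - (\<integral>y. F' x0 y (x - x0) \<partial>M))"
  proof -
    have "\<forall>\<^sub>F x in at x0. x \<in> ball x0 e" using e
      unfolding eventually_at by (auto simp: dist_commute)
    then show ?thesis
    proof eventually_elim
      case (elim x)
      show ?case unfolding Q_def
        by (simp add: int[OF elim] int[OF x0] intF')
    qed
  qed
  ultimately have "((\<lambda>x. (1 / norm (x - x0)) *\<^sub>R
      ((\<integral>y. F x y \<partial>M) - (\<integral>y. F x0 y \<partial>M) - (\<integral>y. F' x0 y (x - x0) \<partial>M))) \<longlongrightarrow> 0) (at x0)"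
    using tendsto_cong by force
  then have "((\<lambda>x. norm ((1 / norm (x - x0)) *\<^sub>R
      ((\<integral>y. F x y \<partial>M) - (\<integral>y. F x0 y \<partial>M) - (\<integral>y. F' x0 y (x - x0) \<partial>M)))) \<longlongrightarrow> 0) (at x0)"
    by (rule tendsto_norm_zero)
  then show ?thesis unfolding has_derivative_iff_norm using bl
    by (simp add: divide_inverse mult.commute)
qed

text \<open>Since the 1-norm is at most d times the Euclidean norm, exp(-|y|) lies below a product
  of one-dimensional functions exp(-|t| / d), whose integral factorises.\<close>

lemma integrable_exp_neg_norm:
  "integrable lborel (\<lambda>y::'a::euclidean_space. exp (- norm y))"
proof -
  let ?d = "real DIM('a)"
  define f :: "real \<Rightarrow> real" where "f t = exp (- \<bar>t\<bar> / ?d)" for t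
  have fm [measurable]: "f \<in> borel_measurable borel" unfolding f_def by measurable
  have half: "(\<integral>\<^sup>+t. ennreal (exp (- t / ?d)) * indicator {0..} t \<partial>lborel) = ennreal ?d"
  proof -
    have "(\<integral>\<^sup>+t. ennreal (exp (- t / ?d)) * indicator {0..} t \<partial>lborel) = ennreal (0 - (- ?d * exp (- 0 / ?d)))"
    proof (rule nn_integral_FTC_atLeast)
      show "((\<lambda>t. - ?d * exp (- t / ?d)) has_real_derivative exp (- x / ?d)) (at x)" for x
        by (auto intro!: derivative_eq_intros)
      have "filterlim (\<lambda>t::real. t / ?d) at_top at_top"
        by (rule filterlim_tendsto_pos_mult_at_top[of "\<lambda>_. 1 / ?d" "1/?d" _ "\<lambda>t. t", simplified])
           (auto simp: filterlim_ident)
      then have "filterlim (\<lambda>t::real. - (t / ?d)) at_bot at_top"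
        by (simp add: filterlim_uminus_at_top)
      then have "((\<lambda>t. exp (- (t / ?d))) \<longlongrightarrow> 0) at_top"
        by (rule filterlim_compose[OF exp_at_bot])
      then have "((\<lambda>t. - ?d * exp (- (t / ?d))) \<longlongrightarrow> - ?d * 0) at_top"
        by (intro tendsto_intros)
      then show "((\<lambda>t. - ?d * exp (- t / ?d)) \<longlongrightarrow> 0) at_top" by simp
    qed auto
    also have "0 - (- ?d * exp (- 0 / ?d)) = ?d" by simp
    finally show ?thesis .
  qed
  have half': "(\<integral>\<^sup>+t. ennreal (exp (t / ?d)) * indicator {..0} t \<partial>lborel) = ennreal ?d"
  proof -
    have "(\<integral>\<^sup>+t. ennreal (exp (t / ?d)) * indicator {..0} t \<partial>lborel) =
       (\<integral>\<^sup>+t. ennreal (exp ((0 + (-1) * t) / ?d)) * indicator {..0} (0 + (-1) * t) \<partial>lborel)"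
      by (subst nn_integral_real_affine[where c = "-1" and t = 0]) auto
    also have "\<dots> = (\<integral>\<^sup>+t. ennreal (exp (- t / ?d)) * indicator {0..} t \<partial>lborel)"
      by (intro nn_integral_cong) (auto simp: indicator_def)
    finally show ?thesis using half by simp
  qed
  have one: "(\<integral>\<^sup>+t. ennreal (f t) \<partial>lborel) < \<infinity>"
  proof -
    have "(\<integral>\<^sup>+t. ennreal (f t) \<partial>lborel) \<le>
       (\<integral>\<^sup>+t. ennreal (exp (- t / ?d)) * indicator {0..} t + ennreal (exp (t / ?d)) * indicator {..0} t \<partial>lborel)"
      by (intro nn_integral_mono) (auto simp: f_def indicator_def)
    also have "\<dots> = ennreal ?d + ennreal ?d"
      by (subst nn_integral_add) (measurable, simp only: half half')
    finally show ?thesis by (simp add: le_less_trans)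
  qed
  have "(\<integral>\<^sup>+(y::'a). ennreal (exp (- norm y)) \<partial>lborel) \<le> (\<integral>\<^sup>+(y::'a). (\<Prod>b\<in>Basis. ennreal (f (y \<bullet> b))) \<partial>lborel)"
  proof (intro nn_integral_mono)
    fix y :: 'a
    have "(\<Sum>b\<in>Basis. \<bar>y \<bullet> b\<bar>) \<le> (\<Sum>b\<in>(Basis::'a set). norm y)"
      by (intro sum_mono) (simp add: Basis_le_norm)
    then have "(\<Sum>b\<in>Basis. \<bar>y \<bullet> b\<bar>) / ?d \<le> norm y"
      by (simp add: field_simps)
    then have "exp (- norm y) \<le> exp (\<Sum>b\<in>Basis. - \<bar>y \<bullet> b\<bar> / ?d)"
      by (simp add: sum_negf sum_divide_distrib[symmetric])
    also have "\<dots> = (\<Prod>b\<in>Basis. f (y \<bullet> b))"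
      unfolding f_def by (simp add: exp_sum)
    finally have "ennreal (exp (- norm y)) \<le> ennreal (\<Prod>b\<in>Basis. f (y \<bullet> b))"
      by (rule ennreal_leI)
    also have "\<dots> = (\<Prod>b\<in>Basis. ennreal (f (y \<bullet> b)))"
      by (subst prod_ennreal) (auto simp: f_def)
    finally show "ennreal (exp (- norm y)) \<le> (\<Prod>b\<in>Basis. ennreal (f (y \<bullet> b)))" .
  qed
  also have "\<dots> = (\<Prod>b\<in>(Basis::'a set). \<integral>\<^sup>+t. ennreal (f t) \<partial>lborel)"
    by (rule nn_integral_lborel_prod) auto
  also have "\<dots> < \<infinity>" using one by (simp add: power_less_top_ennreal)
  finally show ?thesis
    by (intro integrableI_bounded) (auto simp: top_unique)
qed

section \<open>Gaussian integrals of functions of exponential growth\<close>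

text \<open>A class closed under sums and products that contains the constants, the identity and
  exp(-g), and whose members are integrable against every Gaussian; integrability side conditions
  thus reduce to the rules \<open>exp_growth_intros\<close>.\<close>

definition exp_growth :: "('a::euclidean_space \<Rightarrow> 'b::euclidean_space) \<Rightarrow> bool" where
  "exp_growth \<Phi> \<longleftrightarrow> \<Phi> \<in> borel_measurable borel \<and> (\<exists>A B. \<forall>y. norm (\<Phi> y) \<le> A * exp (B * norm y))"

definition hk :: "real \<Rightarrow> 'a::euclidean_space \<Rightarrow> 'a \<Rightarrow> real" where
  "hk \<tau> x y = exp (- (norm (y - x))\<^sup>2 / (2 * \<tau>))"

definition HI :: "real \<Rightarrow> ('a::euclidean_space \<Rightarrow> 'b::euclidean_space) \<Rightarrow> 'a \<Rightarrow> 'b" where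
  "HI \<tau> \<Phi> x = (\<integral>y. hk \<tau> x y *\<^sub>R \<Phi> y \<partial>lborel)"

lemma exp_growth_measurable [measurable_dest]: "exp_growth \<Phi> \<Longrightarrow> \<Phi> \<in> borel_measurable borel"
  by (simp add: exp_growth_def)

lemma exp_growthE:
  assumes "exp_growth \<Phi>"
  obtains A B where "0 \<le> A" "0 \<le> B" "\<And>y. norm (\<Phi> y) \<le> A * exp (B * norm y)"
proof -
  obtain A B where AB: "\<And>y. norm (\<Phi> y) \<le> A * exp (B * norm y)"
    using assms unfolding exp_growth_def by blast
  have "norm (\<Phi> y) \<le> \<bar>A\<bar> * exp (\<bar>B\<bar> * norm y)" for y
  proof -
    have "A * exp (B * norm y) \<le> \<bar>A\<bar> * exp (\<bar>B\<bar> * norm y)"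
      by (intro mult_mono) (auto intro: mult_right_mono)
    then show ?thesis using AB[of y] by linarith
  qed
  then show ?thesis using that[of "\<bar>A\<bar>" "\<bar>B\<bar>"] by auto
qed

lemma exp_growthI:
  assumes "\<Phi> \<in> borel_measurable borel" "\<And>y. norm (\<Phi> y) \<le> A * exp (B * norm y)"
  shows "exp_growth \<Phi>"
  using assms unfolding exp_growth_def by blast

lemma exp_growth_exp_neg:
  assumes "L > 0" "fL_monotone L G" and g: "\<And>x. (g has_derivative (\<lambda>h. G x \<bullet> h)) (at x)"
  shows "exp_growth (\<lambda>y. exp (- g y))"
proof (rule exp_growthI[where A = "exp (- g 0)" and B = "norm (G 0) + 2 * sqrt L"])
  show "(\<lambda>y. exp (- g y)) \<in> borel_measurable borel"
    by (intro borel_measurable_continuous_onI continuous_intros continuous_at_imp_continuous_on ballI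
        has_derivative_continuous[OF g])
  show "norm (exp (- g y)) \<le> exp (- g 0) * exp ((norm (G 0) + 2 * sqrt L) * norm y)" for y
    using potential_lower_bound[OF assms, of y] by (simp flip: exp_add)
qed

lemma exp_growth_const [simp, intro]: "exp_growth (\<lambda>_. c)"
  by (rule exp_growthI[where A = "norm c" and B = 0]) auto

lemma exp_growth_id [simp, intro]: "exp_growth (\<lambda>y. y)"
proof (rule exp_growthI[where A = 1 and B = 1])
  show "norm y \<le> 1 * exp (1 * norm y)" for y :: 'a using exp_ge_add_one_self[of "norm y"] by (simp del: exp_ge_add_one_self)
qed auto

lemma exp_growth_norm: "exp_growth \<Phi> \<Longrightarrow> exp_growth (\<lambda>y. norm (\<Phi> y))"
  unfolding exp_growth_def by auto

lemma exp_growth_add [intro]: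
  assumes "exp_growth \<Phi>" "exp_growth \<Psi>" shows "exp_growth (\<lambda>y. \<Phi> y + \<Psi> y)"
proof -
  obtain A B where 1: "0 \<le> A" "0 \<le> B" "\<And>y. norm (\<Phi> y) \<le> A * exp (B * norm y)"
    using exp_growthE[OF assms(1)] by metis
  obtain A' B' where 2: "0 \<le> A'" "0 \<le> B'" "\<And>y. norm (\<Psi> y) \<le> A' * exp (B' * norm y)"
    using exp_growthE[OF assms(2)] by metis
  show ?thesis
  proof (rule exp_growthI[where A = "A + A'" and B = "B + B'"])
    show "(\<lambda>y. \<Phi> y + \<Psi> y) \<in> borel_measurable borel" using assms by measurable
    fix y :: 'a
    have "A * exp (B * norm y) \<le> A * exp ((B + B') * norm y)"
      using 1 2 by (intro mult_left_mono) (auto intro: mult_right_mono)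
    moreover have "A' * exp (B' * norm y) \<le> A' * exp ((B + B') * norm y)"
      using 1 2 by (intro mult_left_mono) (auto intro: mult_right_mono)
    ultimately show "norm (\<Phi> y + \<Psi> y) \<le> (A + A') * exp ((B + B') * norm y)"
      using norm_triangle_ineq[of "\<Phi> y" "\<Psi> y"] 1(3)[of y] 2(3)[of y] by (simp add: algebra_simps)
  qed
qed

lemma exp_growth_bilinear:
  assumes "exp_growth \<Phi>" "exp_growth \<Psi>" and m: "\<And>a b. norm (m a b) \<le> norm a * norm b"
    and "(\<lambda>y. m (\<Phi> y) (\<Psi> y)) \<in> borel_measurable borel"
  shows "exp_growth (\<lambda>y. m (\<Phi> y) (\<Psi> y))"
proof -
  obtain A B where 1: "0 \<le> A" "0 \<le> B" "\<And>y. norm (\<Phi> y) \<le> A * exp (B * norm y)"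
    using exp_growthE[OF assms(1)] by metis
  obtain A' B' where 2: "0 \<le> A'" "0 \<le> B'" "\<And>y. norm (\<Psi> y) \<le> A' * exp (B' * norm y)"
    using exp_growthE[OF assms(2)] by metis
  show ?thesis
  proof (rule exp_growthI[where A = "A * A'" and B = "B + B'"])
    fix y :: 'a
    have "norm (\<Phi> y) * norm (\<Psi> y) \<le> (A * exp (B * norm y)) * (A' * exp (B' * norm y))"
      using 1 2 by (intro mult_mono) auto
    then show "norm (m (\<Phi> y) (\<Psi> y)) \<le> A * A' * exp ((B + B') * norm y)"
      using m[of "\<Phi> y" "\<Psi> y"] by (simp add: algebra_simps exp_add)
  qed fact
qed

lemma exp_growth_scaleR [intro]:
  "exp_growth q \<Longrightarrow> exp_growth \<Phi> \<Longrightarrow> exp_growth (\<lambda>y. q y *\<^sub>R \<Phi> y)"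
  by (rule exp_growth_bilinear) (auto dest: exp_growth_measurable)

lemma exp_growth_mult [intro]:
  fixes q :: "'a::euclidean_space \<Rightarrow> real"
  shows "exp_growth q \<Longrightarrow> exp_growth r \<Longrightarrow> exp_growth (\<lambda>y. q y * r y)"
  using exp_growth_scaleR[of q r] by simp

lemma exp_growth_inner [intro]:
  "exp_growth \<Phi> \<Longrightarrow> exp_growth \<Psi> \<Longrightarrow> exp_growth (\<lambda>y. \<Phi> y \<bullet> \<Psi> y)"
  by (rule exp_growth_bilinear) (auto dest: exp_growth_measurable intro: Cauchy_Schwarz_ineq2)

lemma exp_growth_diff [intro]:
  "exp_growth \<Phi> \<Longrightarrow> exp_growth \<Psi> \<Longrightarrow> exp_growth (\<lambda>y. \<Phi> y - \<Psi> y)"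
  using exp_growth_add[of \<Phi> "\<lambda>y. (-1) *\<^sub>R \<Psi> y"] exp_growth_scaleR[of "\<lambda>_. -1" \<Psi>] by auto

lemma exp_growth_uminus [intro]: "exp_growth \<Phi> \<Longrightarrow> exp_growth (\<lambda>y. - \<Phi> y)"
  using exp_growth_scaleR[of "\<lambda>_. -1" \<Phi>] by auto

lemma exp_growth_divide [intro]:
  fixes q :: "'a::euclidean_space \<Rightarrow> real"
  shows "exp_growth q \<Longrightarrow> exp_growth (\<lambda>y. q y / c)"
  using exp_growth_mult[of q "\<lambda>_. inverse c"] by (simp add: divide_inverse)

lemma exp_growth_power [intro]:
  fixes q :: "'a::euclidean_space \<Rightarrow> real"
  shows "exp_growth q \<Longrightarrow> exp_growth (\<lambda>y. (q y)^n)"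
  by (induction n) auto

lemmas exp_growth_intros = exp_growth_norm exp_growth_add exp_growth_scaleR exp_growth_mult
  exp_growth_inner exp_growth_uminus exp_growth_diff exp_growth_divide exp_growth_power exp_growth_const exp_growth_id

section \<open>Domination of the Gaussian kernel and differentiation of Gaussian integrals\<close>

lemma hk_pos [simp]: "hk \<tau> x y > 0" and hk_nonneg [simp]: "hk \<tau> x y \<ge> 0"
  by (simp_all add: hk_def)

lemma hk_measurable [measurable]: "hk \<tau> x \<in> borel_measurable borel"
  unfolding hk_def by measurable

text \<open>Completing the square in -\<rho>^2 / (2 \<tau>) + (B + 3) \<rho>, with \<rho> = |y - x|.
  Of B + 3, the part B pays for the growth of the integrand, 2 for (1 + \<rho>)^2 <= exp(2 \<rho>),
  and 1 buys the integrable factor exp(-|y|). The bound is uniform in \<tau> <= T and |x| <= R, so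
  one dominating function serves a whole neighbourhood; the factor (1 + \<rho>)^2 covers all weights
  produced by two derivatives in space or one in time.\<close>

lemma hk_dominated:
  assumes "0 < \<tau>" "\<tau> \<le> T" "norm x \<le> R" "0 \<le> B"
  shows "hk \<tau> x y * (1 + norm (y - x))\<^sup>2 * exp (B * norm y)
    \<le> exp ((B + 1) * R + (B + 3)\<^sup>2 * T / 2) * exp (- norm y)"
proof -
  define \<rho> where "\<rho> = norm (y - x)"
  have \<rho>: "0 \<le> \<rho>" by (simp add: \<rho>_def)
  have "norm y \<le> norm x + \<rho>" unfolding \<rho>_def using norm_triangle_sub[of y x] by simp
  then have ny: "norm y \<le> R + \<rho>" using assms by linarith
  have "0 \<le> (\<rho> - (B + 3) * \<tau>)\<^sup>2 / (2 * \<tau>)" using assms by simp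
  also have "\<dots> = \<rho>\<^sup>2 / (2 * \<tau>) - (B + 3) * \<rho> + (B + 3)\<^sup>2 * \<tau> / 2"
    using assms by (simp add: power2_eq_square field_simps)
  finally have a: "- \<rho>\<^sup>2 / (2 * \<tau>) + (B + 3) * \<rho> \<le> (B + 3)\<^sup>2 * \<tau> / 2" by simp
  have b: "(B + 3)\<^sup>2 * \<tau> / 2 \<le> (B + 3)\<^sup>2 * T / 2"
    using assms by (intro divide_right_mono mult_left_mono) auto
  have c: "(B + 1) * norm y \<le> (B + 1) * (R + \<rho>)" using ny assms by (intro mult_left_mono) auto
  have "(1 + \<rho>)\<^sup>2 \<le> (exp \<rho>)\<^sup>2" using \<rho> exp_ge_add_one_self[of \<rho>] by (intro power_mono) auto
  also have "\<dots> = exp (2 * \<rho>)" by (simp add: exp_double)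
  finally have "hk \<tau> x y * (1 + \<rho>)\<^sup>2 * exp (B * norm y) \<le>
      exp (- \<rho>\<^sup>2 / (2 * \<tau>)) * exp (2 * \<rho>) * exp (B * norm y)"
    unfolding hk_def \<rho>_def[symmetric] by (intro mult_right_mono mult_left_mono) auto
  also have "\<dots> = exp (- \<rho>\<^sup>2 / (2 * \<tau>) + 2 * \<rho> + B * norm y)" by (simp only: exp_add)
  also have "\<dots> \<le> exp ((B + 1) * R + (B + 3)\<^sup>2 * T / 2 + - norm y)"
    using a b c by (simp add: algebra_simps)
  finally show ?thesis unfolding \<rho>_def by (simp only: exp_add)
qed

lemma dominated_kernel:
  assumes "exp_growth \<Phi>" "0 \<le> c"
  obtains C where "0 \<le> C" and
    "\<And>\<tau> x y s. 0 < \<tau> \<Longrightarrow> \<tau> \<le> T \<Longrightarrow> norm x \<le> R \<Longrightarrow> \<bar>s\<bar> \<le> c * (hk \<tau> x y * (1 + norm (y - x))\<^sup>2)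
       \<Longrightarrow> norm (s *\<^sub>R \<Phi> y) \<le> C * exp (- norm y)"
proof -
  obtain A B where AB: "0 \<le> A" "0 \<le> B" "\<And>y. norm (\<Phi> y) \<le> A * exp (B * norm y)"
    using exp_growthE[OF assms(1)] by metis
  define E where "E = exp ((B + 1) * R + (B + 3)\<^sup>2 * T / 2)"
  have "norm (s *\<^sub>R \<Phi> y) \<le> (c * A * E) * exp (- norm y)"
    if "0 < \<tau>" "\<tau> \<le> T" "norm x \<le> R" "\<bar>s\<bar> \<le> c * (hk \<tau> x y * (1 + norm (y - x))\<^sup>2)" for \<tau> x y s
  proof -
    have "norm (s *\<^sub>R \<Phi> y) \<le> (c * (hk \<tau> x y * (1 + norm (y - x))\<^sup>2)) * (A * exp (B * norm y))"
      using that AB(3)[of y] assms(2) by (auto intro!: mult_mono)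
    also have "\<dots> = c * A * (hk \<tau> x y * (1 + norm (y - x))\<^sup>2 * exp (B * norm y))"
      by (simp add: algebra_simps)
    also have "\<dots> \<le> c * A * (E * exp (- norm y))"
      unfolding E_def using that AB assms(2) by (intro mult_left_mono hk_dominated) auto
    finally show ?thesis by simp
  qed
  moreover have "0 \<le> c * A * E" using AB assms(2) by (simp add: E_def)
  ultimately show ?thesis using that by blast
qed

lemma one_le_square_one_plus: "0 \<le> (r::real) \<Longrightarrow> 1 \<le> (1 + r)\<^sup>2"
  and le_square_one_plus: "0 \<le> (r::real) \<Longrightarrow> r \<le> (1 + r)\<^sup>2"
  and square_le_square_one_plus: "0 \<le> (r::real) \<Longrightarrow> r\<^sup>2 \<le> (1 + r)\<^sup>2"
  by (simp_all add: power2_eq_square algebra_simps)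

lemma integrable_hk:
  assumes "0 < \<tau>" "exp_growth \<Phi>"
  shows "integrable lborel (\<lambda>y. hk \<tau> x y *\<^sub>R \<Phi> y)"
proof -
  obtain C where C: "0 \<le> C"
    "\<And>\<tau>' x' y s. 0 < \<tau>' \<Longrightarrow> \<tau>' \<le> \<tau> \<Longrightarrow> norm x' \<le> norm x \<Longrightarrow> \<bar>s\<bar> \<le> 1 * (hk \<tau>' x' y * (1 + norm (y - x'))\<^sup>2)
       \<Longrightarrow> norm (s *\<^sub>R \<Phi> y) \<le> C * exp (- norm y)"
    using dominated_kernel[OF assms(2), of 1 \<tau> "norm x"] by auto
  show ?thesis
  proof (rule Bochner_Integration.integrable_bound)
    show "integrable lborel (\<lambda>y::'a. C * exp (- norm y))"
      by (intro integrable_mult_right integrable_exp_neg_norm)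
    show "(\<lambda>y. hk \<tau> x y *\<^sub>R \<Phi> y) \<in> borel_measurable lborel"
      using exp_growth_measurable[OF assms(2)] by simp
    have "norm (hk \<tau> x y *\<^sub>R \<Phi> y) \<le> C * exp (- norm y)" for y
      using assms by (intro C(2)[of \<tau> x]) (auto simp: one_le_square_one_plus)
    then show "AE y in lborel. norm (hk \<tau> x y *\<^sub>R \<Phi> y) \<le> norm (C * exp (- norm y))"
      using C(1) by (auto simp: abs_mult)
  qed
qed

text \<open>One template for derivatives in space and in time: \<open>\<tau> z\<close> and
  \<open>\<xi> z\<close> are the variance and the centre of the Gaussian that controls the weight at
  parameter z, and \<open>dominated_kernel\<close> replaces them by a bound independent of
  z.\<close>

lemma has_derivative_kernel_integral:
  fixes q :: "'p::real_normed_vector \<Rightarrow> 'a::euclidean_space \<Rightarrow> real" and \<Phi> :: "'a \<Rightarrow> 'b::euclidean_space"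
  assumes "exp_growth \<Phi>" "e > 0" "0 \<le> c"
    and \<tau>: "\<And>z. z \<in> ball z0 e \<Longrightarrow> 0 < \<tau> z \<and> \<tau> z \<le> T \<and> norm (\<xi> z) \<le> R"
    and q: "\<And>z y. z \<in> ball z0 e \<Longrightarrow> \<bar>q z y\<bar> \<le> c * (hk (\<tau> z) (\<xi> z) y * (1 + norm (y - \<xi> z))\<^sup>2)"
    and q': "\<And>z y h. z \<in> ball z0 e \<Longrightarrow>
       \<bar>q' z y h\<bar> \<le> c * (hk (\<tau> z) (\<xi> z) y * (1 + norm (y - \<xi> z))\<^sup>2) * norm h"
    and der: "\<And>z y. z \<in> ball z0 e \<Longrightarrow> ((\<lambda>z. q z y) has_derivative q' z y) (at z)"
    and qm: "\<And>z. q z \<in> borel_measurable borel"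
    and qm': "\<And>h. (\<lambda>y. q' z0 y h) \<in> borel_measurable borel"
  shows "((\<lambda>z. \<integral>y. q z y *\<^sub>R \<Phi> y \<partial>lborel) has_derivative (\<lambda>h. \<integral>y. q' z0 y h *\<^sub>R \<Phi> y \<partial>lborel)) (at z0)"
proof -
  note [measurable] = exp_growth_measurable[OF assms(1)] qm qm'
  obtain C where C: "0 \<le> C"
    "\<And>\<tau> x y s. 0 < \<tau> \<Longrightarrow> \<tau> \<le> T \<Longrightarrow> norm x \<le> R \<Longrightarrow> \<bar>s\<bar> \<le> c * (hk \<tau> x y * (1 + norm (y - x))\<^sup>2)
       \<Longrightarrow> norm (s *\<^sub>R \<Phi> y) \<le> C * exp (- norm y)"
    using dominated_kernel[OF assms(1,3), of T R] by auto
  have iE: "integrable lborel (\<lambda>y::'a. C * exp (- norm y))"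
    by (intro integrable_mult_right integrable_exp_neg_norm)
  show ?thesis
  proof (rule has_derivative_integral_dominated[where F = "\<lambda>z y. q z y *\<^sub>R \<Phi> y"
      and F' = "\<lambda>z y h. q' z y h *\<^sub>R \<Phi> y" and B = "\<lambda>y. C * exp (- norm y)"])
    show "integrable lborel (\<lambda>y. q z y *\<^sub>R \<Phi> y)" if z: "z \<in> ball z0 e" for z
    proof (rule Bochner_Integration.integrable_bound[OF iE])
      show "AE y in lborel. norm (q z y *\<^sub>R \<Phi> y) \<le> norm (C * exp (- norm y))"
        using C(2)[OF _ _ _ q[OF z]] \<tau>[OF z] C(1) by (auto simp: abs_mult)
    qed simp
    show "((\<lambda>z. q z y *\<^sub>R \<Phi> y) has_derivative (\<lambda>h. q' z y h *\<^sub>R \<Phi> y)) (at z)"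
      if z: "z \<in> ball z0 e" for z y
      using der[OF z] by (rule has_derivative_scaleR_left)
    show "norm (q' z y h *\<^sub>R \<Phi> y) \<le> C * exp (- norm y) * norm h" if z: "z \<in> ball z0 e" for z y h
    proof (cases "h = 0")
      case True
      then have "q' z y h = 0" using q'[OF z, of y h] by simp
      then show ?thesis using True by simp
    next
      case False
      have "\<bar>q' z y h / norm h\<bar> \<le> c * (hk (\<tau> z) (\<xi> z) y * (1 + norm (y - \<xi> z))\<^sup>2)"
        using q'[OF z, of y h] False by (simp add: pos_divide_le_eq)
      then have "norm ((q' z y h / norm h) *\<^sub>R \<Phi> y) \<le> C * exp (- norm y)"
        using C(2)[of "\<tau> z" "\<xi> z"] \<tau>[OF z] by blast
      then show ?thesis using False by (simp add: pos_divide_le_eq)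
    qed
  qed (use assms(2) iE C(1) in auto)
qed

lemma has_derivative_hk:
  assumes "0 < \<tau>"
  shows "((\<lambda>x. hk \<tau> x y) has_derivative (\<lambda>h. hk \<tau> x y * (((y - x) \<bullet> h) / \<tau>))) (at x)"
proof -
  have "((\<lambda>x. - ((y - x) \<bullet> (y - x)) / (2 * \<tau>)) has_derivative (\<lambda>h. ((y - x) \<bullet> h) / \<tau>)) (at x)"
    using assms by (auto intro!: derivative_eq_intros simp: inner_commute field_simps fun_eq_iff inner_simps)
  from has_derivative_exp[OF this] show ?thesis
    unfolding hk_def power2_norm_eq_inner by (simp add: mult.commute)
qed

lemma HI_has_derivative:
  assumes "0 < \<tau>" "exp_growth \<Phi>"
  shows "(HI \<tau> \<Phi> has_derivative (\<lambda>h. HI \<tau> (\<lambda>y. (((y - x) \<bullet> h) / \<tau>) *\<^sub>R \<Phi> y) x)) (at x)"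
proof -
  have "((\<lambda>z. \<integral>y. hk \<tau> z y *\<^sub>R \<Phi> y \<partial>lborel) has_derivative
      (\<lambda>h. \<integral>y. (hk \<tau> x y * (((y - x) \<bullet> h) / \<tau>)) *\<^sub>R \<Phi> y \<partial>lborel)) (at x)"
  proof (rule has_derivative_kernel_integral[where e = 1 and c = "1 + 1 / \<tau>" and \<tau> = "\<lambda>_. \<tau>" and \<xi> = "\<lambda>z. z"
        and T = \<tau> and R = "norm x + 1" and q' = "\<lambda>x y h. hk \<tau> x y * (((y - x) \<bullet> h) / \<tau>)"])
    show "0 < \<tau> \<and> \<tau> \<le> \<tau> \<and> norm z \<le> norm x + 1" if "z \<in> ball x 1" for z
      using that assms norm_triangle_sub[of z x] by (simp add: dist_norm norm_minus_commute)
    fix z y h :: 'a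
    let ?P = "hk \<tau> z y * (1 + norm (y - z))\<^sup>2"
    have P: "hk \<tau> z y \<le> ?P" by (simp add: one_le_square_one_plus)
    have P0: "0 \<le> ?P" by simp
    have "?P \<le> (1 + 1 / \<tau>) * ?P" using assms P0 by (simp add: algebra_simps)
    then show "\<bar>hk \<tau> z y\<bar> \<le> (1 + 1 / \<tau>) * ?P"
      using order_trans[OF P] by (simp only: abs_of_nonneg[OF hk_nonneg])
    have "\<bar>hk \<tau> z y * (((y - z) \<bullet> h) / \<tau>)\<bar> \<le> hk \<tau> z y * ((norm (y - z) * norm h) / \<tau>)"
      using assms Cauchy_Schwarz_ineq2[of "y - z" h] by (simp add: abs_mult divide_right_mono)
    also have "\<dots> \<le> hk \<tau> z y * (((1 + norm (y - z))\<^sup>2 * norm h) / \<tau>)"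
      using assms by (intro mult_left_mono divide_right_mono mult_right_mono le_square_one_plus) auto
    also have "\<dots> = (1 / \<tau>) * ?P * norm h" by simp
    also have "\<dots> \<le> (1 + 1 / \<tau>) * ?P * norm h" using assms P0
      by (intro mult_right_mono) auto
    finally show "\<bar>hk \<tau> z y * (((y - z) \<bullet> h) / \<tau>)\<bar> \<le> (1 + 1 / \<tau>) * ?P * norm h" .
    show "((\<lambda>z. hk \<tau> z y) has_derivative (\<lambda>h. hk \<tau> z y * (((y - z) \<bullet> h) / \<tau>))) (at z)"
      by (rule has_derivative_hk[OF assms(1)])
  qed (use assms in auto)
  then show ?thesis unfolding HI_def by simp
qed

lemma HI_weighted_has_derivative:
  assumes "0 < \<tau>" "exp_growth \<Phi>"
  shows "((\<lambda>x. HI \<tau> (\<lambda>y. (((y - x) \<bullet> a) / \<tau>) *\<^sub>R \<Phi> y) x) has_derivative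
     (\<lambda>h. HI \<tau> (\<lambda>y. (((y - x) \<bullet> a) * ((y - x) \<bullet> h) / \<tau>\<^sup>2 - (a \<bullet> h) / \<tau>) *\<^sub>R \<Phi> y) x)) (at x)"
proof -
  let ?q' = "\<lambda>x y h. hk \<tau> x y * (((y - x) \<bullet> a) * ((y - x) \<bullet> h) / \<tau>\<^sup>2 - (a \<bullet> h) / \<tau>)"
  have "((\<lambda>z. \<integral>y. (hk \<tau> z y * (((y - z) \<bullet> a) / \<tau>)) *\<^sub>R \<Phi> y \<partial>lborel) has_derivative
      (\<lambda>h. \<integral>y. ?q' x y h *\<^sub>R \<Phi> y \<partial>lborel)) (at x)"
  proof (rule has_derivative_kernel_integral[where e = 1 and c = "norm a * (1 / \<tau> + 1 / \<tau>\<^sup>2)"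
        and \<tau> = "\<lambda>_. \<tau>" and \<xi> = "\<lambda>z. z" and T = \<tau> and R = "norm x + 1" and q' = ?q'])
    show "0 < \<tau> \<and> \<tau> \<le> \<tau> \<and> norm z \<le> norm x + 1" if "z \<in> ball x 1" for z
      using that assms norm_triangle_sub[of z x] by (simp add: dist_norm norm_minus_commute)
    fix z y h :: 'a
    define \<rho> where "\<rho> = norm (y - z)"
    let ?P = "hk \<tau> z y * (1 + \<rho>)\<^sup>2"
    have \<rho>: "0 \<le> \<rho>" by (simp add: \<rho>_def)
    have P0: "0 \<le> ?P" by simp
    have ya: "\<bar>(y - z) \<bullet> v\<bar> \<le> \<rho> * norm v" for v
      unfolding \<rho>_def by (rule Cauchy_Schwarz_ineq2)
    have "\<bar>(y - z) \<bullet> a\<bar> / \<tau> \<le> (1 + \<rho>)\<^sup>2 * norm a / \<tau>"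
      using assms by (intro divide_right_mono order_trans[OF ya] mult_right_mono le_square_one_plus \<rho>) auto
    also have "\<dots> \<le> (1 + \<rho>)\<^sup>2 * (norm a * (1 / \<tau> + 1 / \<tau>\<^sup>2))"
      using assms by (simp add: algebra_simps)
    finally have "hk \<tau> z y * (\<bar>(y - z) \<bullet> a\<bar> / \<tau>) \<le> hk \<tau> z y * ((1 + \<rho>)\<^sup>2 * (norm a * (1 / \<tau> + 1 / \<tau>\<^sup>2)))"
      by (intro mult_left_mono) auto
    then show "\<bar>hk \<tau> z y * (((y - z) \<bullet> a) / \<tau>)\<bar> \<le> norm a * (1 / \<tau> + 1 / \<tau>\<^sup>2) * (hk \<tau> z y * (1 + norm (y - z))\<^sup>2)"
      using assms by (simp add: abs_mult \<rho>_def mult.assoc mult.left_commute mult.commute)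
    have "\<bar>((y - z) \<bullet> a) * ((y - z) \<bullet> h) / \<tau>\<^sup>2 - (a \<bullet> h) / \<tau>\<bar>
       \<le> \<bar>(y - z) \<bullet> a\<bar> * \<bar>(y - z) \<bullet> h\<bar> / \<tau>\<^sup>2 + \<bar>a \<bullet> h\<bar> / \<tau>"
      using assms by (intro order_trans[OF abs_triangle_ineq4]) (simp add: abs_mult)
    also have "\<dots> \<le> (\<rho> * norm a) * (\<rho> * norm h) / \<tau>\<^sup>2 + (norm a * norm h) / \<tau>"
      using assms \<rho> by (intro add_mono divide_right_mono mult_mono ya Cauchy_Schwarz_ineq2) auto
    also have "\<dots> = (\<rho>\<^sup>2 * (1 / \<tau>\<^sup>2) + 1 * (1 / \<tau>)) * (norm a * norm h)"
      by (simp add: power2_eq_square algebra_simps)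
    also have "\<dots> \<le> ((1 + \<rho>)\<^sup>2 * (1 / \<tau>\<^sup>2) + (1 + \<rho>)\<^sup>2 * (1 / \<tau>)) * (norm a * norm h)"
      using assms \<rho> by (intro mult_right_mono add_mono square_le_square_one_plus one_le_square_one_plus) auto
    finally have "hk \<tau> z y * \<bar>((y - z) \<bullet> a) * ((y - z) \<bullet> h) / \<tau>\<^sup>2 - (a \<bullet> h) / \<tau>\<bar>
       \<le> hk \<tau> z y * (((1 + \<rho>)\<^sup>2 * (1 / \<tau>\<^sup>2) + (1 + \<rho>)\<^sup>2 * (1 / \<tau>)) * (norm a * norm h))"
      by (intro mult_left_mono) auto
    also have "\<dots> = norm a * (1 / \<tau> + 1 / \<tau>\<^sup>2) * ?P * norm h" by (simp only: algebra_simps)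
    finally show "\<bar>?q' z y h\<bar> \<le> norm a * (1 / \<tau> + 1 / \<tau>\<^sup>2) * (hk \<tau> z y * (1 + norm (y - z))\<^sup>2) * norm h"
      unfolding \<rho>_def[symmetric] by (simp only: abs_mult abs_of_nonneg[OF hk_nonneg])
    have "((\<lambda>z. ((y - z) \<bullet> a) / \<tau>) has_derivative (\<lambda>h. - (h \<bullet> a) / \<tau>)) (at z)"
      using assms by (auto intro!: derivative_eq_intros)
    from has_derivative_mult[OF has_derivative_hk[OF assms(1), of y z] this]
    show "((\<lambda>z. hk \<tau> z y * (((y - z) \<bullet> a) / \<tau>)) has_derivative ?q' z y) (at z)"
      by (rule has_derivative_eq_rhs)
         (simp add: fun_eq_iff algebra_simps power2_eq_square inner_commute add_divide_distrib diff_divide_distrib)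
  qed (use assms in auto)
  then show ?thesis unfolding HI_def by simp
qed

lemma HI_has_time_derivative:
  assumes "0 < \<tau>" "exp_growth \<Phi>"
  shows "((\<lambda>\<tau>. HI \<tau> \<Phi> x) has_vector_derivative
     HI \<tau> (\<lambda>y. ((norm (y - x))\<^sup>2 / (2 * \<tau>\<^sup>2)) *\<^sub>R \<Phi> y) x) (at \<tau>)"
proof -
  let ?q' = "\<lambda>\<tau> y h. hk \<tau> x y * ((norm (y - x))\<^sup>2 / (2 * \<tau>\<^sup>2)) * h"
  have "((\<lambda>z. \<integral>y. hk z x y *\<^sub>R \<Phi> y \<partial>lborel) has_derivative
      (\<lambda>h. \<integral>y. ?q' \<tau> y h *\<^sub>R \<Phi> y \<partial>lborel)) (at \<tau>)"
  \<comment> \<open>Radius \<tau> / 2 keeps the times z of the ball below 2 \<tau> and above \<tau>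
    / 2, so that 1 / (2 z^2) <= 2 / \<tau>^2.\<close>
  proof (rule has_derivative_kernel_integral[where e = "\<tau> / 2" and c = "1 + 2 / \<tau>\<^sup>2"
        and \<tau> = "\<lambda>z. z" and \<xi> = "\<lambda>_. x" and T = "2 * \<tau>" and R = "norm x" and q' = ?q'])
    show r: "0 < z \<and> z \<le> 2 * \<tau> \<and> norm x \<le> norm x" if "z \<in> ball \<tau> (\<tau> / 2)" for z
      using that assms by (auto simp: dist_real_def field_simps abs_if split: if_splits)
    fix z h :: real and y :: 'a
    assume z: "z \<in> ball \<tau> (\<tau> / 2)"
    have z2: "\<tau> / 2 \<le> z" using z by (auto simp: dist_real_def field_simps abs_if split: if_splits)
    let ?P = "hk z x y * (1 + norm (y - x))\<^sup>2"
    have P: "hk z x y \<le> ?P" by (simp add: one_le_square_one_plus)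
    have P0: "0 \<le> ?P" by simp
    then have "?P \<le> (1 + 2 / \<tau>\<^sup>2) * ?P" using assms by (simp add: algebra_simps)
    then show "\<bar>hk z x y\<bar> \<le> (1 + 2 / \<tau>\<^sup>2) * ?P"
      using order_trans[OF P] by (simp only: abs_of_nonneg[OF hk_nonneg])
    have "(\<tau> / 2)\<^sup>2 \<le> z\<^sup>2" using z2 assms by (intro power_mono) auto
    then have "1 / (2 * z\<^sup>2) \<le> 2 / \<tau>\<^sup>2"
      using assms r[OF z] by (simp add: field_simps)
    then have "(norm (y - x))\<^sup>2 * (1 / (2 * z\<^sup>2)) \<le> (1 + norm (y - x))\<^sup>2 * (1 + 2 / \<tau>\<^sup>2)"
      using assms by (intro mult_mono square_le_square_one_plus) auto
    then have "hk z x y * ((norm (y - x))\<^sup>2 * (1 / (2 * z\<^sup>2))) * \<bar>h\<bar>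
        \<le> hk z x y * ((1 + norm (y - x))\<^sup>2 * (1 + 2 / \<tau>\<^sup>2)) * \<bar>h\<bar>"
      by (intro mult_right_mono mult_left_mono) auto
    then show "\<bar>?q' z y h\<bar> \<le> (1 + 2 / \<tau>\<^sup>2) * ?P * norm h"
      by (simp add: abs_mult mult.commute mult.left_commute)
    show "((\<lambda>z. hk z x y) has_derivative ?q' z y) (at z)"
      unfolding hk_def using r[OF z]
      by (auto intro!: derivative_eq_intros simp: fun_eq_iff field_simps power2_eq_square)
  qed (use assms in auto)
  then show ?thesis unfolding HI_def has_vector_derivative_def
    by (rule has_derivative_eq_rhs) (simp add: fun_eq_iff mult.commute mult.left_commute flip: integral_scaleR_right)
qed

section \<open>Linearity, positivity and integration by parts\<close>

lemma HI_add:
  assumes "0 < \<tau>" "exp_growth \<Phi>" "exp_growth \<Psi>"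
  shows "HI \<tau> (\<lambda>y. \<Phi> y + \<Psi> y) x = HI \<tau> \<Phi> x + HI \<tau> \<Psi> x"
  unfolding HI_def scaleR_add_right
  by (intro Bochner_Integration.integral_add integrable_hk assms)

lemma HI_diff:
  assumes "0 < \<tau>" "exp_growth \<Phi>" "exp_growth \<Psi>"
  shows "HI \<tau> (\<lambda>y. \<Phi> y - \<Psi> y) x = HI \<tau> \<Phi> x - HI \<tau> \<Psi> x"
  unfolding HI_def scaleR_diff_right
  by (intro Bochner_Integration.integral_diff integrable_hk assms)

lemma HI_sum:
  assumes "0 < \<tau>" "\<And>i. i \<in> S \<Longrightarrow> exp_growth (\<Phi> i)"
  shows "HI \<tau> (\<lambda>y. \<Sum>i\<in>S. \<Phi> i y) x = (\<Sum>i\<in>S. HI \<tau> (\<Phi> i) x)"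
  unfolding HI_def scaleR_sum_right
  by (intro Bochner_Integration.integral_sum integrable_hk assms)

lemma HI_scaleR: "HI \<tau> (\<lambda>y. c *\<^sub>R \<Phi> y) x = c *\<^sub>R HI \<tau> \<Phi> x"
  unfolding HI_def scaleR_left_commute[of _ c] by (rule integral_scaleR_right)

lemma HI_cmult:
  fixes \<Phi> :: "'a::euclidean_space \<Rightarrow> real"
  shows "HI \<tau> (\<lambda>y. c * \<Phi> y) x = c * HI \<tau> \<Phi> x"
  using HI_scaleR[of \<tau> c \<Phi> x] by simp

lemma HI_uminus: "HI \<tau> (\<lambda>y. - \<Phi> y) x = - HI \<tau> \<Phi> x"
  using HI_scaleR[of \<tau> "-1" \<Phi> x] by simp

lemma HI_inner:
  assumes "0 < \<tau>" "exp_growth \<Phi>"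
  shows "HI \<tau> (\<lambda>y. \<Phi> y \<bullet> a) x = HI \<tau> \<Phi> x \<bullet> a"
  unfolding HI_def using integral_inner_left[OF integrable_hk[OF assms], of x a] by simp

lemma HI_scaleR_const:
  assumes "0 < \<tau>" "exp_growth q"
  shows "HI \<tau> (\<lambda>y. q y *\<^sub>R v) x = HI \<tau> q x *\<^sub>R v"
  unfolding HI_def using integral_scaleR_left[OF integrable_hk[OF assms], of x v] by simp

lemma HI_mono:
  fixes \<Phi> \<Psi> :: "'a::euclidean_space \<Rightarrow> real"
  assumes "0 < \<tau>" "exp_growth \<Phi>" "exp_growth \<Psi>" "\<And>y. \<Phi> y \<le> \<Psi> y"
  shows "HI \<tau> \<Phi> x \<le> HI \<tau> \<Psi> x"
  unfolding HI_def
  by (intro integral_mono integrable_hk assms scaleR_left_mono) auto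

lemma norm_HI_le:
  assumes "0 < \<tau>" "exp_growth \<Phi>" "exp_growth \<Psi>" "\<And>y. norm (\<Phi> y) \<le> \<Psi> y"
  shows "norm (HI \<tau> \<Phi> x) \<le> HI \<tau> \<Psi> x"
proof -
  have "norm (HI \<tau> \<Phi> x) \<le> (\<integral>y. norm (hk \<tau> x y *\<^sub>R \<Phi> y) \<partial>lborel)"
    unfolding HI_def by (rule integral_norm_bound)
  also have "\<dots> = HI \<tau> (\<lambda>y. norm (\<Phi> y)) x" unfolding HI_def by simp
  also have "\<dots> \<le> HI \<tau> \<Psi> x" by (intro HI_mono exp_growth_norm assms)
  finally show ?thesis .
qed

lemma HI_pos:
  fixes \<Phi> :: "'a::euclidean_space \<Rightarrow> real"
  assumes "0 < \<tau>" "exp_growth \<Phi>" "\<And>y. 0 < \<Phi> y"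
  shows "0 < HI \<tau> \<Phi> x"
proof -
  have i: "integrable lborel (\<lambda>y. hk \<tau> x y *\<^sub>R \<Phi> y)" by (rule integrable_hk[OF assms(1,2)])
  have pos: "0 < hk \<tau> x y *\<^sub>R \<Phi> y" for y using assms(3)[of y] by simp
  have "HI \<tau> \<Phi> x \<noteq> 0"
  proof
    assume "HI \<tau> \<Phi> x = 0"
    then have "AE y in (lborel :: 'a measure). hk \<tau> x y *\<^sub>R \<Phi> y = 0"
      using integral_nonneg_eq_0_iff_AE[OF i] pos unfolding HI_def by (auto intro: less_imp_le)
    then have "AE y in (lborel :: 'a measure). False"
      using pos by (auto elim!: eventually_mono simp: less_le)
    then show False by (subst (asm) AE_iff_measurable[OF _ refl]) auto
  qed
  moreover have "0 \<le> HI \<tau> \<Phi> x"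
    unfolding HI_def by (rule Bochner_Integration.integral_nonneg) (use pos in \<open>auto intro: less_imp_le\<close>)
  ultimately show ?thesis by simp
qed

lemma lborel_integral_translate:
  fixes \<phi> :: "'a::euclidean_space \<Rightarrow> 'b::euclidean_space"
  assumes "\<phi> \<in> borel_measurable borel"
  shows "(\<integral>y. \<phi> (a + y) \<partial>lborel) = (\<integral>y. \<phi> y \<partial>lborel)"
    and "integrable lborel (\<lambda>y. \<phi> (a + y)) \<longleftrightarrow> integrable lborel \<phi>"
proof -
  have "(\<integral>y. \<phi> y \<partial>(distr lborel borel ((+) a))) = (\<integral>y. \<phi> (a + y) \<partial>lborel)"
    by (rule integral_distr) (use assms in auto)
  then show "(\<integral>y. \<phi> (a + y) \<partial>lborel) = (\<integral>y. \<phi> y \<partial>lborel)" by (simp add: lborel_distr_plus)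
  have "integrable (distr lborel borel ((+) a)) \<phi> \<longleftrightarrow> integrable lborel (\<lambda>y. \<phi> (a + y))"
    by (rule integrable_distr_eq) (use assms in auto)
  then show "integrable lborel (\<lambda>y. \<phi> (a + y)) \<longleftrightarrow> integrable lborel \<phi>" by (simp add: lborel_distr_plus)
qed

text \<open>Integration by parts: the integral of a translate does not depend on the translation.\<close>

lemma HI_by_parts:
  fixes \<Psi> :: "'a::euclidean_space \<Rightarrow> real"
  assumes \<tau>: "0 < \<tau>" and g0: "exp_growth \<Psi>" and g1: "exp_growth (\<lambda>y. \<Psi>' y a)"
    and der: "\<And>y. (\<Psi> has_derivative \<Psi>' y) (at y)"
  shows "HI \<tau> (\<lambda>y. \<Psi>' y a) x = HI \<tau> (\<lambda>y. ((y - x) \<bullet> a) / \<tau> * \<Psi> y) x"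
proof -
  define \<Theta> where "\<Theta> y = \<Psi>' y a - ((y - x) \<bullet> a) / \<tau> * \<Psi> y" for y
  have \<Theta>: "exp_growth \<Theta>" unfolding \<Theta>_def by (intro exp_growth_intros g0 g1)
  obtain A B where AB: "0 \<le> A" "0 \<le> B" "\<And>y. norm (\<Theta> y) \<le> A * exp (B * norm y)"
    using exp_growthE[OF \<Theta>] by metis
  define w where "w y = hk \<tau> x y * \<Psi> y" for y
  have wi: "integrable lborel w" unfolding w_def using integrable_hk[OF \<tau> g0] by simp
  have wm: "w \<in> borel_measurable borel" using wi by simp
  \<comment> \<open>The shift by s a with |s| < 1 costs a factor exp(B |a|) in the growth of
    \<open>\<Theta>\<close> and keeps the centre of the Gaussian within radius |x| + |a|.\<close>
  define C where "C = A * exp (B * norm a) * exp ((B + 1) * (norm x + norm a) + (B + 3)\<^sup>2 * \<tau> / 2)"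
  have der_hk: "((\<lambda>y. hk \<tau> x y) has_derivative (\<lambda>h. - hk \<tau> x y * (((y - x) \<bullet> h) / \<tau>))) (at y)" for y
  proof -
    have sym: "hk \<tau> x y = hk \<tau> y x" for y by (simp add: hk_def norm_minus_commute)
    show ?thesis unfolding sym
      by (rule has_derivative_eq_rhs[OF has_derivative_hk[OF \<tau>]]) (simp add: fun_eq_iff inner_diff_left right_diff_distrib diff_divide_distrib)
  qed
  have der_w: "(w has_derivative (\<lambda>h. hk \<tau> x y * \<Psi>' y h - hk \<tau> x y * (((y - x) \<bullet> h) / \<tau>) * \<Psi> y)) (at y)" for y
    unfolding w_def
    by (rule has_derivative_eq_rhs[OF has_derivative_mult[OF der_hk der]]) (simp add: fun_eq_iff)
  have "((\<lambda>s. \<integral>y. w (s *\<^sub>R a + y) \<partial>lborel) has_derivative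
      (\<lambda>k. \<integral>y. k * (hk \<tau> x (0 *\<^sub>R a + y) * \<Theta> (0 *\<^sub>R a + y)) \<partial>lborel)) (at 0)"
  proof (rule has_derivative_integral_dominated[where e = 1 and B = "\<lambda>y. C * exp (- norm y)"
        and F' = "\<lambda>s y k. k * (hk \<tau> x (s *\<^sub>R a + y) * \<Theta> (s *\<^sub>R a + y))"])
    show "integrable lborel (\<lambda>y. w (s *\<^sub>R a + y))" for s
      using lborel_integral_translate(2)[OF wm] wi by simp
    show "((\<lambda>s. w (s *\<^sub>R a + y)) has_derivative (\<lambda>k. k * (hk \<tau> x (s *\<^sub>R a + y) * \<Theta> (s *\<^sub>R a + y)))) (at s)" for s y
    proof -
      define z where "z = s *\<^sub>R a + y"
      have lin: "linear (\<Psi>' z)" using der has_derivative_linear by blast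
      have "((\<lambda>s. w (s *\<^sub>R a + y)) has_derivative (\<lambda>k. hk \<tau> x z * \<Psi>' z (k *\<^sub>R a)
           - hk \<tau> x z * (((z - x) \<bullet> (k *\<^sub>R a)) / \<tau>) * \<Psi> z)) (at s)"
        unfolding z_def by (rule has_derivative_compose[OF _ der_w, of "\<lambda>s. s *\<^sub>R a + y"]) (auto intro!: derivative_eq_intros)
      then show ?thesis
        unfolding z_def[symmetric]
        by (rule has_derivative_eq_rhs) (simp add: fun_eq_iff \<Theta>_def linear_cmul[OF lin] algebra_simps diff_divide_distrib)
    qed
    show "norm (k * (hk \<tau> x (s *\<^sub>R a + y) * \<Theta> (s *\<^sub>R a + y))) \<le> C * exp (- norm y) * norm k"
      if s: "s \<in> ball 0 1" for s y k
    proof -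
      have sa: "norm (s *\<^sub>R a) \<le> norm a" using s by (simp add: mult_left_le_one_le)
      have hk_shift: "hk \<tau> x (s *\<^sub>R a + y) = hk \<tau> (x - s *\<^sub>R a) y" by (simp add: hk_def algebra_simps)
      have "norm (s *\<^sub>R a + y) \<le> norm a + norm y" using sa norm_triangle_ineq[of "s *\<^sub>R a" y] by linarith
      then have "B * norm (s *\<^sub>R a + y) \<le> B * (norm a + norm y)" using AB(2) by (intro mult_left_mono)
      then have "A * exp (B * norm (s *\<^sub>R a + y)) \<le> A * exp (B * norm a + B * norm y)"
        using AB(1) by (intro mult_left_mono) (auto simp: algebra_simps)
      then have 1: "norm (\<Theta> (s *\<^sub>R a + y)) \<le> A * exp (B * norm a) * exp (B * norm y)"
        using AB(3)[of "s *\<^sub>R a + y"] by (simp add: exp_add mult.assoc)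
      have "hk \<tau> (x - s *\<^sub>R a) y * 1 * exp (B * norm y)
         \<le> hk \<tau> (x - s *\<^sub>R a) y * (1 + norm (y - (x - s *\<^sub>R a)))\<^sup>2 * exp (B * norm y)"
        by (intro mult_right_mono mult_left_mono one_le_square_one_plus) auto
      also have "\<dots> \<le> exp ((B + 1) * (norm x + norm a) + (B + 3)\<^sup>2 * \<tau> / 2) * exp (- norm y)"
        by (rule hk_dominated[OF \<tau> order_refl _ AB(2)])
           (use sa norm_triangle_ineq4[of x "s *\<^sub>R a"] in linarith)
      finally have 2: "hk \<tau> (x - s *\<^sub>R a) y * exp (B * norm y) \<le>
          exp ((B + 1) * (norm x + norm a) + (B + 3)\<^sup>2 * \<tau> / 2) * exp (- norm y)" by simp
      have "hk \<tau> (x - s *\<^sub>R a) y * norm (\<Theta> (s *\<^sub>R a + y)) \<le>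
          hk \<tau> (x - s *\<^sub>R a) y * (A * exp (B * norm a) * exp (B * norm y))"
        by (intro mult_left_mono 1) auto
      also have "\<dots> = A * exp (B * norm a) * (hk \<tau> (x - s *\<^sub>R a) y * exp (B * norm y))" by simp
      also have "\<dots> \<le> C * exp (- norm y)"
        unfolding C_def mult.assoc using AB(1) 2 by (intro mult_left_mono) (auto simp: mult.assoc)
      finally have "norm k * (hk \<tau> (x - s *\<^sub>R a) y * norm (\<Theta> (s *\<^sub>R a + y))) \<le> norm k * (C * exp (- norm y))"
        by (intro mult_left_mono) auto
      then show ?thesis unfolding hk_shift by (simp add: abs_mult mult.commute mult.left_commute)
    qed
    show "integrable lborel (\<lambda>y::'a. C * exp (- norm y))"
      by (intro integrable_mult_right integrable_exp_neg_norm)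
    show "0 \<le> C * exp (- norm y)" for y :: 'a using AB(1) by (simp add: C_def)
    show "(\<lambda>y. k * (hk \<tau> x (0 *\<^sub>R a + y) * \<Theta> (0 *\<^sub>R a + y))) \<in> borel_measurable lborel" for k
      using exp_growth_measurable[OF \<Theta>] by simp
  qed simp
  then have "((\<lambda>s::real. \<integral>y. w y \<partial>lborel) has_derivative (\<lambda>k. k * HI \<tau> \<Theta> x)) (at 0)"
    by (simp add: lborel_integral_translate(1)[OF wm] HI_def)
  then have "(\<lambda>k. k * HI \<tau> \<Theta> x) = (\<lambda>k::real. 0)"
    by (rule has_derivative_unique) (rule has_derivative_const)
  then have "HI \<tau> \<Theta> x = 0" by (metis mult_1)
  then show ?thesis unfolding \<Theta>_def
    by (subst (asm) HI_diff) (auto intro!: exp_growth_intros g0 g1 \<tau>)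
qed

text \<open>Written so that the quotient itself reappears on the right: for p = N / D the derivative
  is (N' - D' p) / D, the shape in which \<open>P1\<close> and \<open>Pt\<close> are defined
  below.\<close>

lemma has_derivative_quotient:
  fixes N :: "'p::real_normed_vector \<Rightarrow> 'b::real_normed_vector" and D :: "'p \<Rightarrow> real"
  assumes "(N has_derivative N') (at x)" "(D has_derivative D') (at x)" "D x \<noteq> 0"
  shows "((\<lambda>x. N x /\<^sub>R D x) has_derivative (\<lambda>h. (N' h - D' h *\<^sub>R (N x /\<^sub>R D x)) /\<^sub>R D x)) (at x)"
  using has_derivative_scaleR[OF Deriv.has_derivative_inverse[OF assms(3,2)] assms(1)]
  by (rule has_derivative_eq_rhs) (simp add: fun_eq_iff algebra_simps)

lemma orthonormal_weight_sum:
  fixes S :: "'a::euclidean_space set"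
  assumes "finite S" "pairwise orthogonal S" "\<And>b. b \<in> S \<Longrightarrow> norm b = 1" "span S = UNIV"
  shows "(\<Sum>b\<in>S. (z \<bullet> b) * (z \<bullet> b)) = (norm z)\<^sup>2" and "(\<Sum>b\<in>S. (z \<bullet> b) *\<^sub>R b) = z"
proof -
  show e: "(\<Sum>b\<in>S. (z \<bullet> b) *\<^sub>R b) = z"
    by (rule orthonormal_basis_expand) (use assms in auto)
  have "(norm z)\<^sup>2 = z \<bullet> (\<Sum>b\<in>S. (z \<bullet> b) *\<^sub>R b)" by (simp add: e power2_norm_eq_inner)
  also have "\<dots> = (\<Sum>b\<in>S. (z \<bullet> b) * (z \<bullet> b))" by (simp add: inner_sum_right)
  finally show "(\<Sum>b\<in>S. (z \<bullet> b) * (z \<bullet> b)) = (norm z)\<^sup>2" by simp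
qed

text \<open>The kernel is not normalised, hence the zeroth-order term in the heat equation;
  it cancels in quotients of solutions.\<close>

lemma HI_heat_equation:
  fixes S :: "'a::euclidean_space set" and \<Phi> :: "'a \<Rightarrow> 'b::euclidean_space"
  assumes \<tau>: "0 < \<tau>" and S: "finite S" "pairwise orthogonal S" "\<And>b. b \<in> S \<Longrightarrow> norm b = 1"
    "card S = DIM('a)" "span S = UNIV" and \<Phi>: "exp_growth \<Phi>"
  shows "(\<Sum>b\<in>S. HI \<tau> (\<lambda>y. (((y - x) \<bullet> b) * ((y - x) \<bullet> b) / \<tau>\<^sup>2 - (b \<bullet> b) / \<tau>) *\<^sub>R \<Phi> y) x)
    = 2 *\<^sub>R HI \<tau> (\<lambda>y. ((norm (y - x))\<^sup>2 / (2 * \<tau>\<^sup>2)) *\<^sub>R \<Phi> y) x - (real DIM('a) / \<tau>) *\<^sub>R HI \<tau> \<Phi> x"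
proof -
  have "(\<Sum>b\<in>S. HI \<tau> (\<lambda>y. (((y - x) \<bullet> b) * ((y - x) \<bullet> b) / \<tau>\<^sup>2 - (b \<bullet> b) / \<tau>) *\<^sub>R \<Phi> y) x)
    = HI \<tau> (\<lambda>y. \<Sum>b\<in>S. (((y - x) \<bullet> b) * ((y - x) \<bullet> b) / \<tau>\<^sup>2 - (b \<bullet> b) / \<tau>) *\<^sub>R \<Phi> y) x"
    by (rule HI_sum[symmetric, OF \<tau>]) (intro exp_growth_intros \<Phi>)
  also have "(\<lambda>y. \<Sum>b\<in>S. (((y - x) \<bullet> b) * ((y - x) \<bullet> b) / \<tau>\<^sup>2 - (b \<bullet> b) / \<tau>) *\<^sub>R \<Phi> y)
    = (\<lambda>y. 2 *\<^sub>R (((norm (y - x))\<^sup>2 / (2 * \<tau>\<^sup>2)) *\<^sub>R \<Phi> y) - (real DIM('a) / \<tau>) *\<^sub>R \<Phi> y)"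
  proof
    fix y
    have "(\<Sum>b\<in>S. ((y - x) \<bullet> b) * ((y - x) \<bullet> b) / \<tau>\<^sup>2 - (b \<bullet> b) / \<tau>) = (norm (y - x))\<^sup>2 / \<tau>\<^sup>2 - real DIM('a) / \<tau>"
    proof -
      have "(\<Sum>b\<in>S. (b \<bullet> b) / \<tau>) = (\<Sum>b\<in>S. 1 / \<tau>)"
        by (intro sum.cong) (use S(3) in \<open>auto simp: dot_square_norm\<close>)
      moreover have "(\<Sum>b\<in>S. ((y - x) \<bullet> b) * ((y - x) \<bullet> b) / \<tau>\<^sup>2) = (norm (y - x))\<^sup>2 / \<tau>\<^sup>2"
        using orthonormal_weight_sum(1)[OF S(1,2,3,5)] by (simp add: sum_divide_distrib[symmetric])
      ultimately show ?thesis using S(4) by (simp add: sum_subtractf)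
    qed
    then show "(\<Sum>b\<in>S. (((y - x) \<bullet> b) * ((y - x) \<bullet> b) / \<tau>\<^sup>2 - (b \<bullet> b) / \<tau>) *\<^sub>R \<Phi> y)
      = 2 *\<^sub>R (((norm (y - x))\<^sup>2 / (2 * \<tau>\<^sup>2)) *\<^sub>R \<Phi> y) - (real DIM('a) / \<tau>) *\<^sub>R \<Phi> y"
      unfolding scaleR_sum_left[symmetric] by (simp add: scaleR_left_diff_distrib)
  qed
  also have "HI \<tau> \<dots> x = 2 *\<^sub>R HI \<tau> (\<lambda>y. ((norm (y - x))\<^sup>2 / (2 * \<tau>\<^sup>2)) *\<^sub>R \<Phi> y) x - (real DIM('a) / \<tau>) *\<^sub>R HI \<tau> \<Phi> x"
    by (subst HI_diff[OF \<tau>]) (intro exp_growth_intros \<Phi> | simp only: HI_scaleR)+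
  finally show ?thesis .
qed

section \<open>The comparison principle\<close>

text \<open>A negative second derivative would make the first derivative negative immediately to the
  right of 0, and the mean value theorem would produce a smaller value. The second derivative is
  taken at 0 only, which matches the line derivative \<open>P2\<close>.\<close>

lemma local_min_second_derivative:
  fixes \<psi> \<psi>' :: "real \<Rightarrow> real"
  assumes "d > 0" and 1: "\<And>s. \<bar>s\<bar> < d \<Longrightarrow> (\<psi> has_real_derivative \<psi>' s) (at s)"
    and 2: "(\<psi>' has_real_derivative c) (at 0)" and min: "\<And>s. \<bar>s\<bar> < d \<Longrightarrow> \<psi> 0 \<le> \<psi> s"
  shows "0 \<le> c"
proof (rule ccontr)
  assume "\<not> 0 \<le> c"
  have z: "\<psi>' 0 = 0"
    by (rule DERIV_local_min[OF 1 \<open>d > 0\<close>]) (use min \<open>d > 0\<close> in auto)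
  obtain e where e: "e > 0" "\<And>h. h > 0 \<Longrightarrow> h < e \<Longrightarrow> \<psi>' (0 + h) < \<psi>' 0"
    using DERIV_neg_dec_right[OF 2] \<open>\<not> 0 \<le> c\<close> by auto
  define h where "h = min d e / 2"
  have h: "0 < h" "h < d" "h < e" using \<open>d > 0\<close> e(1) by (auto simp: h_def)
  obtain w where w: "0 < w" "w < h" "\<psi> h - \<psi> 0 = (h - 0) * \<psi>' w"
    using MVT2[OF h(1), of \<psi> \<psi>'] 1 h by (metis abs_of_nonneg le_less_trans)
  have "\<psi>' w < 0" using e(2)[of w] w h z by auto
  then have "\<psi> h < \<psi> 0" using w h mult_pos_neg[of h "\<psi>' w"] by simp
  then show False using min[of h] h by simp
qed

text \<open>The comparison argument isolated from Gaussian integrals: \<open>Pt\<close>,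
  \<open>P1\<close> and \<open>P2\<close> are the time derivative, the differential and the second
  directional derivative of p. The equation is required in every orthonormal basis because the basis
  will be adapted to the pair of points. \<open>lip\<close> keeps a first contact off the diagonal;
  \<open>growth\<close> keeps it in a ball and controls the drift acting on the penalty.\<close>

locale reflection_comparison =
  fixes L T C0 :: real and p Pt :: "real \<Rightarrow> 'a::euclidean_space \<Rightarrow> 'a"
    and P1 P2 :: "real \<Rightarrow> 'a \<Rightarrow> 'a \<Rightarrow> 'a"
  assumes L: "L > 0" and T: "T > 0"
    and init: "fL_monotone L (p 0)"
    and cont: "\<And>x. continuous_on {0..T} (\<lambda>\<tau>. p \<tau> x)"
    and lip: "\<And>R. \<exists>C\<ge>0. \<forall>\<tau>\<in>{0..T}. \<forall>x\<in>cball 0 R. \<forall>y\<in>cball 0 R.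
        norm (p \<tau> x - p \<tau> y) \<le> C * norm (x - y)"
    and growth: "\<And>\<tau> x. \<tau> \<in> {0..T} \<Longrightarrow> norm (p \<tau> x) \<le> C0 * (1 + norm x)"
    and d1: "\<And>\<tau> x. 0 < \<tau> \<Longrightarrow> \<tau> \<le> T \<Longrightarrow> (p \<tau> has_derivative P1 \<tau> x) (at x)"
    and d2: "\<And>\<tau> x a. 0 < \<tau> \<Longrightarrow> \<tau> \<le> T \<Longrightarrow>
        ((\<lambda>s. P1 \<tau> (x + s *\<^sub>R a) a) has_vector_derivative P2 \<tau> x a) (at 0)"
    and P2_even: "\<And>\<tau> x a. P2 \<tau> x (- a) = P2 \<tau> x a"
    and dt: "\<And>\<tau> x. 0 < \<tau> \<Longrightarrow> \<tau> \<le> T \<Longrightarrow> ((\<lambda>\<tau>. p \<tau> x) has_vector_derivative Pt \<tau> x) (at \<tau>)"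
    and pde: "\<And>\<tau> x S. 0 < \<tau> \<Longrightarrow> \<tau> \<le> T \<Longrightarrow> finite S \<Longrightarrow> pairwise orthogonal S \<Longrightarrow>
        (\<And>b. b \<in> S \<Longrightarrow> norm b = 1) \<Longrightarrow> card S = DIM('a) \<Longrightarrow> span S = UNIV \<Longrightarrow>
        Pt \<tau> x = (1/2) *\<^sub>R (\<Sum>b\<in>S. P2 \<tau> x b) - P1 \<tau> x (p \<tau> x)"
begin

lemma C0_nonneg: "0 \<le> C0"
  using growth[of 0 0] T norm_ge_zero[of "p 0 0"] by (simp del: norm_ge_zero)

text \<open>The growth rate of the penalty, read off from \<open>Z_no_first_zero\<close>: with V = 1
  + |x|^2 + |y|^2, the diffusion costs 2 d, the reaction term f' V at most L V, the drift at most 4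
  C0 V, and the final 1 makes the contradiction strict.\<close>

definition rate :: real where "rate = 2 * real DIM('a) + L + 4 * C0 + 1"

definition Z :: "real \<Rightarrow> real \<Rightarrow> 'a \<Rightarrow> 'a \<Rightarrow> real" where
  "Z \<epsilon> \<tau> x y = ((p \<tau> x - p \<tau> y) \<bullet> (x - y)) / norm (x - y) + fL L (norm (x - y))
      + \<epsilon> * exp (rate * \<tau>) * (1 + x \<bullet> x + y \<bullet> y)"

lemma Z_time_derivative:
  assumes "0 < \<tau>" "\<tau> \<le> T"
  shows "((\<lambda>\<tau>. Z \<epsilon> \<tau> x y) has_real_derivative ((Pt \<tau> x - Pt \<tau> y) \<bullet> (x - y)) / norm (x - y)
     + rate * (\<epsilon> * exp (rate * \<tau>)) * (1 + x \<bullet> x + y \<bullet> y)) (at \<tau>)"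
proof -
  have "((\<lambda>\<tau>. (p \<tau> x - p \<tau> y) \<bullet> (x - y)) has_real_derivative (Pt \<tau> x - Pt \<tau> y) \<bullet> (x - y)) (at \<tau>)"
    unfolding has_real_derivative_iff_has_vector_derivative
    by (intro bounded_linear.has_vector_derivative[OF bounded_linear_inner_left]
        has_vector_derivative_diff dt assms)
  then have 1: "((\<lambda>\<tau>. ((p \<tau> x - p \<tau> y) \<bullet> (x - y)) / norm (x - y)) has_real_derivative
      ((Pt \<tau> x - Pt \<tau> y) \<bullet> (x - y)) / norm (x - y)) (at \<tau>)"
    by (rule DERIV_cdivide)
  have 2: "((\<lambda>\<tau>. fL L (norm (x - y)) + \<epsilon> * exp (rate * \<tau>) * (1 + x \<bullet> x + y \<bullet> y)) has_real_derivative
      rate * (\<epsilon> * exp (rate * \<tau>)) * (1 + x \<bullet> x + y \<bullet> y)) (at \<tau>)"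
    by (auto intro!: derivative_eq_intros)
  from DERIV_add[OF 1 2] show ?thesis unfolding Z_def by (simp add: add.assoc)
qed

section \<open>Conditions at a spatial minimum of the penalised two-point function\<close>

lemma p_line_derivative:
  assumes "0 < \<tau>" "\<tau> \<le> T"
  shows "((\<lambda>s. p \<tau> (x + s *\<^sub>R a)) has_vector_derivative P1 \<tau> (x + s *\<^sub>R a) a) (at s)"
proof -
  have "((\<lambda>s. p \<tau> (x + s *\<^sub>R a)) has_derivative (\<lambda>h. P1 \<tau> (x + s *\<^sub>R a) (h *\<^sub>R a))) (at s)"
    by (rule has_derivative_compose[OF _ d1[OF assms], of "\<lambda>s. x + s *\<^sub>R a"])
       (auto intro!: derivative_eq_intros)
  moreover have "linear (P1 \<tau> (x + s *\<^sub>R a))"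
    using d1[OF assms] has_derivative_linear by blast
  ultimately show ?thesis unfolding has_vector_derivative_def
    by (simp add: linear_cmul)
qed

text \<open>The pair is moved along (x + s b, y + \<sigma> s b): \<sigma> = 1 is the synchronous
  motion, \<sigma> = -1 with b = e the reflected one. In both cases x - y stays a multiple of e, so
  the direction is frozen and only p, f and the penalty are differentiated. The distance changes at
  speed 1 - \<sigma>, hence the factor (1 - \<sigma>)^2 in front of f''.\<close>

lemma Z_second_order:
  assumes \<tau>: "0 < \<tau>" "\<tau> \<le> T" and ne: "x \<noteq> y"
    and z0: "Z \<epsilon> \<tau> x y = 0" and zmin: "\<And>x y. x \<noteq> y \<Longrightarrow> 0 \<le> Z \<epsilon> \<tau> x y"
    and b: "norm b = 1" and \<sigma>: "\<sigma> = 1 \<or> \<sigma> = -1 \<and> b = sgn (x - y)"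
  shows "0 \<le> ((P2 \<tau> x b - P2 \<tau> y b) \<bullet> (x - y)) / norm (x - y)
     + (1 - \<sigma>)\<^sup>2 * (- (fL L (norm (x - y)) / 2) * ((sqrt L)\<^sup>2 * (1 - (tanh (norm (x - y) * sqrt L / 2))\<^sup>2)))
     + 4 * (\<epsilon> * exp (rate * \<tau>))"
proof -
  define r where "r = norm (x - y)"
  define e where "e = sgn (x - y)"
  define E where "E = \<epsilon> * exp (rate * \<tau>)"
  define f' where "f' r = (sqrt L)\<^sup>2 * (1 - (tanh (r * sqrt L / 2))\<^sup>2)" for r
  have r: "r > 0" using ne by (simp add: r_def)
  have xy: "x - y = r *\<^sub>R e" unfolding r_def e_def sgn_div_norm using ne by simp
  have ne1: "norm e = 1" unfolding e_def using ne by (simp add: norm_sgn)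
  have s2: "\<sigma> * \<sigma> = 1" using \<sigma> by auto
  define c where "c = \<sigma> *\<^sub>R b"
  define k where "k = 1 - \<sigma>"
  \<comment> \<open>Either k = 0 or b = e, so the relative displacement k s b is always parallel to
    e.\<close>
  have kb: "k *\<^sub>R b = k *\<^sub>R e" using \<sigma> unfolding k_def e_def by auto
  have k2: "\<bar>k\<bar> \<le> 2" using \<sigma> unfolding k_def by auto
  define \<psi> where "\<psi> s = (p \<tau> (x + s *\<^sub>R b) - p \<tau> (y + s *\<^sub>R c)) \<bullet> e + fL L (r + k * s)
      + E * (1 + (x + s *\<^sub>R b) \<bullet> (x + s *\<^sub>R b) + (y + s *\<^sub>R c) \<bullet> (y + s *\<^sub>R c))" for s
  define \<psi>' where "\<psi>' s = (P1 \<tau> (x + s *\<^sub>R b) b - P1 \<tau> (y + s *\<^sub>R c) c) \<bullet> e + k * f' (r + k * s)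
      + E * (2 * ((x + s *\<^sub>R b) \<bullet> b) + 2 * ((y + s *\<^sub>R c) \<bullet> c))" for s
  have diff: "x + s *\<^sub>R b - (y + s *\<^sub>R c) = (r + k * s) *\<^sub>R e" for s
  proof -
    have "x + s *\<^sub>R b - (y + s *\<^sub>R c) = (x - y) + s *\<^sub>R (k *\<^sub>R b)"
      by (simp add: c_def k_def algebra_simps)
    also have "\<dots> = (r + k * s) *\<^sub>R e" unfolding kb xy by (simp add: algebra_simps)
    finally show ?thesis .
  qed
  \<comment> \<open>With |k| <= 2, restricting to |s| < r / 2 keeps the pair off the diagonal, and
    the direction of the difference is still e.\<close>
  have pos: "r + k * s > 0" if "\<bar>s\<bar> < r / 2" for s
  proof -
    have "\<bar>k * s\<bar> \<le> 2 * \<bar>s\<bar>" using k2 by (auto simp: abs_mult intro: mult_right_mono)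
    then show ?thesis using that by linarith
  qed
  have eq: "\<psi> s = Z \<epsilon> \<tau> (x + s *\<^sub>R b) (y + s *\<^sub>R c)" if "\<bar>s\<bar> < r / 2" for s
    unfolding Z_def diff \<psi>_def E_def using pos[OF that] ne1 by simp
  have eq0: "\<psi> 0 = Z \<epsilon> \<tau> x y" using eq[of 0] r by simp
  have "0 \<le> ((P2 \<tau> x b - P2 \<tau> y c) \<bullet> e) + k * (k * (- (fL L r / 2) * f' r)) + E * (2 * (b \<bullet> b) + 2 * (c \<bullet> c))"
  proof (rule local_min_second_derivative)
    show "r / 2 > 0" using r by simp
    show "\<psi> 0 \<le> \<psi> s" if "\<bar>s\<bar> < r / 2" for s
    proof -
      have "x + s *\<^sub>R b \<noteq> y + s *\<^sub>R c" using diff[of s] pos[OF that] ne1 by fastforce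
      then show ?thesis using zmin eq[OF that] eq0 z0 by simp
    qed
    show "(\<psi> has_real_derivative \<psi>' s) (at s)" for s
    proof -
      have 1: "((\<lambda>s. (p \<tau> (x + s *\<^sub>R b) - p \<tau> (y + s *\<^sub>R c)) \<bullet> e) has_real_derivative
         (P1 \<tau> (x + s *\<^sub>R b) b - P1 \<tau> (y + s *\<^sub>R c) c) \<bullet> e) (at s)"
        unfolding has_real_derivative_iff_has_vector_derivative
        by (intro bounded_linear.has_vector_derivative[OF bounded_linear_inner_left]
            has_vector_derivative_diff p_line_derivative \<tau>)
      have 2: "((\<lambda>s. fL L (r + k * s)) has_real_derivative f' (r + k * s) * k) (at s)"
        unfolding f'_def by (rule DERIV_chain2[OF has_derivative_fL]) (auto intro!: derivative_eq_intros)
      have 3: "((\<lambda>s. E * (1 + (x + s *\<^sub>R b) \<bullet> (x + s *\<^sub>R b) + (y + s *\<^sub>R c) \<bullet> (y + s *\<^sub>R c))) has_real_derivative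
         E * (2 * ((x + s *\<^sub>R b) \<bullet> b) + 2 * ((y + s *\<^sub>R c) \<bullet> c))) (at s)"
        unfolding has_field_derivative_def
        by (auto intro!: derivative_eq_intros simp: fun_eq_iff algebra_simps inner_commute)
      from DERIV_add[OF DERIV_add[OF 1 2] 3] show ?thesis
        unfolding \<psi>_def[abs_def] \<psi>'_def by (simp add: mult.commute)
    qed
    show "(\<psi>' has_real_derivative ((P2 \<tau> x b - P2 \<tau> y c) \<bullet> e) + k * (k * (- (fL L r / 2) * f' r))
       + E * (2 * (b \<bullet> b) + 2 * (c \<bullet> c))) (at 0)"
    proof -
      have 1: "((\<lambda>s. (P1 \<tau> (x + s *\<^sub>R b) b - P1 \<tau> (y + s *\<^sub>R c) c) \<bullet> e) has_real_derivative
         (P2 \<tau> x b - P2 \<tau> y c) \<bullet> e) (at 0)"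
        unfolding has_real_derivative_iff_has_vector_derivative
        by (intro bounded_linear.has_vector_derivative[OF bounded_linear_inner_left]
            has_vector_derivative_diff d2 \<tau>)
      have "(f' has_real_derivative - (fL L (r + k * 0) / 2) * f' (r + k * 0)) (at (r + k * 0))"
        unfolding f'_def by (rule has_derivative_fL')
      then have "((\<lambda>s. f' (r + k * s)) has_real_derivative (- (fL L (r + k * 0) / 2) * f' (r + k * 0)) * k) (at 0)"
        by (rule DERIV_chain2) (auto intro!: derivative_eq_intros)
      then have 2: "((\<lambda>s. k * f' (r + k * s)) has_real_derivative k * (k * (- (fL L r / 2) * f' r))) (at 0)"
        by (auto intro!: derivative_eq_intros)
      have 3: "((\<lambda>s. E * (2 * ((x + s *\<^sub>R b) \<bullet> b) + 2 * ((y + s *\<^sub>R c) \<bullet> c))) has_real_derivative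
         E * (2 * (b \<bullet> b) + 2 * (c \<bullet> c))) (at 0)"
        unfolding has_field_derivative_def
        by (auto intro!: derivative_eq_intros simp: fun_eq_iff algebra_simps)
      from DERIV_add[OF DERIV_add[OF 1 2] 3] show ?thesis
        unfolding \<psi>'_def[abs_def] .
    qed
  qed
  moreover have "b \<bullet> b = 1" using b by (simp add: dot_square_norm)
  moreover have "c \<bullet> c = 1" unfolding c_def using s2 \<open>b \<bullet> b = 1\<close> by (simp add: mult.assoc[symmetric])
  moreover have "P2 \<tau> y c = P2 \<tau> y b" unfolding c_def using \<sigma> P2_even by auto
  moreover have "(v \<bullet> (x - y)) / norm (x - y) = v \<bullet> e" for v
    unfolding xy using r ne1 by simp
  ultimately show ?thesis
    unfolding r_def[symmetric] E_def[symmetric] k_def[symmetric] f'_def[symmetric]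
    by (simp add: power2_eq_square mult.assoc)
qed

text \<open>Here the minimum is tested along the drift (-p(x), -p(y)), where the derivative of Z
  vanishes. The direction e now rotates; its contribution is -(|D|^2 - <D, e>^2) / r <= 0, and
  dropping it turns the equality into the stated inequality.\<close>

lemma Z_first_order:
  assumes \<tau>: "0 < \<tau>" "\<tau> \<le> T" and ne: "x \<noteq> y"
    and z0: "Z \<epsilon> \<tau> x y = 0" and zmin: "\<And>x y. x \<noteq> y \<Longrightarrow> 0 \<le> Z \<epsilon> \<tau> x y"
  shows "((P1 \<tau> x (p \<tau> x) - P1 \<tau> y (p \<tau> y)) \<bullet> (x - y)) / norm (x - y)
     \<le> - ((sqrt L)\<^sup>2 * (1 - (tanh (norm (x - y) * sqrt L / 2))\<^sup>2))
          * (((p \<tau> x - p \<tau> y) \<bullet> (x - y)) / norm (x - y))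
       - 2 * (\<epsilon> * exp (rate * \<tau>)) * (x \<bullet> p \<tau> x + y \<bullet> p \<tau> y)"
proof -
  define r where "r = norm (x - y)"
  define e where "e = sgn (x - y)"
  define E where "E = \<epsilon> * exp (rate * \<tau>)"
  define f' where "f' r = (sqrt L)\<^sup>2 * (1 - (tanh (r * sqrt L / 2))\<^sup>2)" for r
  define D where "D = p \<tau> x - p \<tau> y"
  define q where "q = P1 \<tau> x (p \<tau> x) - P1 \<tau> y (p \<tau> y)"
  have r: "r > 0" using ne by (simp add: r_def)
  have xy: "x - y = r *\<^sub>R e" unfolding r_def e_def sgn_div_norm using ne by simp
  have ne1: "norm e = 1" unfolding e_def using ne by (simp add: norm_sgn)
  define a where "a = - p \<tau> x"
  define c where "c = - p \<tau> y"
  have ac: "a - c = - D" by (simp add: a_def c_def D_def)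
  have lin: "linear (P1 \<tau> z)" for z using d1[OF \<tau>] has_derivative_linear by blast
  have q': "P1 \<tau> x a - P1 \<tau> y c = - q"
    by (simp add: a_def c_def q_def linear_neg[OF lin])
  define w where "w s = (x + s *\<^sub>R a) - (y + s *\<^sub>R c)" for s
  have w0: "w 0 = x - y" by (simp add: w_def)
  have dw: "(w has_vector_derivative (a - c)) (at s)" for s
    unfolding w_def by (auto intro!: derivative_eq_intros)
  have dn: "((\<lambda>s. norm (w s)) has_real_derivative - (e \<bullet> D)) (at 0)"
  proof -
    have "((\<lambda>s. norm (w s)) has_derivative (\<lambda>h. (h *\<^sub>R (a - c)) \<bullet> sgn (w 0))) (at 0)"
      by (rule has_derivative_compose[OF dw[unfolded has_vector_derivative_def] has_derivative_norm])
         (use ne in \<open>simp add: w0\<close>)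
    then show ?thesis unfolding has_field_derivative_def
      by (rule has_derivative_eq_rhs) (simp add: fun_eq_iff w0 ac e_def inner_commute)
  qed
  have dP: "((\<lambda>s. p \<tau> (x + s *\<^sub>R a) - p \<tau> (y + s *\<^sub>R c)) has_vector_derivative - q) (at 0)"
    using has_vector_derivative_diff[OF p_line_derivative[OF \<tau>, of x a 0] p_line_derivative[OF \<tau>, of y c 0]]
    by (simp add: q')
  have dPw: "((\<lambda>s. (p \<tau> (x + s *\<^sub>R a) - p \<tau> (y + s *\<^sub>R c)) \<bullet> w s) has_real_derivative
      D \<bullet> (- D) + (- q) \<bullet> (x - y)) (at 0)"
    using bounded_bilinear.has_vector_derivative[OF bounded_bilinear_inner dP dw]
    unfolding has_real_derivative_iff_has_vector_derivative
    by (simp add: w0 ac D_def[symmetric])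
  have 1: "((\<lambda>s. ((p \<tau> (x + s *\<^sub>R a) - p \<tau> (y + s *\<^sub>R c)) \<bullet> w s) / norm (w s)) has_real_derivative
      ((D \<bullet> (- D) + (- q) \<bullet> (x - y)) * r - (D \<bullet> (x - y)) * (- (e \<bullet> D))) / (r * r)) (at 0)"
    using DERIV_divide[OF dPw dn] ne by (simp add: w0 r_def D_def)
  have 2: "((\<lambda>s. fL L (norm (w s))) has_real_derivative f' r * (- (e \<bullet> D))) (at 0)"
  proof (rule DERIV_chain2[OF _ dn])
    show "(fL L has_real_derivative f' r) (at (norm (w 0)))"
      unfolding f'_def w0 r_def by (rule has_derivative_fL)
  qed
  have 3: "((\<lambda>s. E * (1 + (x + s *\<^sub>R a) \<bullet> (x + s *\<^sub>R a) + (y + s *\<^sub>R c) \<bullet> (y + s *\<^sub>R c))) has_real_derivative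
         E * (2 * (x \<bullet> a) + 2 * (y \<bullet> c))) (at 0)"
    unfolding has_field_derivative_def
    by (auto intro!: derivative_eq_intros simp: fun_eq_iff algebra_simps inner_commute)
  have der: "((\<lambda>s. Z \<epsilon> \<tau> (x + s *\<^sub>R a) (y + s *\<^sub>R c)) has_real_derivative
     ((D \<bullet> (- D) + (- q) \<bullet> (x - y)) * r - (D \<bullet> (x - y)) * (- (e \<bullet> D))) / (r * r)
       + f' r * (- (e \<bullet> D)) + E * (2 * (x \<bullet> a) + 2 * (y \<bullet> c))) (at 0)"
    using DERIV_add[OF DERIV_add[OF 1 2] 3] unfolding Z_def w_def E_def .
  \<comment> \<open>Z is minimal only among pairs off the diagonal, so the test uses a neighbourhood
    of 0 on which w does not vanish.\<close>
  have "isCont w 0" using dw[of 0] has_vector_derivative_continuous by blast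
  moreover have "w 0 \<noteq> 0" using ne w0 by simp
  ultimately have "\<forall>\<^sub>F s in nhds 0. w s \<noteq> 0"
    using tendsto_imp_eventually_ne[of w "w 0" "nhds 0" 0] by (simp add: isCont_def tendsto_at_iff_tendsto_nhds)
  then obtain d where d: "d > 0" "\<And>s. \<bar>s\<bar> < d \<Longrightarrow> w s \<noteq> 0"
    unfolding eventually_nhds_metric by (auto simp: dist_real_def)
  have zero: "((D \<bullet> (- D) + (- q) \<bullet> (x - y)) * r - (D \<bullet> (x - y)) * (- (e \<bullet> D))) / (r * r)
       + f' r * (- (e \<bullet> D)) + E * (2 * (x \<bullet> a) + 2 * (y \<bullet> c)) = 0"
  proof (rule DERIV_local_min[OF der d(1)], intro allI impI)
    fix s :: real assume "\<bar>0 - s\<bar> < d"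
    then have "x + s *\<^sub>R a \<noteq> y + s *\<^sub>R c" using d(2)[of s] by (auto simp: w_def)
    then show "Z \<epsilon> \<tau> (x + 0 *\<^sub>R a) (y + 0 *\<^sub>R c) \<le> Z \<epsilon> \<tau> (x + s *\<^sub>R a) (y + s *\<^sub>R c)"
      using zmin z0 by simp
  qed
  have "((D \<bullet> (- D) + (- q) \<bullet> (x - y)) * r - (D \<bullet> (x - y)) * (- (e \<bullet> D))) / (r * r)
     = - (q \<bullet> e) - (D \<bullet> D - (D \<bullet> e)\<^sup>2) / r"
    unfolding xy using r by (simp add: field_simps power2_eq_square inner_commute)
  moreover have "0 \<le> (D \<bullet> D - (D \<bullet> e)\<^sup>2) / r"
  proof -
    have "(D \<bullet> e)\<^sup>2 \<le> (D \<bullet> D) * (e \<bullet> e)" by (rule Cauchy_Schwarz_ineq)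
    moreover have "e \<bullet> e = 1" using ne1 by (simp add: dot_square_norm)
    ultimately show ?thesis using r by simp
  qed
  ultimately have "q \<bullet> e \<le> - f' r * (D \<bullet> e) - 2 * E * (x \<bullet> p \<tau> x + y \<bullet> p \<tau> y)"
    using zero by (simp add: a_def c_def inner_commute algebra_simps)
  moreover have "(v \<bullet> (x - y)) / norm (x - y) = v \<bullet> e" for v
    unfolding xy using r ne1 by simp
  ultimately show ?thesis
    unfolding r_def[symmetric] E_def[symmetric] f'_def[symmetric] D_def[symmetric] q_def[symmetric]
    by simp
qed

section \<open>Compactness of the set where the penalised function is nonpositive\<close>

lemma continuous_on_p: "continuous_on ({0..T} \<times> UNIV) (\<lambda>(\<tau>, x). p \<tau> x)"
proof (rule continuous_on_TimesI)
  \<comment> \<open>Continuity in time at fixed x and a Lipschitz bound in x uniform in time combine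
    to joint continuity.\<close>
  show "local_lipschitz {0..T} UNIV p"
    unfolding local_lipschitz_def
  proof (intro ballI)
    fix x :: 'a and t assume "t \<in> {0..T}"
    obtain C where C: "C \<ge> 0" "\<forall>\<tau>\<in>{0..T}. \<forall>x'\<in>cball 0 (norm x + 1). \<forall>y\<in>cball 0 (norm x + 1).
        norm (p \<tau> x' - p \<tau> y) \<le> C * norm (x' - y)"
      using lip[of "norm x + 1"] by blast
    have sub: "z \<in> cball 0 (norm x + 1)" if "z \<in> cball x 1" for z
      using that norm_triangle_sub[of z x] by (simp add: dist_norm norm_minus_commute)
    have "C-lipschitz_on (cball x 1 \<inter> UNIV) (p \<tau>)" if "\<tau> \<in> {0..T}" for \<tau>
      using C that sub by (intro lipschitz_onI) (auto simp: dist_norm)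
    then show "\<exists>u>0. \<exists>L. \<forall>t\<in>cball t u \<inter> {0..T}. L-lipschitz_on (cball x u \<inter> UNIV) (p t)"
      by (intro exI[of _ 1] conjI exI[of _ C]) auto
  qed
qed (use cont in auto)

lemma Z_continuous_on:
  assumes "K \<subseteq> {0..T} \<times> UNIV \<times> UNIV" "\<And>\<tau> x y. (\<tau>, x, y) \<in> K \<Longrightarrow> x \<noteq> y"
  shows "continuous_on K (\<lambda>k. Z \<epsilon> (fst k) (fst (snd k)) (snd (snd k)))"
proof -
  have 1: "continuous_on K (\<lambda>k. p (fst k) (fst (snd k)))"
    by (rule continuous_on_compose2[OF continuous_on_p, of _ "\<lambda>k. (fst k, fst (snd k))", simplified])
       (use assms in \<open>auto intro!: continuous_intros\<close>)
  have 2: "continuous_on K (\<lambda>k. p (fst k) (snd (snd k)))"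
    by (rule continuous_on_compose2[OF continuous_on_p, of _ "\<lambda>k. (fst k, snd (snd k))", simplified])
       (use assms in \<open>auto intro!: continuous_intros\<close>)
  show ?thesis unfolding Z_def
    using assms(2) by (intro continuous_intros 1 2) auto
qed

text \<open>The penalty grows quadratically and p linearly, so nonpositivity confines the pair to a
  ball; the constant 1 in the penalty forces |p(x) - p(y)| >= \<epsilon>, which by the Lipschitz
  bound keeps x and y apart.\<close>

lemma Z_nonpos_bounded:
  assumes "\<epsilon> > 0" "\<tau> \<in> {0..T}" "x \<noteq> y" "Z \<epsilon> \<tau> x y \<le> 0"
  shows "(norm x)\<^sup>2 + (norm y)\<^sup>2 \<le> 2 * (2 * C0 + C0\<^sup>2 / \<epsilon>) / \<epsilon>"
    and "\<epsilon> \<le> norm (p \<tau> x - p \<tau> y)"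
proof -
  define r where "r = norm (x - y)"
  have r: "r > 0" using assms by (simp add: r_def)
  have rate: "rate > 0" unfolding rate_def using L C0_nonneg by simp
  have e1: "\<epsilon> * (1 + x \<bullet> x + y \<bullet> y) \<le> \<epsilon> * exp (rate * \<tau>) * (1 + x \<bullet> x + y \<bullet> y)"
    using assms rate by (intro mult_right_mono) auto
  have "\<bar>(p \<tau> x - p \<tau> y) \<bullet> (x - y)\<bar> \<le> norm (p \<tau> x - p \<tau> y) * r"
    unfolding r_def by (rule Cauchy_Schwarz_ineq2)
  then have "((p \<tau> x - p \<tau> y) \<bullet> (x - y)) / r \<ge> - norm (p \<tau> x - p \<tau> y)"
    using r by (simp add: pos_le_divide_eq)
  moreover have "fL L r \<ge> 0" using fL_nonneg L r by simp
  ultimately have main: "\<epsilon> * (1 + x \<bullet> x + y \<bullet> y) \<le> norm (p \<tau> x - p \<tau> y)"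
    using assms(4) e1 unfolding Z_def r_def[symmetric] by linarith
  moreover have "\<epsilon> * 1 \<le> \<epsilon> * (1 + x \<bullet> x + y \<bullet> y)"
    using assms(1) by (intro mult_left_mono) auto
  ultimately show "\<epsilon> \<le> norm (p \<tau> x - p \<tau> y)" by simp
  have "norm (p \<tau> x - p \<tau> y) \<le> C0 * (1 + norm x) + C0 * (1 + norm y)"
    using norm_triangle_ineq4[of "p \<tau> x" "p \<tau> y"] growth[OF assms(2), of x] growth[OF assms(2), of y] by linarith
  \<comment> \<open>Young's inequality with weight \<epsilon> leaves half of the quadratic penalty
    on the left.\<close>
  moreover have amgm: "C0 * s \<le> \<epsilon> * s\<^sup>2 / 2 + C0\<^sup>2 / \<epsilon> / 2" for s
  proof -
    have "0 \<le> (\<epsilon> * s - C0)\<^sup>2 / (2 * \<epsilon>)" using assms(1) by simp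
    also have "\<dots> = \<epsilon> * s\<^sup>2 / 2 + C0\<^sup>2 / \<epsilon> / 2 - C0 * s"
      using assms(1) by (simp add: power2_eq_square field_simps)
    finally show ?thesis by simp
  qed
  ultimately have "\<epsilon> * (1 + (norm x)\<^sup>2 + (norm y)\<^sup>2) \<le> 2 * C0 + \<epsilon> * (norm x)\<^sup>2 / 2 + \<epsilon> * (norm y)\<^sup>2 / 2 + C0\<^sup>2 / \<epsilon>"
    using main amgm[of "norm x"] amgm[of "norm y"] by (simp add: power2_norm_eq_inner algebra_simps)
  then have "\<epsilon> * ((norm x)\<^sup>2 + (norm y)\<^sup>2) \<le> 2 * (2 * C0 + C0\<^sup>2 / \<epsilon>)"
    using assms(1) by (simp add: algebra_simps)
  then show "(norm x)\<^sup>2 + (norm y)\<^sup>2 \<le> 2 * (2 * C0 + C0\<^sup>2 / \<epsilon>) / \<epsilon>"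
    using assms(1) by (simp add: pos_le_divide_eq mult.commute)
qed

text \<open>At a first contact the time derivative of Z is nonpositive while the two spatial
  conditions hold; inserting them into the equation for p cancels every term without \<epsilon>, and
  \<open>rate\<close> is chosen so that the remaining penalty terms are strictly positive.\<close>

lemma Z_no_first_zero:
  assumes "\<epsilon> > 0" and \<tau>: "0 < \<tau>" "\<tau> \<le> T" and ne: "x \<noteq> y"
    and z0: "Z \<epsilon> \<tau> x y = 0" and zmin: "\<And>x y. x \<noteq> y \<Longrightarrow> 0 \<le> Z \<epsilon> \<tau> x y"
    and before: "\<And>t. 0 \<le> t \<Longrightarrow> t < \<tau> \<Longrightarrow> 0 < Z \<epsilon> t x y"
  shows False
proof -
  define r where "r = norm (x - y)"
  define e where "e = sgn (x - y)"
  define E where "E = \<epsilon> * exp (rate * \<tau>)"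
  define V where "V = 1 + x \<bullet> x + y \<bullet> y"
  define f' where "f' = (sqrt L)\<^sup>2 * (1 - (tanh (r * sqrt L / 2))\<^sup>2)"
  have r: "r > 0" using ne by (simp add: r_def)
  have ne1: "norm e = 1" unfolding e_def using ne by (simp add: norm_sgn)
  have E: "E > 0" using assms(1) by (simp add: E_def)
  have V1: "V \<ge> 1" by (simp add: V_def)
  have dots: "(v \<bullet> (x - y)) / norm (x - y) = v \<bullet> e" for v
    unfolding e_def sgn_div_norm by (simp add: divide_inverse mult.commute)
  have f'0: "0 \<le> f'" and f'L: "f' \<le> L"
  proof -
    have "(tanh (r * sqrt L / 2))\<^sup>2 \<le> 1"
      using tanh_real_lt_1[of "r * sqrt L / 2"] tanh_real_gt_neg1[of "r * sqrt L / 2"]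
      unfolding abs_square_le_1 by linarith
    then show "0 \<le> f'" unfolding f'_def by simp
    have "L * (1 - (tanh (r * sqrt L / 2))\<^sup>2) \<le> L * 1" using L by (intro mult_left_mono) auto
    then show "f' \<le> L" unfolding f'_def using L by simp
  qed
  \<comment> \<open>A basis containing e: e is reflected, the other d - 1 vectors are moved
    synchronously.\<close>
  obtain S where S: "e \<in> S" "pairwise orthogonal S" "\<And>x. x \<in> S \<Longrightarrow> norm x = 1"
    "independent S" "card S = DIM('a)" "span S = UNIV"
    using vector_in_orthonormal_basis[OF ne1] by metis
  have fin: "finite S" using S(4) by (rule finiteI_independent)
  define Lx where "Lx = (\<Sum>b\<in>S. P2 \<tau> x b)"
  define Ly where "Ly = (\<Sum>b\<in>S. P2 \<tau> y b)"
  define q where "q = P1 \<tau> x (p \<tau> x) - P1 \<tau> y (p \<tau> y)"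
  define D where "D = p \<tau> x - p \<tau> y"
  have second: "0 \<le> (Lx - Ly) \<bullet> e - 2 * (fL L r * f') + 4 * real DIM('a) * E"
  proof -
    define s where "s b = (if b = e then -1 else 1 :: real)" for b
    have "0 \<le> (\<Sum>b\<in>S. (P2 \<tau> x b - P2 \<tau> y b) \<bullet> e + (1 - s b)\<^sup>2 * (- (fL L r / 2) * f') + 4 * E)"
    proof (rule sum_nonneg)
      fix b assume "b \<in> S"
      have "s b = 1 \<or> s b = -1 \<and> b = sgn (x - y)" by (auto simp: s_def e_def)
      from Z_second_order[OF \<tau> ne z0 zmin S(3)[OF \<open>b \<in> S\<close>] this]
      show "0 \<le> (P2 \<tau> x b - P2 \<tau> y b) \<bullet> e + (1 - s b)\<^sup>2 * (- (fL L r / 2) * f') + 4 * E"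
        unfolding dots E_def f'_def r_def by simp
    qed
    also have "\<dots> = (Lx - Ly) \<bullet> e + (\<Sum>b\<in>S. (1 - s b)\<^sup>2) * (- (fL L r / 2) * f') + 4 * real DIM('a) * E"
      unfolding Lx_def Ly_def
      by (simp only: sum.distrib inner_sum_left[symmetric] sum_distrib_right[symmetric] sum_subtractf)
        (simp add: S(5))
    \<comment> \<open>Only b = e contributes, with (1 - (-1))^2 = 4, so the sum over the basis
      contains 4 f'' = -2 f f'.\<close>
    also have "(\<Sum>b\<in>S. (1 - s b)\<^sup>2) = (\<Sum>b\<in>S. if b = e then 4 else 0)"
      by (intro sum.cong) (auto simp: s_def)
    also have "\<dots> = 4" using S(1) fin by simp
    finally show ?thesis by (simp add: mult.commute)
  qed
  have first: "q \<bullet> e \<le> - f' * (D \<bullet> e) - 2 * E * (x \<bullet> p \<tau> x + y \<bullet> p \<tau> y)"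
    using Z_first_order[OF \<tau> ne z0 zmin]
    unfolding dots E_def f'_def r_def q_def D_def .
  have time: "(Pt \<tau> x - Pt \<tau> y) \<bullet> e + rate * E * V \<le> 0"
  proof (rule ccontr)
    assume "\<not> ?thesis"
    moreover have "((\<lambda>\<tau>. Z \<epsilon> \<tau> x y) has_real_derivative (Pt \<tau> x - Pt \<tau> y) \<bullet> e + rate * E * V) (at \<tau>)"
      using Z_time_derivative[OF \<tau>, of \<epsilon> x y] unfolding dots E_def V_def .
    ultimately obtain d where d: "d > 0" "\<And>h. h > 0 \<Longrightarrow> h < d \<Longrightarrow> Z \<epsilon> (\<tau> - h) x y < Z \<epsilon> \<tau> x y"
      using DERIV_pos_inc_left[of "\<lambda>\<tau>. Z \<epsilon> \<tau> x y"] by (metis not_le)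
    define h where "h = min d \<tau> / 2"
    have "0 < h" "h < d" "h < \<tau>" using d(1) \<tau> by (auto simp: h_def)
    then show False using d(2)[of h] before[of "\<tau> - h"] z0 by simp
  qed
  have "Pt \<tau> x = (1/2) *\<^sub>R Lx - P1 \<tau> x (p \<tau> x)" "Pt \<tau> y = (1/2) *\<^sub>R Ly - P1 \<tau> y (p \<tau> y)"
    unfolding Lx_def Ly_def by (rule pde[OF \<tau> fin S(2,3,5,6)]; assumption)+
  then have "Pt \<tau> x - Pt \<tau> y = (1/2) *\<^sub>R (Lx - Ly) - q"
    unfolding q_def scaleR_right_diff_distrib by simp
  then have "(Pt \<tau> x - Pt \<tau> y) \<bullet> e = ((Lx - Ly) \<bullet> e) / 2 - q \<bullet> e"
    by (simp add: inner_diff_left)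
  moreover have De: "D \<bullet> e = - fL L r - E * V"
    using z0 unfolding Z_def dots D_def r_def E_def V_def by simp
  \<comment> \<open>Contact turns <D, e> into -f - E V. The f f' from the reflected direction and
    the one from the drift cancel in the next rearrangement, leaving only multiples of E.\<close>
  ultimately have "(fL L r * f') - 2 * real DIM('a) * E + f' * (- fL L r - E * V)
      + 2 * E * (x \<bullet> p \<tau> x + y \<bullet> p \<tau> y) + rate * E * V \<le> 0"
    using time first second unfolding De by linarith
  then have ineq: "E * (rate * V - 2 * real DIM('a) - f' * V + 2 * (x \<bullet> p \<tau> x + y \<bullet> p \<tau> y)) \<le> 0"
    by (simp add: algebra_simps)
  \<comment> \<open>From t <= 1/2 + t^2 / 2 with t = |z|; summed over both points and doubled this
    gives the share 4 C0 V in \<open>rate\<close>.\<close>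
  have grow: "- (z \<bullet> p \<tau> z) \<le> C0 * (1/2 + 3/2 * (z \<bullet> z))" for z
  proof -
    have "- (z \<bullet> p \<tau> z) \<le> norm z * norm (p \<tau> z)" using Cauchy_Schwarz_ineq2[of z "p \<tau> z"] by linarith
    also have "\<dots> \<le> norm z * (C0 * (1 + norm z))" using \<tau> by (intro mult_left_mono growth) auto
    also have "\<dots> = C0 * (norm z + (norm z)\<^sup>2)" by (simp add: power2_eq_square algebra_simps)
    also have "\<dots> \<le> C0 * (1/2 + 3/2 * (norm z)\<^sup>2)"
    proof (intro mult_left_mono C0_nonneg)
      have "0 \<le> (norm z - 1)\<^sup>2" by simp
      then show "norm z + (norm z)\<^sup>2 \<le> 1/2 + 3/2 * (norm z)\<^sup>2"
        by (simp add: power2_eq_square algebra_simps)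
    qed
    finally show ?thesis by (simp add: power2_norm_eq_inner)
  qed
  have rV: "rate * V = 2 * real DIM('a) * V + L * V + 2 * (C0 * (2 * V)) + V"
    unfolding rate_def by (simp add: algebra_simps)
  have "- (x \<bullet> p \<tau> x + y \<bullet> p \<tau> y) \<le> C0 * (2 * V)"
  proof -
    have "- (x \<bullet> p \<tau> x + y \<bullet> p \<tau> y) \<le> C0 * (1/2 + 3/2 * (x \<bullet> x)) + C0 * (1/2 + 3/2 * (y \<bullet> y))"
      using grow[of x] grow[of y] by linarith
    also have "\<dots> = C0 * (1 + 3/2 * (x \<bullet> x) + 3/2 * (y \<bullet> y))" by (simp add: algebra_simps)
    also have "\<dots> \<le> C0 * (2 * V)"
    proof (intro mult_left_mono C0_nonneg)
      show "1 + 3/2 * (x \<bullet> x) + 3/2 * (y \<bullet> y) \<le> 2 * V"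
        unfolding V_def using inner_ge_zero[of x] inner_ge_zero[of y] by (simp add: field_simps del: inner_ge_zero)
    qed
    finally show ?thesis .
  qed
  moreover have "2 * real DIM('a) * 1 \<le> 2 * real DIM('a) * V" using V1 by (intro mult_left_mono) auto
  moreover have "f' * V \<le> L * V" using f'L V1 by (intro mult_right_mono) auto
  ultimately have "rate * V - 2 * real DIM('a) - f' * V + 2 * (x \<bullet> p \<tau> x + y \<bullet> p \<tau> y) \<ge> V"
    using rV by (smt (verit, best))
  then have "E * (rate * V - 2 * real DIM('a) - f' * V + 2 * (x \<bullet> p \<tau> x + y \<bullet> p \<tau> y)) > 0"
    using E V1 by (intro mult_pos_pos) auto
  then show False using ineq by linarith
qed

text \<open>The times and pairs off the diagonal with Z <= 0 form a compact set; a point of it with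
  the least time would be a first contact, which the initial condition prevents at time 0 and
  \<open>Z_no_first_zero\<close> afterwards.\<close>

lemma Z_pos:
  assumes eps: "\<epsilon> > 0" and "\<tau> \<in> {0..T}" "x \<noteq> y"
  shows "0 < Z \<epsilon> \<tau> x y"
proof (rule ccontr)
  assume neg: "\<not> ?thesis"
  define R where "R = sqrt (2 * (2 * C0 + C0\<^sup>2 / \<epsilon>) / \<epsilon>)"
  obtain C where C: "C \<ge> 0" "\<forall>\<tau>\<in>{0..T}. \<forall>x\<in>cball 0 R. \<forall>y\<in>cball 0 R.
        norm (p \<tau> x - p \<tau> y) \<le> C * norm (x - y)"
    using lip[of R] by blast
  \<comment> \<open>Z <= 0 implies \<epsilon> <= |p(x) - p(y)| <= C |x - y|; the + 1 covers C =
    0.\<close>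
  define \<delta> where "\<delta> = \<epsilon> / (C + 1)"
  have \<delta>: "\<delta> > 0" using eps C(1) by (simp add: \<delta>_def)
  define K where "K = {0..T} \<times> cball (0::'a) R \<times> cball (0::'a) R \<inter> {k. \<delta> \<le> norm (fst (snd k) - snd (snd k))}"
  have inK: "(t, u, v) \<in> K" if "t \<in> {0..T}" "u \<noteq> v" "Z \<epsilon> t u v \<le> 0" for t u v
  proof -
    have b: "(norm u)\<^sup>2 + (norm v)\<^sup>2 \<le> 2 * (2 * C0 + C0\<^sup>2 / \<epsilon>) / \<epsilon>" "\<epsilon> \<le> norm (p t u - p t v)"
      using Z_nonpos_bounded[OF eps that] by auto
    have uR: "norm u \<le> R" unfolding R_def using b(1) zero_le_power2[of "norm v"]
      by (intro real_le_rsqrt) linarith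
    have vR: "norm v \<le> R" unfolding R_def using b(1) zero_le_power2[of "norm u"]
      by (intro real_le_rsqrt) linarith
    have "norm (p t u - p t v) \<le> C * norm (u - v)" using C(2) that(1) uR vR by simp
    then have "\<epsilon> \<le> (C + 1) * norm (u - v)" using b(2) norm_ge_zero[of "u - v"]
      by (simp add: algebra_simps del: norm_ge_zero)
    then have "\<delta> \<le> norm (u - v)" unfolding \<delta>_def using C(1) by (simp add: pos_divide_le_eq mult.commute)
    then show ?thesis unfolding K_def using that uR vR by simp
  qed
  have neK: "u \<noteq> v" if "(t, u, v) \<in> K" for t u v using that \<delta> by (auto simp: K_def)
  have "compact K" unfolding K_def
    by (intro compact_Int_closed compact_Times compact_cball compact_Icc closed_Collect_le continuous_intros)
  have contZ: "continuous_on K (\<lambda>k. Z \<epsilon> (fst k) (fst (snd k)) (snd (snd k)))"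
    by (rule Z_continuous_on) (use neK in \<open>auto simp: K_def\<close>)
  define A where "A = {k \<in> K. Z \<epsilon> (fst k) (fst (snd k)) (snd (snd k)) \<le> 0}"
  have "closedin (top_of_set K) A"
    using continuous_closedin_preimage[OF contZ closed_atMost[of 0]]
    unfolding A_def vimage_def Int_def by simp
  then have "compact A" using \<open>compact K\<close> closedin_compact by blast
  moreover have "(\<tau>, x, y) \<in> A" using inK[OF assms(2,3)] neg by (simp add: A_def)
  ultimately obtain k where k: "k \<in> A" "\<And>k'. k' \<in> A \<Longrightarrow> fst k \<le> fst k'"
    using continuous_attains_inf[of A fst] continuous_on_fst[OF continuous_on_id] by blast
  obtain t u v where tuv: "k = (t, u, v)" by (cases k) auto
  have t: "t \<in> {0..T}" and uv: "u \<noteq> v" and Zle: "Z \<epsilon> t u v \<le> 0"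
    using k(1) neK unfolding A_def K_def tuv by (auto simp: K_def)
  have before: "0 < Z \<epsilon> s a b" if "0 \<le> s" "s < t" "a \<noteq> b" for s a b
  proof (rule ccontr)
    assume "\<not> ?thesis"
    then have "(s, a, b) \<in> A" using inK[of s a b] that t by (simp add: A_def)
    then show False using k(2)[of "(s, a, b)"] that(2) by (simp add: tuv)
  qed
  have "t \<noteq> 0"
  proof
    assume "t = 0"
    have "- (norm (u - v) * fL L (norm (u - v))) \<le> (p 0 u - p 0 v) \<bullet> (u - v)"
      using init unfolding fL_monotone_def by blast
    then have "((p 0 u - p 0 v) \<bullet> (u - v)) / norm (u - v) + fL L (norm (u - v)) \<ge> 0"
      using uv by (simp add: field_simps)
    moreover have "\<epsilon> * exp (rate * 0) * (1 + u \<bullet> u + v \<bullet> v) > 0"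
      using eps by (auto intro!: mult_pos_pos add_pos_nonneg)
    ultimately have "Z \<epsilon> 0 u v > 0" unfolding Z_def by linarith
    then show False using Zle \<open>t = 0\<close> by simp
  qed
  then have t0: "0 < t" "t \<le> T" using t by auto
  \<comment> \<open>Off the diagonal all values before t are positive, so letting s increase to t
    gives Z >= 0 at time t; with Z <= 0 at (u, v) this is a zero and a spatial minimum.\<close>
  have atmin: "0 \<le> Z \<epsilon> t a b" if "a \<noteq> b" for a b
  proof (rule tendsto_lowerbound)
    show "((\<lambda>s. Z \<epsilon> s a b) \<longlongrightarrow> Z \<epsilon> t a b) (at_left t)"
      using DERIV_isCont[OF Z_time_derivative[OF t0]] by (simp add: isCont_def filterlim_at_split)
    show "\<forall>\<^sub>F s in at_left t. 0 \<le> Z \<epsilon> s a b"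
      unfolding eventually_at_left_field using before that t0 by (intro exI[of _ 0]) (auto intro: less_imp_le)
  qed simp
  show False
    by (rule Z_no_first_zero[OF eps t0 uv]) (use Zle atmin[OF uv] atmin before[OF _ _ uv] in auto)
qed

theorem fL_monotone_final: "fL_monotone L (p T)"
  unfolding fL_monotone_def
proof (intro allI)
  fix x y :: 'a
  show "- (norm (x - y) * fL L (norm (x - y))) \<le> (p T x - p T y) \<bullet> (x - y)"
  proof (cases "x = y")
    case False
    define W where "W = ((p T x - p T y) \<bullet> (x - y)) / norm (x - y) + fL L (norm (x - y))"
    define V where "V = exp (rate * T) * (1 + x \<bullet> x + y \<bullet> y)"
    have "W \<ge> 0"
    proof (rule field_le_epsilon)
      fix \<eta> :: real assume "0 < \<eta>"
      have V: "V > 0" unfolding V_def by (auto intro!: mult_pos_pos add_pos_nonneg)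
      \<comment> \<open>With \<epsilon> = \<eta> / V the penalty at time T equals \<eta>.\<close>
      then have "0 < Z (\<eta> / V) T x y" using \<open>0 < \<eta>\<close> T False by (intro Z_pos) auto
      then show "0 \<le> W + \<eta>" unfolding Z_def W_def using V
        by (simp add: V_def mult.assoc split: if_splits)
    qed
    then show ?thesis unfolding W_def using False by (simp add: field_simps)
  qed simp
qed

end

section \<open>Potentials with Lipschitz gradient\<close>

locale lipschitz_potential =
  fixes L K :: real and g :: "'a::euclidean_space \<Rightarrow> real" and G :: "'a \<Rightarrow> 'a"
  assumes L: "L > 0" and K: "K \<ge> 0"
    and g: "\<And>x. (g has_derivative (\<lambda>h. G x \<bullet> h)) (at x)"
    and G_lip: "\<And>x y. norm (G x - G y) \<le> K * norm (x - y)"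
    and mono: "fL_monotone L G"
begin

definition dens :: "'a \<Rightarrow> real" where "dens y = exp (- g y)"

abbreviation vdens :: "'a \<Rightarrow> 'a" where "vdens \<equiv> \<lambda>y. dens y *\<^sub>R G y"

lemma dens_pos: "dens y > 0"
  by (simp add: dens_def)

lemma dens_has_derivative: "(dens has_derivative (\<lambda>h. - (dens y * (G y \<bullet> h)))) (at y)"
  unfolding dens_def using g[of y] by (auto intro!: derivative_eq_intros)

lemma exp_growth_dens: "exp_growth dens"
  unfolding dens_def[abs_def] by (rule exp_growth_exp_neg[OF L mono g])

lemma G_growth: "norm (G x) \<le> norm (G 0) + K * norm x"
  using G_lip[of x 0] norm_triangle_sub[of "G x" "G 0"] by simp

lemma continuous_on_G: "continuous_on UNIV G"
proof -
  have "K-lipschitz_on UNIV G" by (rule lipschitz_onI) (use K G_lip in \<open>auto simp: dist_norm\<close>)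
  then show ?thesis by (rule lipschitz_on_continuous_on)
qed

lemma exp_growth_G: "exp_growth G"
proof (rule exp_growthI[where A = "norm (G 0) + K" and B = 1])
  show "G \<in> borel_measurable borel" by (rule borel_measurable_continuous_onI[OF continuous_on_G])
  fix y :: 'a
  have "norm y \<le> exp (norm y)" using exp_ge_add_one_self[of "norm y"] by linarith
  then have "norm (G 0) * 1 + K * norm y \<le> norm (G 0) * exp (norm y) + K * exp (norm y)"
    using K by (intro add_mono mult_left_mono) auto
  then show "norm (G y) \<le> (norm (G 0) + K) * exp (1 * norm y)"
    using G_growth[of y] by (simp add: algebra_simps)
qed

lemma exp_growth_vdens: "exp_growth vdens"
  by (intro exp_growth_scaleR exp_growth_dens exp_growth_G)

lemmas growth_intros = exp_growth_intros exp_growth_dens exp_growth_G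

section \<open>The gradient of the solution as a Gibbs average, and its derivatives\<close>

definition D :: "real \<Rightarrow> 'a \<Rightarrow> real" where "D \<tau> x = HI \<tau> dens x"

definition N :: "real \<Rightarrow> 'a \<Rightarrow> 'a" where "N \<tau> x = HI \<tau> vdens x"

definition D1 :: "real \<Rightarrow> 'a \<Rightarrow> 'a \<Rightarrow> real" where
  "D1 \<tau> x a = HI \<tau> (\<lambda>y. (((y - x) \<bullet> a) / \<tau>) *\<^sub>R dens y) x"

definition N1 :: "real \<Rightarrow> 'a \<Rightarrow> 'a \<Rightarrow> 'a" where
  "N1 \<tau> x a = HI \<tau> (\<lambda>y. (((y - x) \<bullet> a) / \<tau>) *\<^sub>R vdens y) x"

definition D2 :: "real \<Rightarrow> 'a \<Rightarrow> 'a \<Rightarrow> real" where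
  "D2 \<tau> x a = HI \<tau> (\<lambda>y. (((y - x) \<bullet> a) * ((y - x) \<bullet> a) / \<tau>\<^sup>2 - (a \<bullet> a) / \<tau>) *\<^sub>R dens y) x"

definition N2 :: "real \<Rightarrow> 'a \<Rightarrow> 'a \<Rightarrow> 'a" where
  "N2 \<tau> x a = HI \<tau> (\<lambda>y. (((y - x) \<bullet> a) * ((y - x) \<bullet> a) / \<tau>\<^sup>2 - (a \<bullet> a) / \<tau>) *\<^sub>R vdens y) x"

definition Dt :: "real \<Rightarrow> 'a \<Rightarrow> real" where
  "Dt \<tau> x = HI \<tau> (\<lambda>y. ((norm (y - x))\<^sup>2 / (2 * \<tau>\<^sup>2)) *\<^sub>R dens y) x"

definition Nt :: "real \<Rightarrow> 'a \<Rightarrow> 'a" where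
  "Nt \<tau> x = HI \<tau> (\<lambda>y. ((norm (y - x))\<^sup>2 / (2 * \<tau>\<^sup>2)) *\<^sub>R vdens y) x"

text \<open>For positive time this is the mean of \<open>G\<close> under the density proportional to
  \<open>hk \<tau> x y * dens y\<close>; by \<open>D1_eq\<close> it is also the gradient of -ln D.
  Nonpositive times get the initial value \<open>G\<close>, which \<open>p_near_G\<close> shows to
  be the limit.\<close>

definition p :: "real \<Rightarrow> 'a \<Rightarrow> 'a" where
  "p \<tau> x = (if \<tau> \<le> 0 then G x else N \<tau> x /\<^sub>R D \<tau> x)"

definition P1 :: "real \<Rightarrow> 'a \<Rightarrow> 'a \<Rightarrow> 'a" where
  "P1 \<tau> x a = (N1 \<tau> x a - D1 \<tau> x a *\<^sub>R p \<tau> x) /\<^sub>R D \<tau> x"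

text \<open>Solved from D P2 + 2 D1 P1 + D2 p = N2, the second derivative of D p = N along a
  line.\<close>

definition P2 :: "real \<Rightarrow> 'a \<Rightarrow> 'a \<Rightarrow> 'a" where
  "P2 \<tau> x a = (N2 \<tau> x a - D2 \<tau> x a *\<^sub>R p \<tau> x - (2 * D1 \<tau> x a) *\<^sub>R P1 \<tau> x a) /\<^sub>R D \<tau> x"

definition Pt :: "real \<Rightarrow> 'a \<Rightarrow> 'a" where
  "Pt \<tau> x = (Nt \<tau> x - Dt \<tau> x *\<^sub>R p \<tau> x) /\<^sub>R D \<tau> x"

lemma D_pos: "0 < \<tau> \<Longrightarrow> 0 < D \<tau> x"
  unfolding D_def by (intro HI_pos exp_growth_dens dens_pos)

lemma N_eq: "0 < \<tau> \<Longrightarrow> N \<tau> x = D \<tau> x *\<^sub>R p \<tau> x"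
  using D_pos[of \<tau> x] by (simp add: p_def)

lemma D_has_derivative: "0 < \<tau> \<Longrightarrow> (D \<tau> has_derivative D1 \<tau> x) (at x)"
  unfolding D_def D1_def by (rule HI_has_derivative[OF _ exp_growth_dens])

lemma N_has_derivative: "0 < \<tau> \<Longrightarrow> (N \<tau> has_derivative N1 \<tau> x) (at x)"
  unfolding N_def N1_def by (rule HI_has_derivative[OF _ exp_growth_vdens])

lemma D1_has_derivative:
  "0 < \<tau> \<Longrightarrow> ((\<lambda>s. D1 \<tau> (x + s *\<^sub>R a) a) has_vector_derivative D2 \<tau> x a) (at 0)"
  unfolding D1_def D2_def has_vector_derivative_def
  by (rule has_derivative_compose[OF _ HI_weighted_has_derivative[OF _ exp_growth_dens],
        of "\<lambda>s. x + s *\<^sub>R a" "\<lambda>s. s *\<^sub>R a" 0, THEN has_derivative_eq_rhs])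
     (auto intro!: derivative_eq_intros simp: fun_eq_iff simp flip: HI_scaleR HI_cmult
       intro!: arg_cong[where f = "\<lambda>\<Phi>. HI \<tau> \<Phi> x"] simp: algebra_simps diff_divide_distrib add_divide_distrib)

lemma N1_has_derivative:
  "0 < \<tau> \<Longrightarrow> ((\<lambda>s. N1 \<tau> (x + s *\<^sub>R a) a) has_vector_derivative N2 \<tau> x a) (at 0)"
  unfolding N1_def N2_def has_vector_derivative_def
  by (rule has_derivative_compose[OF _ HI_weighted_has_derivative[OF _ exp_growth_vdens],
        of "\<lambda>s. x + s *\<^sub>R a" "\<lambda>s. s *\<^sub>R a" 0, THEN has_derivative_eq_rhs])
     (auto intro!: derivative_eq_intros growth_intros simp: fun_eq_iff simp flip: HI_scaleR
       intro!: arg_cong[where f = "\<lambda>\<Phi>. HI \<tau> \<Phi> x"] simp: algebra_simps diff_divide_distrib add_divide_distrib)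

lemma D_has_time_derivative: "0 < \<tau> \<Longrightarrow> ((\<lambda>\<tau>. D \<tau> x) has_vector_derivative Dt \<tau> x) (at \<tau>)"
  unfolding D_def Dt_def by (rule HI_has_time_derivative[OF _ exp_growth_dens])

lemma N_has_time_derivative: "0 < \<tau> \<Longrightarrow> ((\<lambda>\<tau>. N \<tau> x) has_vector_derivative Nt \<tau> x) (at \<tau>)"
  unfolding N_def Nt_def by (rule HI_has_time_derivative[OF _ exp_growth_vdens])

lemma p_has_derivative:
  assumes "0 < \<tau>" shows "(p \<tau> has_derivative P1 \<tau> x) (at x)"
proof -
  have "((\<lambda>x. N \<tau> x /\<^sub>R D \<tau> x) has_derivative
      (\<lambda>h. (N1 \<tau> x h - D1 \<tau> x h *\<^sub>R (N \<tau> x /\<^sub>R D \<tau> x)) /\<^sub>R D \<tau> x)) (at x)"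
    using D_pos[OF assms, of x]
    by (intro has_derivative_quotient N_has_derivative D_has_derivative assms) auto
  moreover have "p \<tau> = (\<lambda>x. N \<tau> x /\<^sub>R D \<tau> x)" using assms by (simp add: p_def fun_eq_iff)
  ultimately show ?thesis by (simp add: P1_def[abs_def])
qed

lemma P1_linear: "0 < \<tau> \<Longrightarrow> linear (P1 \<tau> x)"
  using p_has_derivative has_derivative_linear by blast

lemma P1_has_derivative:
  assumes "0 < \<tau>"
  shows "((\<lambda>s. P1 \<tau> (x + s *\<^sub>R a) a) has_vector_derivative P2 \<tau> x a) (at 0)"
proof -
  have line: "((\<lambda>s. f (x + s *\<^sub>R a)) has_vector_derivative f' a) (at 0)"
    if "(f has_derivative f') (at x)" for f f' and x :: 'a
  proof -
    have "((\<lambda>s. f (x + s *\<^sub>R a)) has_derivative (\<lambda>h. f' (h *\<^sub>R a))) (at 0)"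
      by (rule has_derivative_compose[of "\<lambda>s. x + s *\<^sub>R a"])
         (use that in \<open>auto intro!: derivative_eq_intros\<close>)
    moreover have "linear f'" using that by (rule has_derivative_linear)
    ultimately show ?thesis unfolding has_vector_derivative_def by (simp add: linear_cmul)
  qed
  have num: "((\<lambda>s. N1 \<tau> (x + s *\<^sub>R a) a - D1 \<tau> (x + s *\<^sub>R a) a *\<^sub>R p \<tau> (x + s *\<^sub>R a))
     has_vector_derivative N2 \<tau> x a - (D1 \<tau> x a *\<^sub>R P1 \<tau> x a + D2 \<tau> x a *\<^sub>R p \<tau> x)) (at 0)"
    using has_vector_derivative_diff[OF N1_has_derivative[OF assms, of x a]
        bounded_bilinear.has_vector_derivative[OF bounded_bilinear_scaleR D1_has_derivative[OF assms, of x a]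
           line[OF p_has_derivative[OF assms, of x]]]]
    by simp
  have den: "((\<lambda>s. D \<tau> (x + s *\<^sub>R a)) has_vector_derivative D1 \<tau> x a) (at 0)"
    by (rule line[OF D_has_derivative[OF assms]])
  have "((\<lambda>s. P1 \<tau> (x + s *\<^sub>R a) a) has_derivative
     (\<lambda>h. (h *\<^sub>R (N2 \<tau> x a - (D1 \<tau> x a *\<^sub>R P1 \<tau> x a + D2 \<tau> x a *\<^sub>R p \<tau> x))
        - (h *\<^sub>R D1 \<tau> x a) *\<^sub>R P1 \<tau> x a) /\<^sub>R D \<tau> x)) (at 0)"
    using has_derivative_quotient[OF num[unfolded has_vector_derivative_def] den[unfolded has_vector_derivative_def]]
      D_pos[OF assms, of x]
    by (simp add: P1_def)
  moreover have "(2 * D1 \<tau> x a) *\<^sub>R P1 \<tau> x a = D1 \<tau> x a *\<^sub>R P1 \<tau> x a + D1 \<tau> x a *\<^sub>R P1 \<tau> x a"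
    by (simp add: scaleR_left_distrib[symmetric])
  ultimately show ?thesis unfolding has_vector_derivative_def P2_def
    by - (erule has_derivative_eq_rhs, simp add: fun_eq_iff algebra_simps)
qed

lemma p_has_time_derivative:
  assumes "0 < \<tau>"
  shows "((\<lambda>\<tau>. p \<tau> x) has_vector_derivative Pt \<tau> x) (at \<tau>)"
proof -
  have "((\<lambda>\<tau>. N \<tau> x /\<^sub>R D \<tau> x) has_derivative
      (\<lambda>h. (h *\<^sub>R Nt \<tau> x - (h *\<^sub>R Dt \<tau> x) *\<^sub>R (N \<tau> x /\<^sub>R D \<tau> x)) /\<^sub>R D \<tau> x)) (at \<tau>)"
    using D_pos[OF assms, of x] N_has_time_derivative[OF assms] D_has_time_derivative[OF assms]
    unfolding has_vector_derivative_def
    by (intro has_derivative_quotient) auto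
  then have "((\<lambda>\<tau>. N \<tau> x /\<^sub>R D \<tau> x) has_vector_derivative Pt \<tau> x) (at \<tau>)"
    unfolding has_vector_derivative_def
    by (rule has_derivative_eq_rhs) (use assms in \<open>simp add: fun_eq_iff Pt_def p_def algebra_simps\<close>)
  then show ?thesis
    by (rule has_vector_derivative_transform_within_open[where S = "{0<..}"])
       (use assms in \<open>auto simp: p_def\<close>)
qed

lemma P2_even: "P2 \<tau> x (- a) = P2 \<tau> x a"
proof -
  have "N2 \<tau> x (- a) = N2 \<tau> x a" "D2 \<tau> x (- a) = D2 \<tau> x a" by (simp_all add: N2_def D2_def)
  moreover have d: "D1 \<tau> x (- a) = - D1 \<tau> x a" "N1 \<tau> x (- a) = - N1 \<tau> x a"
    by (simp_all add: D1_def N1_def flip: HI_uminus)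
  moreover have "P1 \<tau> x (- a) = - P1 \<tau> x a" by (simp add: P1_def d algebra_simps)
  ultimately show ?thesis by (simp add: P2_def)
qed

text \<open>Integration by parts moves the derivative from the Gaussian to exp(-g), so the
  logarithmic derivative of D is -p. This identity closes the equation for p: it converts the mixed
  term of the quotient rule into the transport term.\<close>

lemma D1_eq:
  assumes "0 < \<tau>" shows "D1 \<tau> x a = - (D \<tau> x * (p \<tau> x \<bullet> a))"
proof -
  have "HI \<tau> (\<lambda>y. - (dens y * (G y \<bullet> a))) x = HI \<tau> (\<lambda>y. ((y - x) \<bullet> a) / \<tau> * dens y) x"
    by (rule HI_by_parts[OF assms exp_growth_dens _ dens_has_derivative])
       (intro growth_intros)
  also have "HI \<tau> (\<lambda>y. - (dens y * (G y \<bullet> a))) x = - (N \<tau> x \<bullet> a)"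
    unfolding N_def HI_uminus
    by (subst HI_inner[symmetric]) (auto intro!: growth_intros assms)
  finally show ?thesis using N_eq[OF assms, of x] by (simp add: D1_def)
qed

text \<open>Cole-Hopf in quotient form: N and D solve the same linear equation, so the zeroth-order
  terms with factor c cancel because N = D p, and the mixed terms 2 D1 P1, summed over the basis,
  give -2 D P1[p].\<close>

lemma p_equation:
  fixes S :: "'a set"
  assumes \<tau>: "0 < \<tau>" and S: "finite S" "pairwise orthogonal S" "\<And>b. b \<in> S \<Longrightarrow> norm b = 1"
    "card S = DIM('a)" "span S = UNIV"
  shows "Pt \<tau> x = (1/2) *\<^sub>R (\<Sum>b\<in>S. P2 \<tau> x b) - P1 \<tau> x (p \<tau> x)"
proof -
  have Dn: "D \<tau> x \<noteq> 0" using D_pos[OF \<tau>, of x] by simp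
  define c where "c = real DIM('a) / \<tau>"
  have N2: "(\<Sum>b\<in>S. N2 \<tau> x b) = 2 *\<^sub>R Nt \<tau> x - c *\<^sub>R N \<tau> x"
    unfolding N2_def Nt_def N_def c_def by (rule HI_heat_equation[OF \<tau> S exp_growth_vdens])
  have D2: "(\<Sum>b\<in>S. D2 \<tau> x b) = 2 * Dt \<tau> x - c * D \<tau> x"
    using HI_heat_equation[OF \<tau> S exp_growth_dens, of x] unfolding D2_def Dt_def D_def c_def by simp
  have cross: "(\<Sum>b\<in>S. D1 \<tau> x b *\<^sub>R P1 \<tau> x b) = - (D \<tau> x *\<^sub>R P1 \<tau> x (p \<tau> x))"
  proof -
    have "(\<Sum>b\<in>S. D1 \<tau> x b *\<^sub>R P1 \<tau> x b) = (\<Sum>b\<in>S. - (D \<tau> x *\<^sub>R P1 \<tau> x ((p \<tau> x \<bullet> b) *\<^sub>R b)))"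
      by (simp add: D1_eq[OF \<tau>] linear_cmul[OF P1_linear[OF \<tau>]])
    also have "\<dots> = - (D \<tau> x *\<^sub>R P1 \<tau> x (\<Sum>b\<in>S. (p \<tau> x \<bullet> b) *\<^sub>R b))"
      by (simp add: sum_negf scaleR_sum_right[symmetric] linear_sum[OF P1_linear[OF \<tau>]])
    also have "(\<Sum>b\<in>S. (p \<tau> x \<bullet> b) *\<^sub>R b) = p \<tau> x"
      by (rule orthonormal_weight_sum(2)[OF S(1,2,3,5)])
    finally show ?thesis .
  qed
  have "(\<Sum>b\<in>S. P2 \<tau> x b) = ((\<Sum>b\<in>S. N2 \<tau> x b) - (\<Sum>b\<in>S. D2 \<tau> x b) *\<^sub>R p \<tau> x
      - 2 *\<^sub>R (\<Sum>b\<in>S. D1 \<tau> x b *\<^sub>R P1 \<tau> x b)) /\<^sub>R D \<tau> x"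
    unfolding P2_def scaleR_sum_right[symmetric] sum_subtractf scaleR_sum_left
    by (simp add: scaleR_sum_right)
  also have "\<dots> = (2 *\<^sub>R (Nt \<tau> x - Dt \<tau> x *\<^sub>R p \<tau> x) + 2 *\<^sub>R (D \<tau> x *\<^sub>R P1 \<tau> x (p \<tau> x))) /\<^sub>R D \<tau> x"
    unfolding N2 D2 cross N_eq[OF \<tau>] by (simp add: algebra_simps)
  also have "\<dots> = 2 *\<^sub>R Pt \<tau> x + 2 *\<^sub>R P1 \<tau> x (p \<tau> x)"
    unfolding Pt_def using Dn by (simp add: scaleR_add_right mult.commute)
  finally show ?thesis by (simp add: scaleR_add_right)
qed

section \<open>Moment bounds uniform as \<tau> tends to 0\<close>

definition M :: "real \<Rightarrow> 'a \<Rightarrow> real" where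
  "M \<tau> x = 2 * real DIM('a) + \<tau> * (norm (G x) + 2 * sqrt L)\<^sup>2"

lemma M_pos: "0 \<le> \<tau> \<Longrightarrow> 0 < M \<tau> x"
  unfolding M_def by (intro add_pos_nonneg) auto

text \<open>Integration by parts against the field y - x expresses the second moment divided by
  \<tau> as the integral of d - <G(y), y - x>. The one-sided bound on G makes this at most d + c |y
  - x| with c = |G(x)| + 2 sqrt L, and Young's inequality lets half of the second moment be absorbed
  on the left; what remains is \<open>M\<close>.\<close>

lemma second_moment:
  assumes \<tau>: "0 < \<tau>"
  shows "HI \<tau> (\<lambda>y. (norm (y - x))\<^sup>2 * dens y) x \<le> \<tau> * M \<tau> x * D \<tau> x"
proof -
  let ?c = "norm (G x) + 2 * sqrt L"
  let ?m = "HI \<tau> (\<lambda>y. (norm (y - x))\<^sup>2 * dens y) x"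
  have ibp: "HI \<tau> (\<lambda>y. ((y - x) \<bullet> b) * (- (dens y * (G y \<bullet> b))) + (b \<bullet> b) * dens y) x
      = HI \<tau> (\<lambda>y. ((y - x) \<bullet> b) / \<tau> * (((y - x) \<bullet> b) * dens y)) x" for b
  proof (rule HI_by_parts[OF \<tau>, where a = b and \<Psi> = "\<lambda>y. ((y - x) \<bullet> b) * dens y"
        and \<Psi>' = "\<lambda>y h. ((y - x) \<bullet> b) * (- (dens y * (G y \<bullet> h))) + (h \<bullet> b) * dens y"])
    show "exp_growth (\<lambda>y. ((y - x) \<bullet> b) * dens y)" by (intro growth_intros)
    show "exp_growth (\<lambda>y. ((y - x) \<bullet> b) * (- (dens y * (G y \<bullet> b))) + (b \<bullet> b) * dens y)"
      by (intro growth_intros)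
    show "((\<lambda>y. ((y - x) \<bullet> b) * dens y) has_derivative
        (\<lambda>h. ((y - x) \<bullet> b) * (- (dens y * (G y \<bullet> h))) + (h \<bullet> b) * dens y)) (at y)" for y
      by (rule has_derivative_mult[OF _ dens_has_derivative]) (auto intro!: derivative_eq_intros)
  qed
  have "HI \<tau> (\<lambda>y. \<Sum>b\<in>Basis. ((y - x) \<bullet> b) * (- (dens y * (G y \<bullet> b))) + (b \<bullet> b) * dens y) x
      = HI \<tau> (\<lambda>y. \<Sum>b\<in>Basis. ((y - x) \<bullet> b) / \<tau> * (((y - x) \<bullet> b) * dens y)) x"
    by (subst (1 2) HI_sum[OF \<tau>]) (intro growth_intros | simp only: ibp)+
  moreover have "(\<Sum>b\<in>Basis. ((y - x) \<bullet> b) * (- (dens y * (G y \<bullet> b))) + (b \<bullet> b) * dens y)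
      = (real DIM('a) - G y \<bullet> (y - x)) * dens y" for y
  proof -
    have "G y \<bullet> (y - x) = (\<Sum>b\<in>Basis. (G y \<bullet> b) * ((y - x) \<bullet> b))" by (rule euclidean_inner)
    then have "(\<Sum>b\<in>Basis. ((y - x) \<bullet> b) * (- (dens y * (G y \<bullet> b)))) = - (G y \<bullet> (y - x)) * dens y"
      by (simp add: sum_distrib_left sum_negf mult_ac)
    moreover have "(\<Sum>b\<in>(Basis::'a set). (b \<bullet> b) * dens y) = real DIM('a) * dens y" by simp
    ultimately show ?thesis unfolding sum.distrib left_diff_distrib by linarith
  qed
  moreover have "(\<Sum>b\<in>Basis. ((y - x) \<bullet> b) / \<tau> * (((y - x) \<bullet> b) * dens y))
      = (1 / \<tau>) * ((norm (y - x))\<^sup>2 * dens y)" for y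
  proof -
    have "(norm (y - x))\<^sup>2 = (\<Sum>b\<in>Basis. ((y - x) \<bullet> b) * ((y - x) \<bullet> b))"
      unfolding power2_norm_eq_inner by (rule euclidean_inner)
    then show ?thesis by (simp only: sum_distrib_left sum_distrib_right) (intro sum.cong, auto)
  qed
  ultimately have id: "HI \<tau> (\<lambda>y. (real DIM('a) - G y \<bullet> (y - x)) * dens y) x = (1 / \<tau>) * ?m"
    by (simp only: HI_cmult)
  have "HI \<tau> (\<lambda>y. (real DIM('a) - G y \<bullet> (y - x)) * dens y) x
     \<le> HI \<tau> (\<lambda>y. (1 / (2 * \<tau>)) * ((norm (y - x))\<^sup>2 * dens y) + (M \<tau> x / 2) * dens y) x"
  proof (rule HI_mono[OF \<tau>])
    show "exp_growth (\<lambda>y. (real DIM('a) - G y \<bullet> (y - x)) * dens y)" by (intro growth_intros)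
    show "exp_growth (\<lambda>y. (1 / (2 * \<tau>)) * ((norm (y - x))\<^sup>2 * dens y) + (M \<tau> x / 2) * dens y)"
      by (intro growth_intros)
    fix y
    define \<rho> where "\<rho> = norm (y - x)"
    have "- (2 * sqrt L * \<rho>) \<le> (G y - G x) \<bullet> (y - x)"
      unfolding \<rho>_def by (rule fL_monotone_lower[OF L mono])
    moreover have "- (norm (G x) * \<rho>) \<le> G x \<bullet> (y - x)"
      unfolding \<rho>_def using Cauchy_Schwarz_ineq2[of "G x" "y - x"] by linarith
    ultimately have "- (G y \<bullet> (y - x)) \<le> ?c * \<rho>" by (simp add: inner_diff_left algebra_simps)
    also have "\<dots> \<le> \<rho>\<^sup>2 / (2 * \<tau>) + \<tau> * ?c\<^sup>2 / 2"
    proof -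
      have "0 \<le> (\<rho> - \<tau> * ?c)\<^sup>2 / (2 * \<tau>)" using \<tau> by simp
      also have "\<dots> = \<rho>\<^sup>2 / (2 * \<tau>) + \<tau> * ?c\<^sup>2 / 2 - ?c * \<rho>"
        unfolding power2_diff using \<tau> by (simp add: power2_eq_square field_simps)
      finally show ?thesis by simp
    qed
    finally have "real DIM('a) - G y \<bullet> (y - x) \<le> (1 / (2 * \<tau>)) * \<rho>\<^sup>2 + M \<tau> x / 2"
      unfolding M_def by (simp add: add_divide_distrib)
    then have "(real DIM('a) - G y \<bullet> (y - x)) * dens y \<le> ((1 / (2 * \<tau>)) * \<rho>\<^sup>2 + M \<tau> x / 2) * dens y"
      using dens_pos[of y] by (intro mult_right_mono) auto
    then show "(real DIM('a) - G y \<bullet> (y - x)) * dens y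
       \<le> (1 / (2 * \<tau>)) * ((norm (y - x))\<^sup>2 * dens y) + (M \<tau> x / 2) * dens y"
      unfolding \<rho>_def by (simp only: distrib_right mult.assoc)
  qed
  also have "\<dots> = (1 / (2 * \<tau>)) * ?m + (M \<tau> x / 2) * D \<tau> x"
    unfolding D_def by (subst HI_add[OF \<tau>]) (intro growth_intros | simp only: HI_cmult)+
  finally show ?thesis unfolding id using \<tau> by (simp add: field_simps)
qed

text \<open>Cauchy-Schwarz in the form t <= t^2 / (2 s) + s / 2 with s = sqrt(\<tau> M), which
  balances the two terms.\<close>

lemma first_moment:
  assumes \<tau>: "0 < \<tau>"
  shows "HI \<tau> (\<lambda>y. norm (y - x) * dens y) x \<le> sqrt (\<tau> * M \<tau> x) * D \<tau> x"
proof -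
  define s where "s = sqrt (\<tau> * M \<tau> x)"
  have s: "s > 0" "s * s = \<tau> * M \<tau> x" using \<tau> M_pos[of \<tau> x] by (auto simp: s_def)
  have "HI \<tau> (\<lambda>y. norm (y - x) * dens y) x
     \<le> HI \<tau> (\<lambda>y. (1 / (2 * s)) * ((norm (y - x))\<^sup>2 * dens y) + (s / 2) * dens y) x"
  proof (rule HI_mono[OF \<tau>])
    fix y
    have "0 \<le> (norm (y - x) - s)\<^sup>2 / (2 * s)" using s by simp
    also have "\<dots> = (1 / (2 * s)) * (norm (y - x))\<^sup>2 + s / 2 - norm (y - x)"
      unfolding power2_diff using s(1) by (simp add: power2_eq_square field_simps)
    finally have "norm (y - x) * dens y \<le> ((1 / (2 * s)) * (norm (y - x))\<^sup>2 + s / 2) * dens y"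
      using dens_pos[of y] by (intro mult_right_mono) auto
    then show "norm (y - x) * dens y \<le> (1 / (2 * s)) * ((norm (y - x))\<^sup>2 * dens y) + (s / 2) * dens y"
      by (simp only: distrib_right mult.assoc)
  qed (intro growth_intros)+
  also have "\<dots> = (1 / (2 * s)) * HI \<tau> (\<lambda>y. (norm (y - x))\<^sup>2 * dens y) x + (s / 2) * D \<tau> x"
    unfolding D_def by (subst HI_add[OF \<tau>]) (intro growth_intros | simp only: HI_cmult)+
  also have "\<dots> \<le> (1 / (2 * s)) * (s * s * D \<tau> x) + (s / 2) * D \<tau> x"
    using second_moment[OF \<tau>, of x] s by (intro add_right_mono mult_left_mono) auto
  also have "\<dots> = s * D \<tau> x" using s(1) by (simp add: field_simps)
  finally show ?thesis unfolding s_def .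
qed

text \<open>p - G(x) is the mean of G(y) - G(x), at most K times the first moment. The resulting
  order sqrt \<tau> gives continuity at time 0 and reduces the growth of p to that of G.\<close>

lemma p_near_G:
  assumes \<tau>: "0 < \<tau>"
  shows "norm (p \<tau> x - G x) \<le> K * sqrt (\<tau> * M \<tau> x)"
proof -
  have D0: "D \<tau> x > 0" by (rule D_pos[OF \<tau>])
  have "D \<tau> x *\<^sub>R (p \<tau> x - G x) = HI \<tau> (\<lambda>y. dens y *\<^sub>R (G y - G x)) x"
  proof -
    have "HI \<tau> (\<lambda>y. vdens y - dens y *\<^sub>R G x) x = N \<tau> x - D \<tau> x *\<^sub>R G x"
      unfolding N_def D_def
      by (subst HI_diff[OF \<tau>]) (intro growth_intros | simp only: HI_scaleR_const[OF \<tau> exp_growth_dens])+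
    then show ?thesis by (simp add: N_eq[OF \<tau>] scaleR_diff_right)
  qed
  then have "D \<tau> x * norm (p \<tau> x - G x) = norm (HI \<tau> (\<lambda>y. dens y *\<^sub>R (G y - G x)) x)"
    using D0 by (metis abs_of_pos norm_scaleR)
  also have "\<dots> \<le> HI \<tau> (\<lambda>y. K * (norm (y - x) * dens y)) x"
  proof (rule norm_HI_le[OF \<tau>])
    fix y
    have "dens y * norm (G y - G x) \<le> dens y * (K * norm (y - x))"
      using dens_pos[of y] by (intro mult_left_mono G_lip) auto
    then show "norm (dens y *\<^sub>R (G y - G x)) \<le> K * (norm (y - x) * dens y)"
      using dens_pos[of y] by (simp add: mult.commute mult.left_commute)
  qed (intro growth_intros)+
  also have "\<dots> \<le> K * (sqrt (\<tau> * M \<tau> x) * D \<tau> x)"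
    unfolding HI_cmult by (intro mult_left_mono first_moment[OF \<tau>] K)
  finally have "D \<tau> x * norm (p \<tau> x - G x) \<le> D \<tau> x * (K * sqrt (\<tau> * M \<tau> x))" by (simp only: mult_ac)
  then show ?thesis using D0 by simp
qed

text \<open>The differential of p is a covariance of (y - x) / \<tau> and G: the term D1 p in
  \<open>P1\<close> centres G at p, and G(y) - p = (G(y) - G(x)) + (G(x) - p) has two small parts.
  The moments contribute a factor \<tau> that cancels the singular 1 / \<tau>, so the bound survives
  as \<tau> tends to 0 although \<open>G\<close> need not be differentiable.\<close>

lemma P1_bound:
  assumes \<tau>: "0 < \<tau>"
  shows "norm (P1 \<tau> x a) \<le> 2 * K * M \<tau> x * norm a"
proof -
  have D0: "D \<tau> x > 0" by (rule D_pos[OF \<tau>])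
  define k where "k = norm (p \<tau> x - G x)"
  have k: "0 \<le> k" by (simp add: k_def)
  define s where "s = sqrt (\<tau> * M \<tau> x)"
  have s: "s > 0" "s * s = \<tau> * M \<tau> x" using \<tau> M_pos[of \<tau> x] by (auto simp: s_def)
  have "D \<tau> x *\<^sub>R P1 \<tau> x a = HI \<tau> (\<lambda>y. (((y - x) \<bullet> a) / \<tau>) *\<^sub>R (dens y *\<^sub>R (G y - p \<tau> x))) x"
  proof -
    have "HI \<tau> (\<lambda>y. (((y - x) \<bullet> a) / \<tau>) *\<^sub>R vdens y - ((((y - x) \<bullet> a) / \<tau>) *\<^sub>R dens y) *\<^sub>R p \<tau> x) x
       = N1 \<tau> x a - D1 \<tau> x a *\<^sub>R p \<tau> x"
      unfolding N1_def D1_def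
      by (subst HI_diff[OF \<tau>], (intro growth_intros)+, subst HI_scaleR_const[OF \<tau>], (intro growth_intros)+, rule refl)
    then show ?thesis using D0 by (simp add: P1_def scaleR_diff_right)
  qed
  then have "D \<tau> x * norm (P1 \<tau> x a) = norm (HI \<tau> (\<lambda>y. (((y - x) \<bullet> a) / \<tau>) *\<^sub>R (dens y *\<^sub>R (G y - p \<tau> x))) x)"
    using D0 by (metis abs_of_pos norm_scaleR)
  also have "\<dots> \<le> HI \<tau> (\<lambda>y. (norm a / \<tau>) * (K * ((norm (y - x))\<^sup>2 * dens y) + k * (norm (y - x) * dens y))) x"
  proof (rule norm_HI_le[OF \<tau>])
    fix y
    define \<rho> where "\<rho> = norm (y - x)"
    have "norm (G y - p \<tau> x) \<le> norm (G y - G x) + norm (G x - p \<tau> x)"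
      using norm_triangle_ineq[of "G y - G x" "G x - p \<tau> x"] by simp
    then have 1: "norm (G y - p \<tau> x) \<le> K * \<rho> + k"
      unfolding k_def \<rho>_def using G_lip[of y x] by (simp add: norm_minus_commute)
    have 2: "\<bar>(y - x) \<bullet> a\<bar> \<le> \<rho> * norm a" unfolding \<rho>_def by (rule Cauchy_Schwarz_ineq2)
    have "norm ((((y - x) \<bullet> a) / \<tau>) *\<^sub>R (dens y *\<^sub>R (G y - p \<tau> x)))
        = \<bar>(y - x) \<bullet> a\<bar> / \<tau> * (dens y * norm (G y - p \<tau> x))"
      using \<tau> dens_pos[of y] by (simp add: abs_mult)
    also have "\<dots> \<le> (\<rho> * norm a) / \<tau> * (dens y * (K * \<rho> + k))"
      using \<tau> dens_pos[of y] 1 2 by (intro mult_mono divide_right_mono) (auto simp: \<rho>_def)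
    also have "\<dots> = (norm a / \<tau>) * (K * (\<rho>\<^sup>2 * dens y) + k * (\<rho> * dens y))"
      by (simp add: power2_eq_square algebra_simps)
    finally show "norm ((((y - x) \<bullet> a) / \<tau>) *\<^sub>R (dens y *\<^sub>R (G y - p \<tau> x)))
       \<le> (norm a / \<tau>) * (K * ((norm (y - x))\<^sup>2 * dens y) + k * (norm (y - x) * dens y))"
      unfolding \<rho>_def .
  qed (intro growth_intros)+
  also have "\<dots> = (norm a / \<tau>) * (K * HI \<tau> (\<lambda>y. (norm (y - x))\<^sup>2 * dens y) x + k * HI \<tau> (\<lambda>y. norm (y - x) * dens y) x)"
    unfolding HI_cmult by (subst HI_add[OF \<tau>]) (intro growth_intros | simp only: HI_cmult)+
  also have "\<dots> \<le> (norm a / \<tau>) * (K * (s * s * D \<tau> x) + (K * s) * (s * D \<tau> x))"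
  proof (intro mult_left_mono add_mono mult_mono)
    show "HI \<tau> (\<lambda>y. (norm (y - x))\<^sup>2 * dens y) x \<le> s * s * D \<tau> x"
      unfolding s(2) by (rule second_moment[OF \<tau>])
    show "HI \<tau> (\<lambda>y. norm (y - x) * dens y) x \<le> s * D \<tau> x"
      unfolding s_def by (rule first_moment[OF \<tau>])
    show "k \<le> K * s" unfolding k_def s_def by (rule p_near_G[OF \<tau>])
    have "HI \<tau> (\<lambda>y. 0) x \<le> HI \<tau> (\<lambda>y. norm (y - x) * dens y) x"
      by (rule HI_mono[OF \<tau>]) (auto intro!: growth_intros mult_nonneg_nonneg less_imp_le[OF dens_pos])
    then show "0 \<le> HI \<tau> (\<lambda>y. norm (y - x) * dens y) x" by (simp add: HI_def)
  qed (use \<tau> K s in auto)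
  also have "\<dots> = (norm a / \<tau>) * (2 * K * (s * s) * D \<tau> x)" by (simp add: algebra_simps)
  also have "\<dots> = D \<tau> x * (2 * K * M \<tau> x * norm a)" unfolding s(2) using \<tau> by simp
  finally show ?thesis using D0 by simp
qed

lemma M_le:
  assumes "0 \<le> \<tau>" "\<tau> \<le> T" "norm x \<le> R"
  shows "M \<tau> x \<le> 2 * real DIM('a) + T * (norm (G 0) + K * R + 2 * sqrt L)\<^sup>2"
proof -
  have "norm (G x) \<le> norm (G 0) + K * R"
    using G_growth[of x] mult_left_mono[OF assms(3) K] by linarith
  then have "(norm (G x) + 2 * sqrt L)\<^sup>2 \<le> (norm (G 0) + K * R + 2 * sqrt L)\<^sup>2"
    using L by (intro power_mono) auto
  then show ?thesis unfolding M_def using assms by (intro add_left_mono mult_mono) auto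
qed

theorem fL_monotone_p:
  assumes T: "0 < T"
  shows "fL_monotone L (p T)"
proof -
  \<comment> \<open>With c = |G(x)| + 2 sqrt L, one has c <= (c1 + K) (1 + |x|) and sqrt M <= B (1 +
    c), the latter because B >= 1; inserting both into |p| <= c + K sqrt(T M) gives
    \<open>C0\<close>.\<close>
  define c1 where "c1 = norm (G 0) + 2 * sqrt L"
  define B where "B = 1 + 2 * real DIM('a) + T"
  define C0 where "C0 = (c1 + K) * (1 + K * sqrt T * B) + K * sqrt T * B"
  have c1: "c1 \<ge> 0" using L by (simp add: c1_def)
  have B: "B \<ge> 1" using T by (simp add: B_def)
  interpret reflection_comparison L T C0 p Pt P1 P2
  proof
    show "L > 0" "T > 0" by (fact L, fact T)
    show "fL_monotone L (p 0)" using mono by (simp add: p_def[abs_def])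
    show "continuous_on {0..T} (\<lambda>\<tau>. p \<tau> x)" for x
      unfolding continuous_on_def
    proof
      fix \<tau> assume \<tau>: "\<tau> \<in> {0..T}"
      show "((\<lambda>\<tau>. p \<tau> x) \<longlongrightarrow> p \<tau> x) (at \<tau> within {0..T})"
      proof (cases "\<tau> = 0")
        case False
        then have "isCont (\<lambda>\<tau>. p \<tau> x) \<tau>"
          using \<tau> has_vector_derivative_continuous[OF p_has_time_derivative] by auto
        then show ?thesis by (simp add: isCont_def tendsto_within_subset[OF _ subset_UNIV])
      next
        case True
        have "((\<lambda>t. p t x - G x) \<longlongrightarrow> 0) (at 0 within {0..T})"
        proof (rule Lim_null_comparison)
          show "\<forall>\<^sub>F t in at 0 within {0..T}. norm (p t x - G x) \<le> K * sqrt (t * M t x)"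
            unfolding eventually_at_filter using p_near_G by (auto intro!: always_eventually)
          have "((\<lambda>t. K * sqrt (t * M t x)) \<longlongrightarrow> K * sqrt (0 * M 0 x)) (at 0 within {0..T})"
            unfolding M_def by (intro tendsto_intros)
          then show "((\<lambda>t. K * sqrt (t * M t x)) \<longlongrightarrow> 0) (at 0 within {0..T})" by simp
        qed
        then have "((\<lambda>t. p t x) \<longlongrightarrow> G x) (at 0 within {0..T})"
          using LIM_zero_iff by blast
        then show ?thesis using True by (simp add: p_def)
      qed
    qed
    show "\<exists>C\<ge>0. \<forall>\<tau>\<in>{0..T}. \<forall>x\<in>cball 0 R. \<forall>y\<in>cball 0 R. norm (p \<tau> x - p \<tau> y) \<le> C * norm (x - y)" for R
    proof (intro exI conjI ballI)
      define MR where "MR = 2 * real DIM('a) + T * (norm (G 0) + K * R + 2 * sqrt L)\<^sup>2"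
      have MR: "MR \<ge> 0" using T by (simp add: MR_def)
      show "0 \<le> K + 2 * K * MR" using K MR by simp
      fix \<tau> and x y :: 'a assume a: "\<tau> \<in> {0..T}" "x \<in> cball 0 R" "y \<in> cball (0::'a) R"
      show "norm (p \<tau> x - p \<tau> y) \<le> (K + 2 * K * MR) * norm (x - y)"
      proof (cases "\<tau> = 0")
        case True
        have "K * norm (x - y) \<le> (K + 2 * K * MR) * norm (x - y)" using K MR by (intro mult_right_mono) auto
        then show ?thesis using True G_lip[of x y] by (simp add: p_def)
      next
        case False
        then have \<tau>: "0 < \<tau>" using a by simp
        have "norm (p \<tau> x - p \<tau> y) \<le> 2 * K * MR * norm (x - y)"
        proof (rule differentiable_bound[OF convex_cball _ _ a(2,3)])
          fix z :: 'a assume z: "z \<in> cball 0 R"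
          show "(p \<tau> has_derivative P1 \<tau> z) (at z within cball 0 R)"
            by (rule has_derivative_at_withinI[OF p_has_derivative[OF \<tau>]])
          have le: "M \<tau> z \<le> MR" unfolding MR_def using a z by (intro M_le) auto
          show "onorm (P1 \<tau> z) \<le> 2 * K * MR"
          proof (rule onorm_bound)
            fix h :: 'a
            have "2 * K * M \<tau> z * norm h \<le> 2 * K * MR * norm h"
              using le K by (intro mult_right_mono mult_left_mono) auto
            then show "norm (P1 \<tau> z h) \<le> 2 * K * MR * norm h"
              using P1_bound[OF \<tau>, of z h] by linarith
          qed (use K MR in simp)
        qed
        also have "\<dots> \<le> (K + 2 * K * MR) * norm (x - y)" using K by (intro mult_right_mono) auto
        finally show ?thesis .
      qed
    qed
    show "norm (p \<tau> x) \<le> C0 * (1 + norm x)" if "\<tau> \<in> {0..T}" for \<tau> x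
    proof -
      define c where "c = norm (G x) + 2 * sqrt L"
      have c: "0 \<le> c" using L by (simp add: c_def)
      have cx: "c \<le> (c1 + K) * (1 + norm x)"
      proof -
        have "c \<le> c1 * 1 + K * norm x" unfolding c_def c1_def using G_growth[of x] by simp
        also have "\<dots> \<le> c1 * (1 + norm x) + K * (1 + norm x)"
          using K c1 by (intro add_mono mult_left_mono) auto
        finally show ?thesis by (simp only: distrib_right)
      qed
      have KB: "0 \<le> K * sqrt T * B" using K T B by simp
      have "norm (p \<tau> x) \<le> c + K * sqrt T * (B * (1 + c))"
      proof (cases "\<tau> = 0")
        case True
        have "0 \<le> K * sqrt T * (B * (1 + c))" using K T B c by simp
        moreover have "norm (G x) \<le> c" unfolding c_def using L by simp
        ultimately show ?thesis using True by (simp add: p_def)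
      next
        case False
        then have \<tau>: "0 < \<tau>" "\<tau> \<le> T" using that by auto
        have "M \<tau> x \<le> (B * (1 + c))\<^sup>2"
        proof -
          have "M \<tau> x \<le> 2 * real DIM('a) * 1 + T * c\<^sup>2"
            unfolding M_def c_def using \<tau> by (intro add_mono mult_right_mono) auto
          also have "\<dots> \<le> B * (1 + c)\<^sup>2 * 1"
          proof -
            have "2 * real DIM('a) * 1 \<le> 2 * real DIM('a) * (1 + c)\<^sup>2"
              using c by (intro mult_left_mono one_le_square_one_plus) auto
            moreover have "T * c\<^sup>2 \<le> T * (1 + c)\<^sup>2"
              using c T by (intro mult_left_mono square_le_square_one_plus) auto
            moreover have "0 \<le> (1 + c)\<^sup>2" by simp
            ultimately show ?thesis unfolding B_def distrib_right by linarith
          qed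
          also have "\<dots> \<le> B * (1 + c)\<^sup>2 * B" using B by (intro mult_left_mono) auto
          also have "\<dots> = (B * (1 + c))\<^sup>2" by (simp add: power2_eq_square)
          finally show ?thesis .
        qed
        then have "sqrt (M \<tau> x) \<le> B * (1 + c)" using B c by (intro real_le_lsqrt) auto
        then have "sqrt (\<tau> * M \<tau> x) \<le> sqrt T * (B * (1 + c))"
          unfolding real_sqrt_mult using \<tau> M_pos[of \<tau> x] by (intro mult_mono) auto
        then have "K * sqrt (\<tau> * M \<tau> x) \<le> K * (sqrt T * (B * (1 + c)))" using K by (intro mult_left_mono)
        moreover have "norm (G x) \<le> c" unfolding c_def using L by simp
        moreover have "norm (p \<tau> x) \<le> norm (G x) + norm (p \<tau> x - G x)" by (rule norm_triangle_sub)
        ultimately show ?thesis using p_near_G[OF \<tau>(1), of x] by (simp only: mult.assoc)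
      qed
      also have "\<dots> = c * (1 + K * sqrt T * B) + K * sqrt T * B" by (simp add: algebra_simps)
      also have "\<dots> \<le> ((c1 + K) * (1 + norm x)) * (1 + K * sqrt T * B) + K * sqrt T * B * (1 + norm x)"
      proof (intro add_mono mult_right_mono cx)
        show "K * sqrt T * B \<le> K * sqrt T * B * (1 + norm x)" using KB by (simp add: mult_le_cancel_left1)
      qed (use KB in auto)
      also have "\<dots> = C0 * (1 + norm x)" unfolding C0_def by (simp add: algebra_simps)
      finally show ?thesis .
    qed
    show "(p \<tau> has_derivative P1 \<tau> x) (at x)" if "0 < \<tau>" for \<tau> x by (rule p_has_derivative[OF that])
    show "((\<lambda>s. P1 \<tau> (x + s *\<^sub>R a) a) has_vector_derivative P2 \<tau> x a) (at 0)" if "0 < \<tau>" for \<tau> x a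
      by (rule P1_has_derivative[OF that])
    show "P2 \<tau> x (- a) = P2 \<tau> x a" for \<tau> x a by (rule P2_even)
    show "((\<lambda>\<tau>. p \<tau> x) has_vector_derivative Pt \<tau> x) (at \<tau>)" if "0 < \<tau>" for \<tau> x
      by (rule p_has_time_derivative[OF that])
    show "Pt \<tau> x = (1/2) *\<^sub>R (\<Sum>b\<in>S. P2 \<tau> x b) - P1 \<tau> x (p \<tau> x)"
      if "0 < \<tau>" "finite S" "pairwise orthogonal S" "\<And>b. b \<in> S \<Longrightarrow> norm b = 1" "card S = DIM('a)" "span S = UNIV"
      for \<tau> x S using p_equation[OF that] .
  qed
  show ?thesis by (rule fL_monotone_final)
qed

text \<open>Rewriting the mean of \<open>G\<close> through the Gaussian weight (x - y) / \<tau>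
  removes \<open>G\<close> from the formula. Limits of potentials can then be taken without any
  convergence of their gradients.\<close>

lemma p_eq:
  assumes \<tau>: "0 < \<tau>"
  shows "p \<tau> x = HI \<tau> (\<lambda>y. dens y *\<^sub>R (x - y)) x /\<^sub>R (\<tau> * D \<tau> x)"
proof (rule vector_eq_rdot[THEN iffD1], rule allI)
  fix a
  have "D1 \<tau> x a = HI \<tau> (\<lambda>y. (- 1 / \<tau>) * ((dens y *\<^sub>R (x - y)) \<bullet> a)) x"
    unfolding D1_def by (rule arg_cong[where f = "\<lambda>\<Phi>. HI \<tau> \<Phi> x"]) (use \<tau> in \<open>simp add: fun_eq_iff field_simps inner_diff_left\<close>)
  also have "\<dots> = (- 1 / \<tau>) * (HI \<tau> (\<lambda>y. dens y *\<^sub>R (x - y)) x \<bullet> a)"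
    unfolding HI_cmult by (subst HI_inner[OF \<tau>]) (intro growth_intros, simp)
  finally show "p \<tau> x \<bullet> a = (HI \<tau> (\<lambda>y. dens y *\<^sub>R (x - y)) x /\<^sub>R (\<tau> * D \<tau> x)) \<bullet> a"
    using D1_eq[OF \<tau>, of x a] D_pos[OF \<tau>, of x] \<tau> by (simp add: field_simps)
qed

theorem fL_monotone_HI:
  assumes "0 < \<tau>"
  shows "fL_monotone L (\<lambda>x. HI \<tau> (\<lambda>y. exp (- g y) *\<^sub>R (x - y)) x /\<^sub>R (\<tau> * HI \<tau> (\<lambda>y. exp (- g y)) x))"
proof -
  have "p \<tau> = (\<lambda>x. HI \<tau> (\<lambda>y. exp (- g y) *\<^sub>R (x - y)) x /\<^sub>R (\<tau> * HI \<tau> (\<lambda>y. exp (- g y)) x))"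
    using p_eq[OF assms] unfolding D_def dens_def[abs_def] by auto
  then show ?thesis using fL_monotone_p[OF assms] by simp
qed

end

section \<open>Moreau envelopes\<close>

locale moreau =
  fixes L l :: real and g :: "'a::euclidean_space \<Rightarrow> real" and G :: "'a \<Rightarrow> 'a"
  assumes L: "L > 0" and l: "l > 0" "l * L < 1"
    and g: "\<And>x. (g has_derivative (\<lambda>h. G x \<bullet> h)) (at x)"
    and mono: "fL_monotone L G"
begin

definition slope :: real where "slope = norm (G 0) + 2 * sqrt L"

lemma slope_nonneg: "0 \<le> slope"
  using L by (simp add: slope_def)

lemma g_ge: "g 0 - slope * norm x \<le> g x"
  unfolding slope_def by (rule potential_lower_bound[OF L mono g])

lemma g_shift_ge: "g 0 - slope * norm x - slope * norm (q - x) \<le> g q"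
proof -
  have "slope * norm q \<le> slope * (norm x + norm (q - x))"
    using slope_nonneg norm_triangle_sub[of q x] by (intro mult_left_mono) auto
  then show ?thesis using g_ge[of q] by (simp add: algebra_simps)
qed

text \<open>g decreases at most linearly, so the quadratic term makes the objective coercive; the
  minimiser over a large ball is global, hence stationary.\<close>

lemma prox_exists:
  "\<exists>q. q + l *\<^sub>R G q = x \<and> (\<forall>z. g q + (norm (q - x))\<^sup>2 / (2 * l) \<le> g z + (norm (z - x))\<^sup>2 / (2 * l))"
proof -
  define \<phi> where "\<phi> z = g z + (norm (z - x))\<^sup>2 / (2 * l)" for z
  define A where "A = \<bar>g x - g 0\<bar> + slope * norm x"
  have A: "A \<ge> 0" using slope_nonneg by (simp add: A_def)
  \<comment> \<open>For \<rho> > R one gets \<rho> >= 1 and \<rho> / (2 l) - slope >= A + 1, so the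
    quadratic gain exceeds A, which bounds g(x) minus the linear lower bound.\<close>
  define R where "R = 1 + 2 * l * (slope + A + 1)"
  have R: "R \<ge> 1" using l slope_nonneg A by (simp add: R_def)
  have far: "\<phi> x \<le> \<phi> z" if "z \<notin> cball x R" for z
  proof -
    define \<rho> where "\<rho> = norm (z - x)"
    have \<rho>: "\<rho> > R" using that by (simp add: \<rho>_def dist_norm norm_minus_commute)
    then have "2 * l * (slope + A + 1) \<le> \<rho>" by (simp add: R_def)
    then have "slope + A + 1 \<le> \<rho> / (2 * l)" using l by (simp add: field_simps)
    then have "1 * (A + 1) \<le> \<rho> * (\<rho> / (2 * l) - slope)" using \<rho> R A by (intro mult_mono) auto
    then have "A \<le> \<rho>\<^sup>2 / (2 * l) - slope * \<rho>" by (simp add: power2_eq_square algebra_simps)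
    then show ?thesis using g_shift_ge[of x z] unfolding \<phi>_def \<rho>_def A_def by simp
  qed
  have der: "(\<phi> has_derivative (\<lambda>h. G z \<bullet> h + ((z - x) \<bullet> h) / l)) (at z)" for z
    unfolding \<phi>_def power2_norm_eq_inner using g[of z] l
    by (auto intro!: derivative_eq_intros simp: fun_eq_iff field_simps inner_commute)
  have "continuous_on (cball x R) \<phi>"
    by (intro continuous_at_imp_continuous_on ballI has_derivative_continuous[OF der])
  then obtain q where q: "q \<in> cball x R" "\<And>z. z \<in> cball x R \<Longrightarrow> \<phi> q \<le> \<phi> z"
    using continuous_attains_inf[OF compact_cball, of x R \<phi>] R by force
  have min: "\<phi> q \<le> \<phi> z" for z
  proof (cases "z \<in> cball x R")
    case False
    have "\<phi> q \<le> \<phi> x" using q(2)[of x] R by simp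
    then show ?thesis using far[OF False] by linarith
  qed (rule q(2))
  have "(\<lambda>h. G q \<bullet> h + ((q - x) \<bullet> h) / l) = (\<lambda>h. 0)"
    by (rule has_derivative_local_min[OF der]) (simp add: min)
  then have "(q + l *\<^sub>R G q - x) \<bullet> h = 0" for h
    using l by (simp add: fun_eq_iff field_simps inner_simps)
  then have "q + l *\<^sub>R G q - x = 0" by (metis inner_eq_zero_iff)
  then show ?thesis using min unfolding \<phi>_def by (intro exI[of _ q]) auto
qed

text \<open>The proximal map, or resolvent of l G. It is chosen with both stationarity, from which
  the expansion estimates follow, and global minimality, which makes \<open>env\<close> the Moreau
  envelope.\<close>

definition J :: "'a \<Rightarrow> 'a" where
  "J x = (SOME q. q + l *\<^sub>R G q = x \<and> (\<forall>z. g q + (norm (q - x))\<^sup>2 / (2 * l) \<le> g z + (norm (z - x))\<^sup>2 / (2 * l)))"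

definition env :: "'a \<Rightarrow> real" where "env x = g (J x) + (norm (J x - x))\<^sup>2 / (2 * l)"

lemma J_eq: "J x + l *\<^sub>R G (J x) = x"
  and env_min: "env x \<le> g z + (norm (z - x))\<^sup>2 / (2 * l)"
  using someI_ex[OF prox_exists[of x]] unfolding env_def J_def by blast+

lemma env_le: "env x \<le> g x"
  using env_min[of x x] by simp

text \<open>The loss slope^2 l / 2 stays bounded as l decreases, so all envelopes share one linear
  lower bound and hence one dominating function for exp(-env).\<close>

lemma env_ge: "g 0 - slope * norm x - slope\<^sup>2 * l / 2 \<le> env x"
proof -
  define \<rho> where "\<rho> = norm (J x - x)"
  have "0 \<le> (\<rho> - slope * l)\<^sup>2 / (2 * l)" using l by simp
  also have "\<dots> = \<rho>\<^sup>2 / (2 * l) - slope * \<rho> + slope\<^sup>2 * l / 2"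
    unfolding power2_diff using l by (simp add: power2_eq_square field_simps)
  finally show ?thesis using g_shift_ge[of x "J x"] unfolding env_def \<rho>_def by simp
qed

text \<open>Comparison with the competitor x; half of the quadratic term absorbs the linear one, and
  the factor l drives J x to x.\<close>

lemma J_near: "(norm (J x - x))\<^sup>2 \<le> 4 * l * (g x - g 0 + slope * norm x + slope\<^sup>2 * l)"
proof -
  define \<rho> where "\<rho> = norm (J x - x)"
  have "0 \<le> (\<rho> - 2 * slope * l)\<^sup>2 / (4 * l)" using l by simp
  also have "\<dots> = \<rho>\<^sup>2 / (4 * l) - slope * \<rho> + slope\<^sup>2 * l"
    unfolding power2_diff using l by (simp add: power2_eq_square field_simps)
  finally have "\<rho>\<^sup>2 / (4 * l) \<le> g x - g 0 + slope * norm x + slope\<^sup>2 * l"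
    using g_shift_ge[of x "J x"] env_le[of x] unfolding env_def \<rho>_def by (simp add: field_simps)
  then show ?thesis unfolding \<rho>_def using l by (simp add: field_simps)
qed

text \<open>Test x - y = w + l (G(J x) - G(J y)) against w = J x - J y: monotonicity bounds the last
  product below by -l |w| f(|w|), and Cauchy-Schwarz bounds the left side by |x - y| |w|.\<close>

lemma J_expand:
  "norm (J x - J y) - l * fL L (norm (J x - J y)) \<le> norm (x - y)"
proof (cases "J x = J y")
  case False
  define w where "w = J x - J y"
  define \<rho> where "\<rho> = norm w"
  have \<rho>: "\<rho> > 0" using False by (simp add: \<rho>_def w_def)
  have z: "x - y = w + l *\<^sub>R (G (J x) - G (J y))"
    using J_eq[of x] J_eq[of y] unfolding w_def by (simp add: algebra_simps)
  have "- (\<rho> * fL L \<rho>) \<le> (G (J x) - G (J y)) \<bullet> w"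
    using mono unfolding fL_monotone_def \<rho>_def w_def by blast
  then have "l * - (\<rho> * fL L \<rho>) \<le> l * ((G (J x) - G (J y)) \<bullet> w)" using l by (intro mult_left_mono) auto
  then have "\<rho> * (\<rho> - l * fL L \<rho>) \<le> (x - y) \<bullet> w"
    unfolding z by (simp add: \<rho>_def inner_add_left dot_square_norm power2_eq_square algebra_simps)
  also have "\<dots> \<le> norm (x - y) * \<rho>" unfolding \<rho>_def by (rule norm_cauchy_schwarz)
  finally have "\<rho> * (\<rho> - l * fL L \<rho>) \<le> \<rho> * norm (x - y)" by (simp only: mult.commute)
  then show ?thesis using \<rho> unfolding \<rho>_def w_def by simp
qed simp

lemma J_lipschitz: "(1 - l * L) * norm (J x - J y) \<le> norm (x - y)"
proof -
  have "l * fL L (norm (J x - J y)) \<le> l * (L * norm (J x - J y))"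
    using l L by (intro mult_left_mono fL_le_linear) auto
  then show ?thesis using J_expand[of x y] by (simp add: algebra_simps)
qed

lemma G_J: "G (J x) = (x - J x) /\<^sub>R l"
proof -
  have "l *\<^sub>R G (J x) = x - J x" using J_eq[of x] by (metis add_diff_cancel_left')
  then show ?thesis using l by (metis divideR_right order_less_irrefl)
qed

definition lip :: real where "lip = (1 + 1 / (1 - l * L)) / l"

lemma G_J_lipschitz: "norm (G (J x) - G (J y)) \<le> lip * norm (x - y)"
proof -
  have "norm (J x - J y) \<le> norm (x - y) / (1 - l * L)"
    using J_lipschitz[of x y] l by (simp add: field_simps)
  then have "norm ((x - y) - (J x - J y)) \<le> (1 + 1 / (1 - l * L)) * norm (x - y)"
    using norm_triangle_ineq4[of "x - y" "J x - J y"] by (simp add: algebra_simps)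
  moreover have "G (J x) - G (J y) = ((x - y) - (J x - J y)) /\<^sub>R l" unfolding G_J by (simp add: algebra_simps)
  ultimately show ?thesis unfolding lip_def using l
    by (simp add: inverse_eq_divide divide_right_mono)
qed

text \<open>The upper expansion inserts J x as a competitor at y. Exchanging x and y gives a lower
  expansion with slope G(J y), and the Lipschitz bound on x \<mapsto> G(J x) replaces it by G(J x)
  at the cost lip |y - x|^2.\<close>

lemma env_has_derivative: "(env has_derivative (\<lambda>h. G (J x) \<bullet> h)) (at x)"
proof -
  define C where "C = lip + 1 / (2 * l)"
  have lip0: "0 \<le> lip" unfolding lip_def using l by simp
  have upper: "env y - env x \<le> G (J x) \<bullet> (y - x) + (norm (y - x))\<^sup>2 / (2 * l)" for x y
  proof -
    have "(norm (J x - y))\<^sup>2 - (norm (J x - x))\<^sup>2 = 2 * ((x - J x) \<bullet> (y - x)) + (norm (y - x))\<^sup>2"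
      unfolding power2_norm_eq_inner by (simp add: inner_simps inner_commute algebra_simps)
    moreover have "G (J x) \<bullet> (y - x) = ((x - J x) \<bullet> (y - x)) / l"
      unfolding G_J by (simp add: divide_inverse mult.commute)
    ultimately have "((norm (J x - y))\<^sup>2 - (norm (J x - x))\<^sup>2) / (2 * l) = G (J x) \<bullet> (y - x) + (norm (y - x))\<^sup>2 / (2 * l)"
      using l by (simp add: field_simps)
    then show ?thesis using env_min[of y "J x"] unfolding env_def[of x] by (simp add: diff_divide_distrib)
  qed
  have both: "\<bar>env y - env x - G (J x) \<bullet> (y - x)\<bar> \<le> C * (norm (y - x))\<^sup>2" for y
  proof -
    have "(norm (y - x))\<^sup>2 / (2 * l) \<le> C * (norm (y - x))\<^sup>2"
      using lip0 by (simp add: C_def algebra_simps)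
    then have up: "env y - env x - G (J x) \<bullet> (y - x) \<le> C * (norm (y - x))\<^sup>2" using upper[of y x] by linarith
    have "(G (J y) - G (J x)) \<bullet> (y - x) \<ge> - (norm (G (J y) - G (J x)) * norm (y - x))"
      using Cauchy_Schwarz_ineq2[of "G (J y) - G (J x)" "y - x"] by linarith
    moreover have "norm (G (J y) - G (J x)) * norm (y - x) \<le> lip * norm (y - x) * norm (y - x)"
      by (intro mult_right_mono G_J_lipschitz) auto
    ultimately have "(G (J y) - G (J x)) \<bullet> (y - x) \<ge> - (lip * (norm (y - x))\<^sup>2)"
      by (simp add: power2_eq_square)
    moreover have "env x - env y \<le> - (G (J y) \<bullet> (y - x)) + (norm (y - x))\<^sup>2 / (2 * l)"
      using upper[of x y] by (simp add: inner_diff_right norm_minus_commute)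
    ultimately have "env y - env x - G (J x) \<bullet> (y - x) \<ge> - (C * (norm (y - x))\<^sup>2)"
      by (simp add: C_def inner_diff_left algebra_simps)
    then show ?thesis using up by linarith
  qed
  have "((\<lambda>y. norm (env y - env x - G (J x) \<bullet> (y - x)) / norm (y - x)) \<longlongrightarrow> 0) (at x)"
  proof (rule Lim_null_comparison)
    show "\<forall>\<^sub>F y in at x. norm (norm (env y - env x - G (J x) \<bullet> (y - x)) / norm (y - x)) \<le> C * norm (y - x)"
      unfolding eventually_at_filter
      using both by (auto intro!: always_eventually simp: divide_le_eq power2_eq_square mult.assoc)
    have "((\<lambda>y. C * norm (y - x)) \<longlongrightarrow> C * norm (x - x)) (at x)" by (intro tendsto_intros)
    then show "((\<lambda>y. C * norm (y - x)) \<longlongrightarrow> 0) (at x)" by simp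
  qed
  then show ?thesis unfolding has_derivative_iff_norm by (simp add: bounded_linear_inner_right)
qed

text \<open>The difference of gradients is ((x - y) - (J x - J y)) / l. Paired with x - y it is at
  least r (r - \<rho>) / l >= -r f(\<rho>) by \<open>J_expand\<close>, and \<rho> <= r / (1 - l L)
  is absorbed by enlarging L as in \<open>fL_scale_le\<close>.\<close>

lemma env_fL_monotone: "fL_monotone (L / (1 - l * L)\<^sup>2) (\<lambda>x. G (J x))"
  unfolding fL_monotone_def
proof (intro allI)
  fix x y :: 'a
  define r where "r = norm (x - y)"
  define \<rho> where "\<rho> = norm (J x - J y)"
  have "(x - y) \<bullet> (J x - J y) \<le> r * \<rho>" unfolding r_def \<rho>_def by (rule norm_cauchy_schwarz)
  moreover have "((x - y) - (J x - J y)) \<bullet> (x - y) = r\<^sup>2 - (x - y) \<bullet> (J x - J y)"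
    unfolding r_def power2_norm_eq_inner
    by (subst inner_diff_left) (simp only: inner_commute[of "J x - J y"])
  ultimately have "r\<^sup>2 - r * \<rho> \<le> ((x - y) - (J x - J y)) \<bullet> (x - y)" by linarith
  moreover have "(G (J x) - G (J y)) \<bullet> (x - y) = (((x - y) - (J x - J y)) \<bullet> (x - y)) / l"
    unfolding G_J scaleR_diff_right[symmetric] by (simp add: divide_inverse mult.commute algebra_simps)
  ultimately have 1: "(r\<^sup>2 - r * \<rho>) / l \<le> (G (J x) - G (J y)) \<bullet> (x - y)"
    using l by (simp add: divide_right_mono)
  have "r * (\<rho> - r) \<le> r * (l * fL L \<rho>)"
    using J_expand[of x y] unfolding r_def \<rho>_def by (intro mult_left_mono) auto
  then have "- (r * fL L \<rho>) \<le> (r\<^sup>2 - r * \<rho>) / l"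
    using l by (simp add: field_simps power2_eq_square)
  moreover have "r * fL L \<rho> \<le> r * fL (L / (1 - l * L)\<^sup>2) r"
    using L l J_lipschitz[of x y] unfolding r_def \<rho>_def by (intro mult_left_mono fL_scale_le) auto
  ultimately show "- (norm (x - y) * fL (L / (1 - l * L)\<^sup>2) (norm (x - y))) \<le> (G (J x) - G (J y)) \<bullet> (x - y)"
    using 1 unfolding r_def by linarith
qed

lemma env_lipschitz_potential:
  "lipschitz_potential (L / (1 - l * L)\<^sup>2) lip env (\<lambda>x. G (J x))"
proof
  show "0 < L / (1 - l * L)\<^sup>2" using L l by simp
  show "0 \<le> lip" unfolding lip_def using l by simp
qed (fact env_has_derivative G_J_lipschitz env_fL_monotone)+

end

section \<open>Approximation and passage to the limit\<close>

lemma moreau_approximation: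
  fixes g :: "'a::euclidean_space \<Rightarrow> real"
  assumes L: "L > 0" and g: "\<And>x. (g has_derivative (\<lambda>h. G x \<bullet> h)) (at x)" and mono: "fL_monotone L G"
  obtains Ln Kn gn Gn A B where "\<And>n::nat. lipschitz_potential (Ln n) (Kn n) (gn n) (Gn n)"
    "Ln \<longlonglongrightarrow> L" "\<And>x. (\<lambda>n. gn n x) \<longlonglongrightarrow> g x" "\<And>n x. - A - B * norm x \<le> gn n x"
proof -
  \<comment> \<open>The 2 makes l L <= 1/2 already at n = 0, so that every index satisfies l L <
    1.\<close>
  define l where "l n = 1 / (L * (real n + 2))" for n
  have lL: "l n * L = 1 / (real n + 2)" for n unfolding l_def using L by simp
  have l0: "l n > 0" for n unfolding l_def using L by simp
  have l1: "l n \<le> 1 / L" for n unfolding l_def using L by (intro divide_left_mono) auto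
  have mor: "moreau L (l n) g G" for n
    by unfold_locales (use L g mono l0 lL in auto)
  have l_lim: "l \<longlonglongrightarrow> 0"
  proof -
    have "(\<lambda>n. (1 / L) * inverse (real (Suc (Suc n)))) \<longlonglongrightarrow> (1 / L) * 0"
      by (intro tendsto_intros LIMSEQ_Suc[OF LIMSEQ_inverse_real_of_nat])
    moreover have "l = (\<lambda>n. (1 / L) * inverse (real (Suc (Suc n))))"
      unfolding l_def using L by (simp add: fun_eq_iff field_simps)
    ultimately show ?thesis by simp
  qed
  define s where "s = norm (G 0) + 2 * sqrt L"
  have s: "moreau.slope L G = s" using moreau.slope_def[OF mor] by (simp add: s_def)
  define gn where "gn n = moreau.env (l n) g G" for n
  show ?thesis
  proof (rule that[where Ln = "\<lambda>n. L / (1 - l n * L)\<^sup>2" and Kn = "\<lambda>n. moreau.lip L (l n)" and gn = gn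
        and Gn = "\<lambda>n x. G (moreau.J (l n) g G x)" and A = "s\<^sup>2 * (1 / L) / 2 - g 0" and B = s])
    show "lipschitz_potential (L / (1 - l n * L)\<^sup>2) (moreau.lip L (l n)) (gn n) (\<lambda>x. G (moreau.J (l n) g G x))" for n
      unfolding gn_def by (rule moreau.env_lipschitz_potential[OF mor])
    have "(\<lambda>n. L / (1 - l n * L)\<^sup>2) \<longlonglongrightarrow> L / (1 - 0 * L)\<^sup>2"
      by (rule tendsto_divide[OF tendsto_const tendsto_power[OF tendsto_diff[OF tendsto_const
              tendsto_mult[OF l_lim tendsto_const]]]]) simp
    then show "(\<lambda>n. L / (1 - l n * L)\<^sup>2) \<longlonglongrightarrow> L" by simp
    show "- (s\<^sup>2 * (1 / L) / 2 - g 0) - s * norm x \<le> gn n x" for n x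
    proof -
      have "s\<^sup>2 * l n / 2 \<le> s\<^sup>2 * (1 / L) / 2" by (intro divide_right_mono mult_left_mono l1) auto
      then show ?thesis using moreau.env_ge[OF mor, of x n] unfolding s gn_def by linarith
    qed
    show "(\<lambda>n. gn n x) \<longlonglongrightarrow> g x" for x
    proof -
      define q where "q n = moreau.J (l n) g G x" for n
      have "(\<lambda>n. (norm (q n - x))\<^sup>2) \<longlonglongrightarrow> 0"
      proof (rule tendsto_sandwich[where f = "\<lambda>_. 0" and h = "\<lambda>n. 4 * l n * (g x - g 0 + s * norm x + s\<^sup>2 * l n)"])
        show "\<forall>\<^sub>F n in sequentially. (norm (q n - x))\<^sup>2 \<le> 4 * l n * (g x - g 0 + s * norm x + s\<^sup>2 * l n)"
          unfolding q_def by (rule always_eventually[OF allI[OF moreau.J_near[OF mor, unfolded s]]])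
        have "(\<lambda>n. 4 * l n * (g x - g 0 + s * norm x + s\<^sup>2 * l n)) \<longlonglongrightarrow> 4 * 0 * (g x - g 0 + s * norm x + s\<^sup>2 * 0)"
          by (intro tendsto_intros l_lim)
        then show "(\<lambda>n. 4 * l n * (g x - g 0 + s * norm x + s\<^sup>2 * l n)) \<longlonglongrightarrow> 0" by simp
      qed auto
      then have "(\<lambda>n. sqrt ((norm (q n - x))\<^sup>2)) \<longlonglongrightarrow> sqrt 0" by (rule tendsto_real_sqrt)
      then have "(\<lambda>n. norm (q n - x)) \<longlonglongrightarrow> 0" by simp
      then have "q \<longlonglongrightarrow> x" by (rule LIM_zero_cancel[OF tendsto_norm_zero_cancel])
      then have lim: "(\<lambda>n. g (q n)) \<longlonglongrightarrow> g x"
        by (rule isCont_tendsto_compose[OF has_derivative_continuous[OF g]])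
      \<comment> \<open>The envelope is squeezed between g (J x) and g x; J x tends to x and g is
        continuous.\<close>
      have lo: "g (q n) \<le> gn n x" for n
        using moreau.env_def[OF mor, of n x] l0[of n] unfolding gn_def q_def by simp
      have up: "gn n x \<le> g x" for n unfolding gn_def by (rule moreau.env_le[OF mor])
      show ?thesis
        by (rule tendsto_sandwich[OF always_eventually[OF allI[OF lo]] always_eventually[OF allI[OF up]] lim tendsto_const])
    qed
  qed
qed

lemma HI_tendsto:
  assumes \<tau>: "0 < \<tau>" and \<Psi>: "exp_growth \<Psi>"
    and m: "\<And>n. \<Phi>n n \<in> borel_measurable borel" "\<Phi> \<in> borel_measurable borel"
    and lim: "\<And>y. (\<lambda>n. \<Phi>n n y) \<longlonglongrightarrow> \<Phi> y" and bnd: "\<And>n y. norm (\<Phi>n n y) \<le> \<Psi> y"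
  shows "(\<lambda>n. HI \<tau> (\<Phi>n n) x) \<longlonglongrightarrow> HI \<tau> \<Phi> x"
  unfolding HI_def
proof (rule integral_dominated_convergence[where w = "\<lambda>y. hk \<tau> x y *\<^sub>R \<Psi> y"])
  show "(\<lambda>y. hk \<tau> x y *\<^sub>R \<Phi> y) \<in> borel_measurable lborel"
    "(\<lambda>y. hk \<tau> x y *\<^sub>R \<Phi>n n y) \<in> borel_measurable lborel" for n using m by auto
  show "integrable lborel (\<lambda>y. hk \<tau> x y *\<^sub>R \<Psi> y)" by (rule integrable_hk[OF \<tau> \<Psi>])
  show "AE y in lborel. (\<lambda>n. hk \<tau> x y *\<^sub>R \<Phi>n n y) \<longlonglongrightarrow> hk \<tau> x y *\<^sub>R \<Phi> y"
    using lim by (auto intro!: tendsto_intros)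
  show "AE y in lborel. norm (hk \<tau> x y *\<^sub>R \<Phi>n n y) \<le> hk \<tau> x y *\<^sub>R \<Psi> y" for n
    using bnd by (auto intro!: mult_left_mono)
qed

text \<open>The two-point inequality is closed under pointwise limits of the gradients and of the
  constants \<open>Ln\<close>; the approximating gradients converge because their formula contains
  only the potentials, with integrands dominated by one function of exponential growth.\<close>

lemma fL_monotone_heat_flow:
  fixes g :: "'a::euclidean_space \<Rightarrow> real"
  assumes L: "L > 0" and g: "\<And>x. (g has_derivative (\<lambda>h. G x \<bullet> h)) (at x)" and mono: "fL_monotone L G"
    and \<tau>: "0 < \<tau>"
  shows "fL_monotone L (\<lambda>x. HI \<tau> (\<lambda>y. exp (- g y) *\<^sub>R (x - y)) x /\<^sub>R (\<tau> * HI \<tau> (\<lambda>y. exp (- g y)) x))"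
proof -
  obtain Ln Kn gn Gn A B where n: "\<And>n::nat. lipschitz_potential (Ln n) (Kn n) (gn n) (Gn n)"
    "Ln \<longlonglongrightarrow> L" "\<And>x. (\<lambda>n. gn n x) \<longlonglongrightarrow> g x" "\<And>n x. - A - B * norm x \<le> gn n x"
    using moreau_approximation[OF L g mono] by blast
  define Gu where "Gu h x = HI \<tau> (\<lambda>y. exp (- h y) *\<^sub>R (x - y)) x /\<^sub>R (\<tau> * HI \<tau> (\<lambda>y. exp (- h y)) x)" for h and x :: 'a
  define \<Psi> where "\<Psi> y = exp A * exp (B * norm y)" for y :: 'a
  have \<Psi>: "exp_growth \<Psi>" unfolding \<Psi>_def
    by (rule exp_growthI[where A = "exp A" and B = B]) auto
  have bnd: "exp (- gn n y) \<le> \<Psi> y" for n y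
    unfolding \<Psi>_def using n(4)[where n = n and x = y] by (simp flip: exp_add)
  have gm: "g \<in> borel_measurable borel"
    by (intro borel_measurable_continuous_onI continuous_at_imp_continuous_on ballI has_derivative_continuous[OF g])
  have gnm: "gn n \<in> borel_measurable borel" for n
    using lipschitz_potential.g[OF n(1)[of n]]
    by (intro borel_measurable_continuous_onI continuous_at_imp_continuous_on ballI) (blast intro: has_derivative_continuous)
  have elim: "(\<lambda>n. exp (- gn n y)) \<longlonglongrightarrow> exp (- g y)" for y by (intro tendsto_intros n(3))
  have Dlim: "(\<lambda>n. HI \<tau> (\<lambda>y. exp (- gn n y)) x) \<longlonglongrightarrow> HI \<tau> (\<lambda>y. exp (- g y)) x" for x
    by (rule HI_tendsto[OF \<tau> \<Psi>]) (use gm gnm elim bnd in auto)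
  have Nlim: "(\<lambda>n. HI \<tau> (\<lambda>y. exp (- gn n y) *\<^sub>R (x - y)) x) \<longlonglongrightarrow> HI \<tau> (\<lambda>y. exp (- g y) *\<^sub>R (x - y)) x" for x
  proof (rule HI_tendsto[OF \<tau>])
    show "exp_growth (\<lambda>y. \<Psi> y * norm (x - y))" by (intro exp_growth_intros \<Psi>)
    show "norm (exp (- gn n y) *\<^sub>R (x - y)) \<le> \<Psi> y * norm (x - y)" for n y
      using bnd[of n y] by (simp add: mult_right_mono)
    show "(\<lambda>n. exp (- gn n y) *\<^sub>R (x - y)) \<longlonglongrightarrow> exp (- g y) *\<^sub>R (x - y)" for y
      by (intro tendsto_intros elim)
  qed (use gm gnm in auto)
  have "HI \<tau> (\<lambda>y. exp (- g y)) x > 0" for x by (rule HI_pos[OF \<tau> exp_growth_exp_neg[OF L mono g]]) simp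
  then have lim: "(\<lambda>n. Gu (gn n) x) \<longlonglongrightarrow> Gu g x" for x
    unfolding Gu_def using \<tau> by (intro tendsto_intros Dlim Nlim) (simp add: less_imp_neq[symmetric])
  have "fL_monotone L (Gu g)" unfolding fL_monotone_def
  proof (intro allI)
    fix x y :: 'a
    have "(\<lambda>n. - (norm (x - y) * fL (Ln n) (norm (x - y)))) \<longlonglongrightarrow> - (norm (x - y) * fL L (norm (x - y)))"
      unfolding fL_def by (intro tendsto_intros n(2)) (use cosh_real_pos in \<open>auto simp: less_le\<close>)
    moreover have "(\<lambda>n. (Gu (gn n) x - Gu (gn n) y) \<bullet> (x - y)) \<longlonglongrightarrow> (Gu g x - Gu g y) \<bullet> (x - y)"
      by (intro tendsto_intros lim)
    moreover have "- (norm (x - y) * fL (Ln n) (norm (x - y))) \<le> (Gu (gn n) x - Gu (gn n) y) \<bullet> (x - y)" for n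
      using lipschitz_potential.fL_monotone_HI[OF n(1) \<tau>, of n] unfolding fL_monotone_def Gu_def by blast
    ultimately show "- (norm (x - y) * fL L (norm (x - y))) \<le> (Gu g x - Gu g y) \<bullet> (x - y)"
      by (intro LIMSEQ_le[where X = "\<lambda>n. - (norm (x - y) * fL (Ln n) (norm (x - y)))"]) auto
  qed
  then show ?thesis unfolding Gu_def .
qed

theorem theorem3:
  fixes L T t :: real and g :: "'a::euclidean_space \<Rightarrow> real"
  assumes "L > 0" and "0 \<le> t" and "t \<le> T" and "g \<in> FL L"
  shows "UTg T g t \<in> FL L"
proof (cases "t = T")
  case True
  then show ?thesis using assms(4) by (simp add: UTg_def[abs_def])
next
  case False
  define \<tau> where "\<tau> = T - t"
  have \<tau>: "0 < \<tau>" using False assms by (simp add: \<tau>_def)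
  obtain G where G: "\<And>x. (g has_derivative (\<lambda>h. G x \<bullet> h)) (at x)" and mono: "fL_monotone L G"
    using assms(4) unfolding FL_iff by blast
  have dens: "exp_growth (\<lambda>y. exp (- g y))" by (rule exp_growth_exp_neg[OF assms(1) mono G])
  define D where "D x = HI \<tau> (\<lambda>y. exp (- g y)) x" for x
  define Gu where "Gu x = HI \<tau> (\<lambda>y. exp (- g y) *\<^sub>R (x - y)) x /\<^sub>R (\<tau> * D x)" for x
  define c where "c = (2 * pi * \<tau>) powr (- real DIM('a) / 2)"
  have c: "c > 0" unfolding c_def using \<tau> by simp
  have D_pos: "D x > 0" for x unfolding D_def by (rule HI_pos[OF \<tau> dens]) simp
  have U: "UTg T g t = (\<lambda>x. - ln (c * D x))"
  proof
    fix x
    have "hk \<tau> x y *\<^sub>R exp (- g y) = exp (- (norm (y - x))\<^sup>2 / (2 * (T - t)) - g y)" for y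
      unfolding hk_def \<tau>_def by (simp flip: exp_add)
    then show "UTg T g t x = - ln (c * D x)"
      using False unfolding UTg_def D_def HI_def c_def \<tau>_def by simp
  qed
  \<comment> \<open>The integrand depends on x, so it is split into Gaussian integrals of functions
    independent of x, whose continuity follows from their differentiability.\<close>
  have split: "HI \<tau> (\<lambda>y. exp (- g y) *\<^sub>R (x - y)) z = D z *\<^sub>R x - HI \<tau> (\<lambda>y. exp (- g y) *\<^sub>R y) z" for x z
    unfolding scaleR_diff_right D_def
    by (subst HI_diff[OF \<tau>], (intro exp_growth_intros dens)+, subst HI_scaleR_const[OF \<tau> dens], rule refl)
  \<comment> \<open>The derivative falls on the Gaussian weight and produces (y - x) / \<tau>; G
    itself may grow arbitrarily fast.\<close>
  have derD: "(D has_derivative (\<lambda>h. - (D x * (Gu x \<bullet> h)))) (at x)" for x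
  proof -
    have "HI \<tau> (\<lambda>y. (((y - x) \<bullet> h) / \<tau>) *\<^sub>R exp (- g y)) x = - (D x * (Gu x \<bullet> h))" for h
    proof -
      have "HI \<tau> (\<lambda>y. (((y - x) \<bullet> h) / \<tau>) *\<^sub>R exp (- g y)) x
         = HI \<tau> (\<lambda>y. (- 1 / \<tau>) * ((exp (- g y) *\<^sub>R (x - y)) \<bullet> h)) x"
        by (rule arg_cong[where f = "\<lambda>\<Phi>. HI \<tau> \<Phi> x"])
           (use \<tau> in \<open>simp add: fun_eq_iff field_simps inner_diff_left\<close>)
      also have "\<dots> = (- 1 / \<tau>) * (HI \<tau> (\<lambda>y. exp (- g y) *\<^sub>R (x - y)) x \<bullet> h)"
        unfolding HI_cmult by (subst HI_inner[OF \<tau>]) (intro exp_growth_intros dens, simp)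
      finally show ?thesis unfolding Gu_def using D_pos[of x] \<tau> by (simp add: field_simps)
    qed
    then show ?thesis using HI_has_derivative[OF \<tau> dens, of x] unfolding D_def by simp
  qed
  have "(UTg T g t has_derivative (\<lambda>h. Gu x \<bullet> h)) (at x)" for x
    unfolding U using D_pos[of x] c
    by (auto intro!: derivative_eq_intros derD simp: fun_eq_iff field_simps)
  moreover have "continuous_on UNIV Gu"
    unfolding Gu_def split
  proof (intro continuous_intros)
    show "continuous_on UNIV D"
      by (intro continuous_at_imp_continuous_on ballI has_derivative_continuous[OF derD])
    then show "continuous_on UNIV D" .
    show "continuous_on UNIV (HI \<tau> (\<lambda>y. exp (- g y) *\<^sub>R y))"
      by (intro continuous_at_imp_continuous_on ballI, rule has_derivative_continuous, rule HI_has_derivative[OF \<tau>])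
         (intro exp_growth_intros dens)
    show "\<forall>x\<in>UNIV. \<tau> * D x \<noteq> 0" using \<tau> D_pos by (simp add: less_imp_neq[symmetric])
  qed
  moreover have "fL_monotone L Gu"
    using fL_monotone_heat_flow[OF assms(1) G mono \<tau>] unfolding Gu_def D_def .
  ultimately show ?thesis unfolding FL_iff by blast
qed

end
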